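(* Let $N=\{1,\dots,n\}$ be a set of players and $V$ a finite set of resources. For each $i\in N$ let $\omega_i\colon2^V\to\mathbf{R}_+\cup\{+\infty\}$ be a valuated matroid whose effective domain is the strategy set $\mathcal{B}_i$ of player $i$ (the base family of a matroid on $V$), and for each $v\in V$ let $d_v\colon\mathbf{Z}_+\to\mathbf{R}_+$ be a nondecreasing weakly convex function. Consider the matroid congestion game in which, in a state $\mathcal{X}=(X_1,\dots,X_n)$, the cost paid by player $i\in N$ is $$\omega_i(X_i)+\sum_{v\in X_i}d_v\big(x^{(v)}(\mathcal{X})\big).$$ Then a socially optimal state can be computed in strongly polynomial time.
   Context: A state is a tuple $\mathcal{X}=(X_1,\dots,X_n)$ with $X_i\in\mathcal{B}_i$ for each $i\in N$, and $x^{(v)}(\mathcal{X})=|\{i\in N\mid v\in X_i\}|$. A state is socially optimal if it minimizes, over all states, the sum over all players of the costs paid. A function $c\colon\mathbf{Z}_+\to\mathbf{R}$ is weakly convex if $(x+1)c(x+1)-x\,c(x)$ is nondecreasing in $x\in\mathbf{Z}_+$. A function $\omega\colon2^V\to\mathbf{R}\cup\{+\infty\}$, with effective domain $\operatorname{dom}\omega=\{X\mid\omega(X)<+\infty\}$, is a valuated matroid if for all $X,Y\in\operatorname{dom}\omega$ and $v\in X\setminus Y$ there exists $u\in Y\setminus X$ with $\omega(X)+\omega(Y)\ge\omega((X\setminus\{v\})\cup\{u\})+\omega((Y\cup\{v\})\setminus\{u\})$. The functions $\omega_i,d_v$ are given by evaluation oracles, together with a member of each $\operatorname{dom}\omega_i$;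 strongly polynomial means polynomial in $|V|$ and $n$ counting arithmetic operations and oracle calls. *)

theory Defs
  imports "HOL-Library.Extended_Real"
begin

section \<open>Matroid congestion games with weakly convex costs\<close>

definition effective_domain :: "'v set \<Rightarrow> ('v set \<Rightarrow> ereal) \<Rightarrow> 'v set set" where
  "effective_domain V \<omega> = {X. X \<subseteq> V \<and> \<omega> X < \<infinity>}"

text \<open>Values of \<open>\<omega>\<close> on sets that are not contained in \<open>V\<close> are irrelevant throughout.\<close>

definition valuated_matroid :: "'v set \<Rightarrow> ('v set \<Rightarrow> ereal) \<Rightarrow> bool" where
  "valuated_matroid V \<omega> \<longleftrightarrow>
     (\<forall>X. X \<subseteq> V \<longrightarrow> \<omega> X \<noteq> -\<infinity>) \<and>
     (\<forall>X \<in> effective_domain V \<omega>. \<forall>Y \<in> effective_domain V \<omega>. \<forall>v \<in> X - Y. \<exists>u \<in> Y - X.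
        \<omega> X + \<omega> Y \<ge> \<omega> ((X - {v}) \<union> {u}) + \<omega> ((Y \<union> {v}) - {u}))"

definition matroid_base_family :: "'v set \<Rightarrow> 'v set set \<Rightarrow> bool" where
  "matroid_base_family V \<B> \<longleftrightarrow>
     \<B> \<noteq> {} \<and> (\<forall>X \<in> \<B>. X \<subseteq> V) \<and>
     (\<forall>X \<in> \<B>. \<forall>Y \<in> \<B>. \<forall>v \<in> X - Y. \<exists>u \<in> Y - X. (X - {v}) \<union> {u} \<in> \<B>)"

definition weakly_convex :: "(nat \<Rightarrow> real) \<Rightarrow> bool" where
  "weakly_convex c \<longleftrightarrow> mono (\<lambda>x. real (x + 1) * c (x + 1) - real x * c x)"

definition matroid_congestion_game ::
  "nat \<Rightarrow> 'v set \<Rightarrow> (nat \<Rightarrow> 'v set set) \<Rightarrow> (nat \<Rightarrow> 'v set \<Rightarrow> ereal) \<Rightarrow> ('v \<Rightarrow> nat \<Rightarrow> real) \<Rightarrow> bool" where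
  "matroid_congestion_game n V \<B> \<omega> d \<longleftrightarrow>
     finite V \<and>
     (\<forall>i \<in> {1..n}. valuated_matroid V (\<omega> i) \<and> (\<forall>X. X \<subseteq> V \<longrightarrow> 0 \<le> \<omega> i X) \<and>
        \<B> i = effective_domain V (\<omega> i) \<and> matroid_base_family V (\<B> i)) \<and>
     (\<forall>v \<in> V. (\<forall>x. 0 \<le> d v x) \<and> mono (d v) \<and> weakly_convex (d v))"

definition is_state :: "nat \<Rightarrow> (nat \<Rightarrow> 'v set set) \<Rightarrow> (nat \<Rightarrow> 'v set) \<Rightarrow> bool" where
  "is_state n \<B> X \<longleftrightarrow> (\<forall>i \<in> {1..n}. X i \<in> \<B> i)"

definition congestion :: "nat \<Rightarrow> (nat \<Rightarrow> 'v set) \<Rightarrow> 'v \<Rightarrow> nat" where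
  "congestion n X v = card {i \<in> {1..n}. v \<in> X i}"

definition player_cost ::
  "nat \<Rightarrow> (nat \<Rightarrow> 'v set \<Rightarrow> ereal) \<Rightarrow> ('v \<Rightarrow> nat \<Rightarrow> real) \<Rightarrow> (nat \<Rightarrow> 'v set) \<Rightarrow> nat \<Rightarrow> ereal" where
  "player_cost n \<omega> d X i = \<omega> i (X i) + ereal (\<Sum>v \<in> X i. d v (congestion n X v))"

definition social_cost ::
  "nat \<Rightarrow> (nat \<Rightarrow> 'v set \<Rightarrow> ereal) \<Rightarrow> ('v \<Rightarrow> nat \<Rightarrow> real) \<Rightarrow> (nat \<Rightarrow> 'v set) \<Rightarrow> ereal" where
  "social_cost n \<omega> d X = (\<Sum>i \<in> {1..n}. player_cost n \<omega> d X i)"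

definition socially_optimal ::
  "nat \<Rightarrow> (nat \<Rightarrow> 'v set set) \<Rightarrow> (nat \<Rightarrow> 'v set \<Rightarrow> ereal) \<Rightarrow> ('v \<Rightarrow> nat \<Rightarrow> real) \<Rightarrow> (nat \<Rightarrow> 'v set) \<Rightarrow> bool" where
  "socially_optimal n \<B> \<omega> d X \<longleftrightarrow>
     is_state n \<B> X \<and> (\<forall>Y. is_state n \<B> Y \<longrightarrow> social_cost n \<omega> d X \<le> social_cost n \<omega> d Y)"


section \<open>Real-RAM programs with oracle calls\<close>

text \<open>
  A structured real RAM.  The memory consists of named arrays of natural numbers (indices, flags)
  and of real numbers; an array is addressed by a list of indices, the empty list giving a scalar.
  The only literals are natural numbers, and a real number influences control or a natural-number
  cell only through a comparison: arbitrary real constants or a floor operation would make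
  unit-cost computation unreasonably powerful.  For the same reason indices admit only addition
  and truncated subtraction.
\<close>

type_synonym vname = string

datatype nexp =
    NConst nat
  | NVar vname "nexp list"
  | NAdd nexp nexp
  | NSub nexp nexp

datatype rexp =
    ROfNat nexp
  | RVar vname "nexp list"
  | RAdd rexp rexp
  | RSub rexp rexp
  | RMul rexp rexp
  | RDiv rexp rexp

datatype bexp =
    NLess nexp nexp
  | RLess rexp rexp
  | BNot bexp
  | BAnd bexp bexp

datatype com =
    Skip
  | NAssign vname "nexp list" nexp
  | RAssign vname "nexp list" rexp
  | CallOmega vname vname nexp vname "nexp list"
  | CallD vname nexp nexp
  | Seq com com
  | Cond bexp com com
  | While bexp com

datatype store = Store (nmem: "vname \<Rightarrow> nat list \<Rightarrow> nat") (rmem: "vname \<Rightarrow> nat list \<Rightarrow> real")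

definition nupdate :: "vname \<Rightarrow> nat list \<Rightarrow> nat \<Rightarrow> store \<Rightarrow> store" where
  "nupdate x js a s = Store ((nmem s)(x := (nmem s x)(js := a))) (rmem s)"

definition rupdate :: "vname \<Rightarrow> nat list \<Rightarrow> real \<Rightarrow> store \<Rightarrow> store" where
  "rupdate x js a s = Store (nmem s) ((rmem s)(x := (rmem s x)(js := a)))"

fun nval :: "nexp \<Rightarrow> store \<Rightarrow> nat" where
  "nval (NConst k) s = k"
| "nval (NVar x es) s = nmem s x (map (\<lambda>e. nval e s) es)"
| "nval (NAdd a b) s = nval a s + nval b s"
| "nval (NSub a b) s = nval a s - nval b s"

fun rval :: "rexp \<Rightarrow> store \<Rightarrow> real" where
  "rval (ROfNat e) s = real (nval e s)"
| "rval (RVar x es) s = rmem s x (map (\<lambda>e. nval e s) es)"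
| "rval (RAdd a b) s = rval a s + rval b s"
| "rval (RSub a b) s = rval a s - rval b s"
| "rval (RMul a b) s = rval a s * rval b s"
| "rval (RDiv a b) s = rval a s / rval b s"

fun bval :: "bexp \<Rightarrow> store \<Rightarrow> bool" where
  "bval (NLess a b) s \<longleftrightarrow> nval a s < nval b s"
| "bval (RLess a b) s \<longleftrightarrow> rval a s < rval b s"
| "bval (BNot b) s \<longleftrightarrow> \<not> bval b s"
| "bval (BAnd a b) s \<longleftrightarrow> bval a s \<and> bval b s"

text \<open>
  \<open>exec \<Omega> D c s t s'\<close>: started in \<open>s\<close>, the program \<open>c\<close> halts in \<open>s'\<close> after \<open>t\<close> steps, where every
  assignment, test and oracle call counts as one step.  The expressions of a fixed program have
  bounded size, so \<open>t\<close> is, up to a constant factor depending on the program only, an upper bound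
  on the number of arithmetic operations, comparisons and oracle calls.

  \<open>CallOmega f y e A es\<close> asks \<open>\<Omega>\<close> for the value of player \<open>e\<close> at the set whose characteristic vector
  is the row \<open>A[es, _]\<close>; it sets the flag \<open>f\<close> to 1 and \<open>y\<close> to the value if the value is finite, and
  both to 0 otherwise.  \<open>CallD y e k\<close> stores in \<open>y\<close> the value of the cost function of resource \<open>e\<close>
  at \<open>k\<close>.
\<close>

inductive exec ::
  "(nat \<Rightarrow> nat set \<Rightarrow> ereal) \<Rightarrow> (nat \<Rightarrow> nat \<Rightarrow> real) \<Rightarrow> com \<Rightarrow> store \<Rightarrow> nat \<Rightarrow> store \<Rightarrow> bool"
  for \<Omega> :: "nat \<Rightarrow> nat set \<Rightarrow> ereal" and D :: "nat \<Rightarrow> nat \<Rightarrow> real" where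
  Skip: "exec \<Omega> D Skip s 1 s"
| NAssign: "exec \<Omega> D (NAssign x es e) s 1 (nupdate x (map (\<lambda>e. nval e s) es) (nval e s) s)"
| RAssign: "exec \<Omega> D (RAssign x es e) s 1 (rupdate x (map (\<lambda>e. nval e s) es) (rval e s) s)"
| CallOmega_finite:
    "\<Omega> (nval e s) {j. nmem s A (map (\<lambda>e. nval e s) es @ [j]) \<noteq> 0} = ereal r \<Longrightarrow>
     exec \<Omega> D (CallOmega f y e A es) s 1 (nupdate f [] 1 (rupdate y [] r s))"
| CallOmega_infinite:
    "\<Omega> (nval e s) {j. nmem s A (map (\<lambda>e. nval e s) es @ [j]) \<noteq> 0} = \<infinity> \<Longrightarrow>
     exec \<Omega> D (CallOmega f y e A es) s 1 (nupdate f [] 0 (rupdate y [] 0 s))"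
| CallD: "exec \<Omega> D (CallD y e k) s 1 (rupdate y [] (D (nval e s) (nval k s)) s)"
| Seq: "exec \<Omega> D c1 s t1 s' \<Longrightarrow> exec \<Omega> D c2 s' t2 s'' \<Longrightarrow> exec \<Omega> D (Seq c1 c2) s (t1 + t2) s''"
| Cond_true: "bval b s \<Longrightarrow> exec \<Omega> D c1 s t s' \<Longrightarrow> exec \<Omega> D (Cond b c1 c2) s (1 + t) s'"
| Cond_false: "\<not> bval b s \<Longrightarrow> exec \<Omega> D c2 s t s' \<Longrightarrow> exec \<Omega> D (Cond b c1 c2) s (1 + t) s'"
| While_false: "\<not> bval b s \<Longrightarrow> exec \<Omega> D (While b c) s 1 s"
| While_true:
    "bval b s \<Longrightarrow> exec \<Omega> D c s t1 s' \<Longrightarrow> exec \<Omega> D (While b c) s' t2 s'' \<Longrightarrow>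
     exec \<Omega> D (While b c) s (1 + t1 + t2) s''"


section \<open>Input and output\<close>

text \<open>
  A program sees the resources only through their positions in a list \<open>vs\<close> enumerating \<open>V\<close>.  It is
  given the two numbers \<open>n\<close> and \<open>|V|\<close>, one strategy \<open>X\<^sub>0 i\<close> of every player as the row \<open>X[i, _]\<close>, and
  the two oracles; all other memory is zero.  Its answer is read off the same rows.
\<close>

definition omega_oracle :: "'v list \<Rightarrow> (nat \<Rightarrow> 'v set \<Rightarrow> ereal) \<Rightarrow> nat \<Rightarrow> nat set \<Rightarrow> ereal" where
  "omega_oracle vs \<omega> i S = \<omega> i ((\<lambda>j. vs ! j) ` S)"

definition d_oracle :: "'v list \<Rightarrow> ('v \<Rightarrow> nat \<Rightarrow> real) \<Rightarrow> nat \<Rightarrow> nat \<Rightarrow> real" where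
  "d_oracle vs d j x = d (vs ! j) x"

definition input_store :: "nat \<Rightarrow> 'v list \<Rightarrow> (nat \<Rightarrow> 'v set) \<Rightarrow> store" where
  "input_store n vs X\<^sub>0 =
     Store
       (\<lambda>x js.
          if x = ''n'' \<and> js = [] then n
          else if x = ''m'' \<and> js = [] then length vs
          else if x = ''X'' \<and> (\<exists>i j. js = [i, j] \<and> i \<in> {1..n} \<and> j < length vs \<and> vs ! j \<in> X\<^sub>0 i) then 1
          else 0)
       (\<lambda>x js. 0)"

definition output_state :: "'v list \<Rightarrow> store \<Rightarrow> nat \<Rightarrow> 'v set" where
  "output_state vs s i = {vs ! j | j. j < length vs \<and> nmem s ''X'' [i, j] \<noteq> 0}"

definition computes_social_optimum ::
  "com \<Rightarrow> nat \<Rightarrow> nat \<Rightarrow> 'v list \<Rightarrow> (nat \<Rightarrow> 'v set set) \<Rightarrow> (nat \<Rightarrow> 'v set \<Rightarrow> ereal) \<Rightarrow>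
    ('v \<Rightarrow> nat \<Rightarrow> real) \<Rightarrow> (nat \<Rightarrow> 'v set) \<Rightarrow> bool" where
  "computes_social_optimum p T n vs \<B> \<omega> d X\<^sub>0 \<longleftrightarrow>
     (\<exists>t s. exec (omega_oracle vs \<omega>) (d_oracle vs d) p (input_store n vs X\<^sub>0) t s \<and> t \<le> T \<and>
        socially_optimal n \<B> \<omega> d (output_state vs s))"

end

theory Submission
  imports Defs
begin

text \<open>
  With \<open>\<phi> v k = k * d v k\<close> the social cost is \<open>\<Sum>i. \<omega> i (X i) + \<Sum>v. \<phi> v (x v)\<close>, and weak convexity makes
  every \<open>\<phi> v\<close> convex: a resource consists of slots \<open>(v, 1), (v, 2), \<dots>\<close> with nondecreasing nonnegative
  marginal costs.  If all slots are free, the greedy algorithm minimises each \<open>\<omega> i\<close> separately.  The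
  slots are then given their true costs one at a time, \<open>(v, n)\<close> down to \<open>(v, 1)\<close>.

  Throughout, optimality of the current state is certified by prices \<open>p\<close> such that \<open>X i\<close> minimises
  \<open>\<omega> i + p\<close> and \<open>p v\<close> lies between the marginal costs at \<open>x v\<close> and \<open>x v + 1\<close>.  Raising the cost of slot
  \<open>(r, j)\<close> to \<open>\<gamma>\<close> can violate this only if \<open>x r = j\<close>, and then only at \<open>r\<close>.  Let \<open>dist\<close> denote the distance
  from \<open>r\<close> in the exchange graph, whose arcs \<open>u \<rightarrow> v\<close> are single exchanges of some player, and let \<open>\<delta>\<close> be the
  minimum of \<open>\<gamma>\<close> and of all values \<open>dist v\<close> plus the marginal cost at \<open>x v + 1\<close>.  The prices
  \<open>max (p v) (\<delta> - dist v)\<close> certify \<open>X\<close> itself if \<open>\<delta> = \<gamma>\<close>, and otherwise the state obtained from \<open>X\<close> by the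
  exchanges along a shortest walk with fewest arcs to a minimising \<open>v\<close>.  So \<open>n |V|\<close> runs of the
  Bellman-Ford algorithm suffice.
\<close>

section \<open>Valuated matroids\<close>

text \<open>The obstacle is that several arcs of one walk may belong to the same player, and
  exchanges that are admissible singly need not be admissible together. They are therefore performed
  from the far end of the walk back to \<open>r\<close>, with optimality of every intermediate base
  under the final prices \<open>raised \<delta>\<close> as invariant. Give each vertex as its layer
  the least \<open>k\<close> at which \<open>D k\<close> attains its distance. As the walk has
  fewest arcs, layers fall strictly towards \<open>r\<close>; elements inserted so far lie in later
  layers than the current vertex, elements removed so far in no earlier ones, and under these
  conditions the exchange axiom yields exactly the next exchange. Slots are priced from the last to
  the first because the costs of a resource then remain nondecreasing throughout: zeros followed by
  true marginal costs. The number of phases depends on the number of slots and not on the size of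
  the values, so no scaling is involved. All loops run at most \<open>m\<close> or \<open>n\<close>
  times, so the running time can be read off the program text (\<open>step_bound\<close>) and
  invariants speak of correctness only.\<close>

definition real_valuated_matroid :: "'a set set \<Rightarrow> ('a set \<Rightarrow> real) \<Rightarrow> bool" where
  "real_valuated_matroid B f \<longleftrightarrow>
     (\<forall>X\<in>B. \<forall>Y\<in>B. \<forall>v\<in>X - Y. \<exists>u\<in>Y - X.
        insert u (X - {v}) \<in> B \<and> insert v (Y - {u}) \<in> B \<and>
        f (insert u (X - {v})) + f (insert v (Y - {u})) \<le> f X + f Y)"

lemma real_valuated_matroidE:
  assumes "real_valuated_matroid B f" "X \<in> B" "Y \<in> B" "v \<in> X" "v \<notin> Y"
  obtains u where "u \<in> Y" "u \<notin> X" "insert u (X - {v}) \<in> B" "insert v (Y - {u}) \<in> B"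
    "f (insert u (X - {v})) + f (insert v (Y - {u})) \<le> f X + f Y"
  using assms unfolding real_valuated_matroid_def by (metis DiffE DiffI)

lemma sum_exchange:
  fixes p :: "'a \<Rightarrow> real"
  assumes "finite X" "v \<in> X" "u \<notin> X"
  shows "sum p (insert u (X - {v})) = sum p X - p v + p u"
  using assms by (simp add: sum_diff1)

text \<open>The two exchanged sets together contain the same elements, with multiplicity, as
  \<open>X\<close> and \<open>Y\<close>, so the sums over \<open>p\<close> cancel. Prices can thus
  be added to a valuation at will.\<close>

lemma real_valuated_matroid_add_modular:
  assumes "real_valuated_matroid B f" "\<And>X. X \<in> B \<Longrightarrow> finite X"
  shows "real_valuated_matroid B (\<lambda>X. f X + sum p X)"
  unfolding real_valuated_matroid_def
proof (intro ballI)
  fix X Y v assume h: "X \<in> B" "Y \<in> B" "v \<in> X - Y"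
  then obtain u where u: "u \<in> Y" "u \<notin> X" "insert u (X - {v}) \<in> B" "insert v (Y - {u}) \<in> B"
    "f (insert u (X - {v})) + f (insert v (Y - {u})) \<le> f X + f Y"
    using real_valuated_matroidE[OF assms(1)] by (metis DiffE)
  have "sum p (insert u (X - {v})) = sum p X - p v + p u"
       "sum p (insert v (Y - {u})) = sum p Y - p u + p v"
    using h u assms(2) by (metis DiffE sum_exchange)+
  with u show "\<exists>u\<in>Y - X. insert u (X - {v}) \<in> B \<and> insert v (Y - {u}) \<in> B \<and>
    f (insert u (X - {v})) + sum p (insert u (X - {v})) + (f (insert v (Y - {u})) + sum p (insert v (Y - {u})))
    \<le> f X + sum p X + (f Y + sum p Y)"
    by (intro bexI[of _ u]) auto
qed

definition minimizer :: "'a set set \<Rightarrow> ('a set \<Rightarrow> real) \<Rightarrow> 'a set \<Rightarrow> bool" where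
  "minimizer B f X \<longleftrightarrow> X \<in> B \<and> (\<forall>Y\<in>B. f X \<le> f Y)"

text \<open>An element of \<open>Y - X\<close> would need an exchange partner in
  \<open>X - Y\<close>, which is empty.\<close>

lemma real_valuated_matroid_subset_eq:
  assumes "real_valuated_matroid B f" "X \<in> B" "Y \<in> B" "X \<subseteq> Y"
  shows "X = Y"
  using assms unfolding real_valuated_matroid_def by blast

text \<open>One of the two exchanged sets is a single exchange of \<open>X\<close> and gains nothing
  by local optimality, so the other costs at most \<open>f Y\<close>, and it is closer to
  \<open>X\<close>. This lets arcs that are single exchanges certify optimality over all
  bases.\<close>

lemma local_minimizer_imp_minimizer:
  assumes vm: "real_valuated_matroid B f" and X: "X \<in> B" "finite X"
    and loc: "\<And>u v. u \<in> X \<Longrightarrow> v \<notin> X \<Longrightarrow> insert v (X - {u}) \<in> B \<Longrightarrow> f X \<le> f (insert v (X - {u}))"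
  shows "minimizer B f X"
proof -
  have "f X \<le> f Y" if "Y \<in> B" for Y
    using that
  proof (induction "card (X - Y)" arbitrary: Y rule: less_induct)
    case less
    show ?case
    proof (cases "X \<subseteq> Y")
      case True
      then show ?thesis using real_valuated_matroid_subset_eq[OF vm X(1) less.prems] by simp
    next
      case False
      then obtain v where v: "v \<in> X" "v \<notin> Y" by blast
      obtain u where u: "u \<in> Y" "u \<notin> X" "insert u (X - {v}) \<in> B" "insert v (Y - {u}) \<in> B"
        "f (insert u (X - {v})) + f (insert v (Y - {u})) \<le> f X + f Y"
        by (rule real_valuated_matroidE[OF vm X(1) less.prems v])
      have "X - insert v (Y - {u}) \<subset> X - Y" using u v by auto
      then have "card (X - insert v (Y - {u})) < card (X - Y)"
        using X(2) by (simp add: psubset_card_mono)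
      then have "f X \<le> f (insert v (Y - {u}))" using less.hyps u(4) by blast
      moreover have "f X \<le> f (insert u (X - {v}))" using loc v u by blast
      ultimately show ?thesis using u(5) by linarith
    qed
  qed
  then show ?thesis using X by (simp add: minimizer_def)
qed

lemma minimizer_exchange:
  assumes "real_valuated_matroid B f" "minimizer B f X" "minimizer B f Y" "v \<in> X" "v \<notin> Y"
  obtains u where "u \<in> Y" "u \<notin> X" "minimizer B f (insert u (X - {v}))" "minimizer B f (insert v (Y - {u}))"
proof -
  obtain u where u: "u \<in> Y" "u \<notin> X" "insert u (X - {v}) \<in> B" "insert v (Y - {u}) \<in> B"
        "f (insert u (X - {v})) + f (insert v (Y - {u})) \<le> f X + f Y"
    using real_valuated_matroidE[OF assms(1)] assms(2-5) unfolding minimizer_def by metis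
  have "f X \<le> f Y" "f Y \<le> f X" using assms(2,3) unfolding minimizer_def by auto
  moreover have "f X \<le> f (insert u (X - {v}))" "f X \<le> f (insert v (Y - {u}))"
    using u assms(2) unfolding minimizer_def by auto
  ultimately have "f (insert u (X - {v})) = f X" "f (insert v (Y - {u})) = f X"
    using u(5) by linarith+
  then show ?thesis using that u assms(2) unfolding minimizer_def by auto
qed

text \<open>Exchanging \<open>v\<close> out of the greedily chosen base against \<open>w\<close> in
  \<open>Y\<close> yields another candidate \<open>insert w (X - {u})\<close>, which is no cheaper.
  Hence \<open>insert v (Y - {w})\<close> is no dearer than \<open>Y\<close>; and \<open>w\<close>
  lies outside \<open>X - {u}\<close>, so nothing of \<open>F\<close> is lost.\<close>

lemma greedy_exchange:
  assumes vm: "real_valuated_matroid B f" and Z: "insert v (X - {u}) \<in> B"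
    and best: "\<And>w. w \<notin> X - {u} \<Longrightarrow> insert w (X - {u}) \<in> B \<Longrightarrow> f (insert v (X - {u})) \<le> f (insert w (X - {u}))"
    and Y: "minimizer B f Y" "F \<subseteq> Y" and F: "F \<subseteq> X - {u}" and v: "v \<notin> X - {u}"
  shows "\<exists>Y. minimizer B f Y \<and> insert v F \<subseteq> Y"
proof (cases "v \<in> Y")
  case True
  then show ?thesis using Y by blast
next
  case False
  obtain w where w: "w \<in> Y" "w \<notin> insert v (X - {u})"
    "insert w (insert v (X - {u}) - {v}) \<in> B" "insert v (Y - {w}) \<in> B"
    "f (insert w (insert v (X - {u}) - {v})) + f (insert v (Y - {w})) \<le> f (insert v (X - {u})) + f Y"
    using real_valuated_matroidE[OF vm Z _ _ False] Y(1) unfolding minimizer_def by blast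
  have "insert v (X - {u}) - {v} = X - {u}" using v by auto
  then have "f (insert v (Y - {w})) \<le> f Y" using best[of w] w by simp
  then have "minimizer B f (insert v (Y - {w}))" using Y(1) w(4) unfolding minimizer_def by force
  moreover have "insert v F \<subseteq> insert v (Y - {w})" using Y F w by auto
  ultimately show ?thesis by blast
qed

section \<open>Exchange graphs\<close>

text \<open>Lengths are taken in the unpriced valuation and may be negative; prices enter only as a
  vertex potential.\<close>

definition arc_length ::
  "('i \<Rightarrow> 'a set set) \<Rightarrow> ('i \<Rightarrow> 'a set \<Rightarrow> real) \<Rightarrow> ('i \<Rightarrow> 'a set) \<Rightarrow> 'i \<Rightarrow> 'a \<Rightarrow> 'a \<Rightarrow> ereal" where
  "arc_length B f X i u v =
     (if u \<in> X i \<and> v \<notin> X i \<and> insert v (X i - {u}) \<in> B i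
      then ereal (f i (insert v (X i - {u})) - f i (X i)) else \<infinity>)"

lemma arc_length_self: "arc_length B f Z i v v = \<infinity>"
  by (simp add: arc_length_def)

text \<open>\<open>walk_dist V L r k v\<close> is the length of a shortest walk from \<open>r\<close> to \<open>v\<close> with at most \<open>k\<close> arcs.\<close>

primrec walk_dist :: "'a set \<Rightarrow> ('a \<Rightarrow> 'a \<Rightarrow> ereal) \<Rightarrow> 'a \<Rightarrow> nat \<Rightarrow> 'a \<Rightarrow> ereal" where
  "walk_dist V L r 0 = (\<lambda>v. if v = r then 0 else \<infinity>)"
| "walk_dist V L r (Suc k) = (\<lambda>v. min (walk_dist V L r k v) (INF u\<in>V. walk_dist V L r k u + L u v))"

declare walk_dist.simps(2) [simp del]

lemma walk_dist_cong:
  assumes "\<And>u v. u \<in> V \<Longrightarrow> v \<in> V \<Longrightarrow> L u v = L' u v" "v \<in> V"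
  shows "walk_dist V L r k v = walk_dist V L' r k v"
  using assms(2) by (induction k arbitrary: v) (simp_all add: walk_dist.simps(2) assms(1))

text \<open>\<open>L_ge\<close> makes \<open>p\<close> a feasible potential: the reduced lengths
  \<open>L u v - p u + p v\<close> are nonnegative.\<close>

locale shortest_walks =
  fixes V :: "'a set" and L :: "'a \<Rightarrow> 'a \<Rightarrow> ereal" and r :: 'a and p :: "'a \<Rightarrow> real"
  assumes finV: "finite V" and r: "r \<in> V"
    and L_ge: "\<And>u v. u \<in> V \<Longrightarrow> v \<in> V \<Longrightarrow> ereal (p u - p v) \<le> L u v"
begin

abbreviation "D \<equiv> walk_dist V L r"
abbreviation "sdist \<equiv> D (card V)"

lemma D_antimono: "k \<le> l \<Longrightarrow> D l v \<le> D k v"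
  by (rule lift_Suc_antimono_le[of "\<lambda>k. D k v"]) (auto simp: walk_dist.simps(2))

lemma D_step: "u \<in> V \<Longrightarrow> D (Suc k) v \<le> D k u + L u v"
  unfolding walk_dist.simps(2) by (rule min.coboundedI2) (rule INF_lower)

lemma D_ge: "v \<in> V \<Longrightarrow> ereal (p r - p v) \<le> D k v"
proof (induction k arbitrary: v)
  case 0
  then show ?case by (auto simp: zero_ereal_def)
next
  case (Suc k)
  have "ereal (p r - p v) \<le> D k u + L u v" if "u \<in> V" for u
  proof -
    have "ereal (p r - p u) + ereal (p u - p v) \<le> D k u + L u v"
      using Suc that L_ge by (intro add_mono) auto
    then show ?thesis by simp
  qed
  then show ?case using Suc by (auto simp: walk_dist.simps(2) intro!: INF_greatest)
qed

lemma D_improved: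
  assumes "v \<in> V" "D (Suc k) v < D k v"
  obtains u where "u \<in> V" "D (Suc k) v = D k u + L u v"
proof -
  have "D (Suc k) v = (INF u\<in>V. D k u + L u v)" using assms by (auto simp: walk_dist.simps(2) min_def split: if_splits)
  also have "\<dots> = Min ((\<lambda>u. D k u + L u v) ` V)"
    using finV assms by (subst Min_Inf) auto
  also have "\<dots> \<in> (\<lambda>u. D k u + L u v) ` V" using finV assms by (intro Min_in) auto
  finally show ?thesis using that by auto
qed

text \<open>An improvement of \<open>v\<close> in one round is caused by an improvement of its
  predecessor in the round before; going back gives one vertex per round.\<close>

lemma improvement_chain:
  assumes "v \<in> V" "D (Suc k) v < D k v"
  shows "\<exists>w. w (Suc k) = v \<and> (\<forall>a\<le>Suc k. w a \<in> V) \<and>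
    (\<forall>a\<le>k. D (Suc a) (w (Suc a)) = D a (w a) + L (w a) (w (Suc a)) \<and>
           D (Suc a) (w (Suc a)) < D a (w (Suc a)))"
  using assms
proof (induction k arbitrary: v)
  case 0
  then obtain u where u: "u \<in> V" "D (Suc 0) v = D 0 u + L u v" by (rule D_improved)
  show ?case
    by (rule exI[of _ "\<lambda>a. if a = 0 then u else v"]) (use 0 u in \<open>auto\<close>)
next
  case (Suc k)
  then obtain u where u: "u \<in> V" "D (Suc (Suc k)) v = D (Suc k) u + L u v" by (meson D_improved)
  \<comment> \<open>If \<open>u\<close> had not just improved, the arc from \<open>u\<close> would
    have given \<open>v\<close> this value one round earlier.\<close>
  have "D (Suc k) u < D k u"
  proof (rule ccontr)
    assume "\<not> ?thesis"
    then have "D (Suc k) u = D k u" using D_antimono[of k "Suc k" u] by (simp add: antisym)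
    then have "D (Suc k) v \<le> D (Suc (Suc k)) v" using u D_step[OF u(1), of k v] by simp
    then show False using Suc.prems(2) by simp
  qed
  then obtain w where w: "w (Suc k) = u" "\<forall>a\<le>Suc k. w a \<in> V"
    "\<forall>a\<le>k. D (Suc a) (w (Suc a)) = D a (w a) + L (w a) (w (Suc a)) \<and>
           D (Suc a) (w (Suc a)) < D a (w (Suc a))"
    using Suc.IH[OF u(1)] by blast
  show ?case
  proof (rule exI[of _ "w(Suc (Suc k) := v)"], intro conjI allI impI)
    fix a assume a: "a \<le> Suc k"
    show "D (Suc a) ((w(Suc (Suc k) := v)) (Suc a)) =
      D a ((w(Suc (Suc k) := v)) a) + L ((w(Suc (Suc k) := v)) a) ((w(Suc (Suc k) := v)) (Suc a))"
      using a w u by (cases "a = Suc k") auto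
    show "D (Suc a) ((w(Suc (Suc k) := v)) (Suc a)) < D a ((w(Suc (Suc k) := v)) (Suc a))"
      using a w(1) w(3)[rule_format, of a] Suc.prems by (cases "a = Suc k") auto
  qed (use w Suc.prems in auto)
qed

text \<open>A chain of improvements visits pairwise distinct vertices, since by \<open>L_ge\<close> no closed walk has
  negative length; so improvements stop after \<open>card V\<close> rounds.\<close>

lemma D_stable:
  assumes "v \<in> V"
  shows "D (Suc (card V)) v = D (card V) v"
proof (rule ccontr)
  define k where "k = card V"
  assume "\<not> ?thesis"
  then have "D (Suc k) v < D k v" using D_antimono[of k "Suc k" v] by (simp add: k_def order.not_eq_order_implies_strict)
  from improvement_chain[OF assms this] obtain w where w: "\<forall>a\<le>Suc k. w a \<in> V"
    "\<And>a. a\<le>k \<Longrightarrow> D (Suc a) (w (Suc a)) = D a (w a) + L (w a) (w (Suc a))"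
    "\<And>a. a\<le>k \<Longrightarrow> D (Suc a) (w (Suc a)) < D a (w (Suc a))" by blast
  \<comment> \<open>\<open>L_ge\<close> telescopes along the chain. If \<open>w a = w b\<close>, the
    potential difference vanishes and the later value is at least the earlier one.\<close>
  have len: "D a (w a) + ereal (p (w a) - p (w b)) \<le> D b (w b)" if "a \<le> b" "b \<le> Suc k" for a b
    using that
  proof (induction b rule: dec_induct)
    case base
    then show ?case by (cases "D a (w a)") auto
  next
    case (step b)
    have "D a (w a) + ereal (p (w a) - p (w (Suc b)))
        = D a (w a) + ereal (p (w a) - p (w b)) + ereal (p (w b) - p (w (Suc b)))"
      by (cases "D a (w a)") auto
    also have "\<dots> \<le> D b (w b) + L (w b) (w (Suc b))"
      using step w(1) by (intro add_mono L_ge) auto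
    also have "\<dots> = D (Suc b) (w (Suc b))" using w(2)[of b] step by simp
    finally show ?case .
  qed
  have "w a \<noteq> w b" if "a < b" "b \<le> Suc k" for a b
  proof
    assume eq: "w a = w b"
    obtain b' where b': "b = Suc b'" using \<open>a < b\<close> by (metis less_imp_Suc_add)
    have "D a (w a) \<le> D b (w b)" using len[of a b] that eq by (cases "D a (w a)") auto
    also have "\<dots> < D b' (w b)" using w(3)[of b'] that b' by simp
    also have "\<dots> \<le> D a (w b)" using that b' by (intro D_antimono) auto
    finally show False using eq by simp
  qed
  then have "inj_on w {..Suc k}" by (intro linorder_inj_onI) auto
  moreover have "w ` {..Suc k} \<subseteq> V" using w(1) by auto
  ultimately have "card {..Suc k} \<le> card V" using finV by (rule card_inj_on_le)
  then show False by (simp add: k_def)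
qed

lemma sdist_triangle: "u \<in> V \<Longrightarrow> v \<in> V \<Longrightarrow> sdist v \<le> sdist u + L u v"
  using D_step[of u "card V" v] D_stable[of v] by simp

lemma sdist_root: "sdist r = 0"
  using D_ge[OF r, of "card V"] D_antimono[of 0 "card V" r] by (auto simp: zero_ereal_def)

lemma sdist_not_MInf: "v \<in> V \<Longrightarrow> sdist v \<noteq> -\<infinity>"
  using D_ge[of v "card V"] by auto

text \<open>\<open>real_of_ereal\<close> sends infinity to 0, where the formula should give minus
  infinity; hence the separate case for unreachable vertices.\<close>

definition raised :: "real \<Rightarrow> 'a \<Rightarrow> real" where
  "raised \<delta> v = (if sdist v = \<infinity> then p v else max (p v) (\<delta> - real_of_ereal (sdist v)))"

lemma raised_ge: "p v \<le> raised \<delta> v"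
  by (simp add: raised_def)

text \<open>A pointwise maximum of feasible potentials is feasible; \<open>p\<close> is one, and so
  is \<open>\<delta>\<close> minus the distance, by the triangle inequality.\<close>

lemma raised_feasible:
  assumes "u \<in> V" "v \<in> V"
  shows "ereal (raised \<delta> u - raised \<delta> v) \<le> L u v"
proof (cases "raised \<delta> u = p u \<or> L u v = \<infinity>")
  case True
  have "raised \<delta> u - raised \<delta> v \<le> p u - p v" if "raised \<delta> u = p u"
    using raised_ge[of v \<delta>] that by simp
  then show ?thesis using True L_ge[OF assms] by (metis ereal_less_eq(1,3) order_trans)
next
  case False
  then have fin: "sdist u \<noteq> \<infinity>" "raised \<delta> u = \<delta> - real_of_ereal (sdist u)"
    by (auto simp: raised_def max_def split: if_splits)
  obtain a where a: "sdist u = ereal a" using fin sdist_not_MInf[OF assms(1)] by (cases "sdist u") auto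
  obtain l where l: "L u v = ereal l" using False L_ge[OF assms] by (cases "L u v") auto
  have "sdist v \<le> ereal (a + l)" using sdist_triangle[OF assms] a l by simp
  then obtain b where b: "sdist v = ereal b" "b \<le> a + l"
    using sdist_not_MInf[OF assms(2)] by (cases "sdist v") auto
  have "\<delta> - b \<le> raised \<delta> v" by (simp add: raised_def b)
  then show ?thesis using fin a b l by simp
qed

end

section \<open>Optimality certificates and augmentation\<close>

definition congested :: "'i set \<Rightarrow> ('i \<Rightarrow> 'a set) \<Rightarrow> 'a \<Rightarrow> nat" where
  "congested I X v = card {i \<in> I. v \<in> X i}"

text \<open>Optimality certificate for minimising \<open>\<Sum>i. f i (X i) + \<Sum>v. \<phi> v (x v)\<close>, where \<open>c v k\<close> is the
  marginal cost \<open>\<phi> v k - \<phi> v (k - 1)\<close>: a price vector \<open>p\<close> that decouples the two sums.\<close>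

definition supports ::
  "'a set \<Rightarrow> 'i set \<Rightarrow> ('i \<Rightarrow> 'a set set) \<Rightarrow> ('i \<Rightarrow> 'a set \<Rightarrow> real) \<Rightarrow> ('a \<Rightarrow> nat \<Rightarrow> real) \<Rightarrow>
    ('a \<Rightarrow> real) \<Rightarrow> ('i \<Rightarrow> 'a set) \<Rightarrow> bool" where
  "supports V I B f c p X \<longleftrightarrow>
     (\<forall>i\<in>I. minimizer (B i) (\<lambda>Y. f i Y + sum p Y) (X i)) \<and>
     (\<forall>v\<in>V. (0 < congested I X v \<longrightarrow> c v (congested I X v) \<le> p v) \<and>
             (congested I X v < card I \<longrightarrow> p v \<le> c v (Suc (congested I X v))))"

text \<open>The parent \<open>Q k v\<close> of \<open>v\<close> in layer \<open>k\<close> is \<open>v\<close> itself if no walk with \<open>k\<close> arcs is shorter than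
  those with fewer arcs.\<close>

primrec augment ::
  "(nat \<Rightarrow> 'a \<Rightarrow> 'a) \<Rightarrow> ('a \<Rightarrow> 'a \<Rightarrow> 'i) \<Rightarrow> nat \<Rightarrow> 'a \<Rightarrow> ('i \<Rightarrow> 'a set) \<Rightarrow> ('i \<Rightarrow> 'a set)" where
  "augment Q P 0 v X = X"
| "augment Q P (Suc k) v X =
     (let u = Q (Suc k) v in
      if u = v then augment Q P k v X
      else augment Q P k u (X(P u v := insert v (X (P u v) - {u}))))"

locale exchange_graph =
  fixes V :: "'a set" and I :: "'i set" and B :: "'i \<Rightarrow> 'a set set" and f :: "'i \<Rightarrow> 'a set \<Rightarrow> real"
    and X :: "'i \<Rightarrow> 'a set" and p :: "'a \<Rightarrow> real" and r :: 'a
  assumes finite_V: "finite V" and finite_I: "finite I" and root: "r \<in> V"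
    and vm: "\<And>i. i \<in> I \<Longrightarrow> real_valuated_matroid (B i) (f i)"
    and B_sub: "\<And>i Y. i \<in> I \<Longrightarrow> Y \<in> B i \<Longrightarrow> Y \<subseteq> V"
    and X_min: "\<And>i. i \<in> I \<Longrightarrow> minimizer (B i) (\<lambda>Y. f i Y + sum p Y) (X i)"
begin

definition L :: "'a \<Rightarrow> 'a \<Rightarrow> ereal" where
  "L u v = (INF i\<in>I. arc_length B f X i u v)"

lemma X_in: "i \<in> I \<Longrightarrow> X i \<in> B i"
  using X_min by (simp add: minimizer_def)

lemma fin_in: "i \<in> I \<Longrightarrow> Y \<in> B i \<Longrightarrow> finite Y"
  using B_sub finite_V finite_subset by blast

text \<open>That \<open>X i\<close> is no dearer than one of its single exchanges at prices
  \<open>p\<close> is precisely the potential inequality for that arc.\<close>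

sublocale shortest_walks V L r p
proof
  fix u v assume "u \<in> V" "v \<in> V"
  show "ereal (p u - p v) \<le> L u v" unfolding L_def
  proof (rule INF_greatest)
    fix i assume i: "i \<in> I"
    show "ereal (p u - p v) \<le> arc_length B f X i u v"
    proof (cases "u \<in> X i \<and> v \<notin> X i \<and> insert v (X i - {u}) \<in> B i")
      case True
      have "f i (X i) + sum p (X i) \<le> f i (insert v (X i - {u})) + sum p (insert v (X i - {u}))"
        using X_min[OF i] True by (auto simp: minimizer_def)
      then show ?thesis using True sum_exchange[of "X i" u v p] fin_in[OF i X_in[OF i]]
        by (simp add: arc_length_def)
    qed (auto simp: arc_length_def)
  qed
qed (use finite_V root in auto)

text \<open>Since \<open>raised\<close> is again a feasible potential, no single exchange improves
  \<open>X i\<close> at the new prices, and local optimality suffices. The change of prices alone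
  never destroys optimality for the players.\<close>

lemma minimizer_raised:
  assumes i: "i \<in> I"
  shows "minimizer (B i) (\<lambda>Y. f i Y + sum (raised \<delta>) Y) (X i)"
proof (rule local_minimizer_imp_minimizer)
  show "real_valuated_matroid (B i) (\<lambda>Y. f i Y + sum (raised \<delta>) Y)"
    using vm[OF i] fin_in[OF i] by (rule real_valuated_matroid_add_modular)
  fix u v assume h: "u \<in> X i" "v \<notin> X i" "insert v (X i - {u}) \<in> B i"
  then have uv: "u \<in> V" "v \<in> V" using B_sub[OF i] X_in[OF i] by blast+
  have "ereal (raised \<delta> u - raised \<delta> v) \<le> L u v" using uv by (rule raised_feasible)
  also have "\<dots> \<le> arc_length B f X i u v" unfolding L_def using i by (rule INF_lower)
  finally show "f i (X i) + sum (raised \<delta>) (X i) \<le> f i (insert v (X i - {u})) + sum (raised \<delta>) (insert v (X i - {u}))"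
    using h sum_exchange[of "X i" u v "raised \<delta>"] fin_in[OF i X_in[OF i]] by (simp add: arc_length_def)
qed (use i X_in fin_in in auto)

lemma L_le: "i \<in> I \<Longrightarrow> L u v \<le> arc_length B f X i u v"
  unfolding L_def by (rule INF_lower)

end

section \<open>Augmentation along a shortest walk with fewest arcs\<close>

locale augmentation = exchange_graph +
  fixes Q :: "nat \<Rightarrow> 'a \<Rightarrow> 'a" and P :: "'a \<Rightarrow> 'a \<Rightarrow> 'b"
  assumes parent: "\<And>k v. k < card V \<Longrightarrow> v \<in> V \<Longrightarrow>
       (Q (Suc k) v = v \<and> D (Suc k) v = D k v) \<or>
       (Q (Suc k) v \<in> V \<and> Q (Suc k) v \<noteq> v \<and> D (Suc k) v = D k (Q (Suc k) v) + L (Q (Suc k) v) v \<and>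
        D (Suc k) v < D k v)"
    and player: "\<And>u v. u \<in> V \<Longrightarrow> v \<in> V \<Longrightarrow> L u v < \<infinity> \<Longrightarrow> P u v \<in> I \<and> L u v = arc_length B f X (P u v) u v"
begin

text \<open>The situation in the middle of an augmentation: the exchanges between \<open>v\<close>
  and the end \<open>t\<close> have turned \<open>X\<close> into \<open>Y\<close>, and one unit of
  congestion has moved from \<open>v\<close> to \<open>t\<close>. The bound on \<open>p v\<close>
  makes \<open>raised \<delta> v\<close> equal to \<open>\<delta>\<close> minus the distance. The
  layer conditions say that inserted elements attain their distance only after layer
  \<open>k\<close>, and removed ones not before it; they keep the next exchange possible in
  \<open>Y\<close>.\<close>

definition on_walk :: "real \<Rightarrow> 'a \<Rightarrow> nat \<Rightarrow> 'a \<Rightarrow> ('b \<Rightarrow> 'a set) \<Rightarrow> bool" where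
  "on_walk \<delta> t k v Y \<longleftrightarrow>
     v \<in> V \<and> D k v = sdist v \<and> sdist v < \<infinity> \<and> p v \<le> \<delta> - real_of_ereal (sdist v) \<and>
     (\<forall>i\<in>I. minimizer (B i) (\<lambda>Y. f i Y + sum (raised \<delta>) Y) (Y i)) \<and>
     (\<forall>i\<in>I. \<forall>w\<in>Y i - X i. D k w \<noteq> sdist w) \<and>
     (\<forall>i\<in>I. \<forall>w\<in>X i - Y i. \<forall>l<k. D l w \<noteq> sdist w) \<and>
     (\<forall>w\<in>V. congested I Y w + of_bool (w = v) = congested I X w + of_bool (w = t))"

lemma congested_exchange:
  assumes "i \<in> I" "u \<in> Y i" "v \<notin> Y i"
  shows "congested I (Y(i := insert v (Y i - {u}))) w + of_bool (w = u) = congested I Y w + of_bool (w = v)"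
proof -
  have ne: "u \<noteq> v" using assms by auto
  let ?Y = "Y(i := insert v (Y i - {u}))"
  show ?thesis
  proof (cases "w = u")
    case True
    then have "{j \<in> I. w \<in> Y j} = insert i {j \<in> I. w \<in> ?Y j}" "i \<notin> {j \<in> I. w \<in> ?Y j}"
      using assms ne by auto
    then show ?thesis using True ne finite_I by (simp add: congested_def)
  next
    case F: False
    show ?thesis
    proof (cases "w = v")
      case True
      then have "{j \<in> I. w \<in> ?Y j} = insert i {j \<in> I. w \<in> Y j}" "i \<notin> {j \<in> I. w \<in> Y j}"
        using assms ne by auto
      then show ?thesis using True ne finite_I by (simp add: congested_def)
    next
      case False
      with F have "{j \<in> I. w \<in> ?Y j} = {j \<in> I. w \<in> Y j}" by auto
      then show ?thesis using F False by (simp add: congested_def)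
    qed
  qed
qed

lemma D_eq_sdist_mono: "D k w = sdist w \<Longrightarrow> k \<le> l \<Longrightarrow> l \<le> card V \<Longrightarrow> D l w = sdist w"
  using D_antimono[of k l w] D_antimono[of l "card V" w] by auto

text \<open>The heart of the augmentation: a second tight exchange \<open>u \<rightarrow> w\<close> with \<open>w\<close> in a later layer would
  shortcut the walk, so the exchange axiom leaves \<open>u\<close> as the only partner of \<open>v\<close>.\<close>

lemma on_walk_step:
  assumes ow: "on_walk \<delta> t (Suc k) v Y" and k: "k < card V"
    and u: "u = Q (Suc k) v" "u \<noteq> v"
  shows "on_walk \<delta> t k u (Y(P u v := insert v (Y (P u v) - {u})))"
proof -
  define i where "i = P u v"
  have v: "v \<in> V" "D (Suc k) v = sdist v" "sdist v < \<infinity>" "p v \<le> \<delta> - real_of_ereal (sdist v)"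
    and Y_min: "\<And>i. i \<in> I \<Longrightarrow> minimizer (B i) (\<lambda>Y. f i Y + sum (raised \<delta>) Y) (Y i)"
    and new: "\<And>i w. i \<in> I \<Longrightarrow> w \<in> Y i \<Longrightarrow> w \<notin> X i \<Longrightarrow> D (Suc k) w \<noteq> sdist w"
    and old: "\<And>i w l. i \<in> I \<Longrightarrow> w \<in> X i \<Longrightarrow> w \<notin> Y i \<Longrightarrow> l < Suc k \<Longrightarrow> D l w \<noteq> sdist w"
    and cong: "\<And>w. w \<in> V \<Longrightarrow> congested I Y w + of_bool (w = v) = congested I X w + of_bool (w = t)"
    using ow unfolding on_walk_def by blast+
  have u': "u \<in> V" "D (Suc k) v = D k u + L u v" "D (Suc k) v < D k v"
    using parent[OF k v(1)] u by auto
  obtain b where b: "sdist v = ereal b" using v sdist_not_MInf[OF v(1)] by (cases "sdist v") auto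
  have Lfin: "L u v < \<infinity>" "D k u < \<infinity>" using u'(2) v(2,3) by auto
  have i: "i \<in> I" "L u v = arc_length B f X i u v" using player[OF u'(1) v(1) Lfin(1)] by (auto simp: i_def)
  have arc: "u \<in> X i" "v \<notin> X i" "insert v (X i - {u}) \<in> B i"
    using i Lfin by (auto simp: arc_length_def split: if_splits)
  define l where "l = f i (insert v (X i - {u})) - f i (X i)"
  have l: "L u v = ereal l" using i arc by (simp add: arc_length_def l_def)
  obtain a where a: "D k u = ereal a" "b = a + l"
    using u'(2) v(2) b l by (cases "D k u") auto
  \<comment> \<open>A shortest walk without its last arc is itself shortest.\<close>
  have "sdist v \<le> sdist u + L u v" using u' v by (intro sdist_triangle)
  moreover have "sdist u \<le> D k u" using k by (intro D_antimono) auto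
  ultimately have du: "sdist u = ereal a" "D k u = sdist u"
    using a b l by (cases "sdist u"; auto)+
  \<comment> \<open>Had \<open>u\<close> attained its distance before layer \<open>k\<close>, then
    \<open>v\<close> would have attained its own by layer \<open>k\<close>, against the strict
    improvement in layer \<open>Suc k\<close>.\<close>
  have lev_u: "D j u \<noteq> sdist u" if "j < k" for j
  proof
    assume "D j u = sdist u"
    then have "D (k - 1) u = sdist u" using D_eq_sdist_mono[of j u "k - 1"] that k by simp
    moreover have "D k v \<le> D (k - 1) u + L u v" using D_step[OF u'(1), of "k - 1" v] that by simp
    ultimately show False using du u' by simp
  qed
  have pu: "p u \<le> \<delta> - a"
  proof -
    have "p u - p v \<le> l" using L_ge[OF u'(1) v(1)] l by simp
    then show ?thesis using v(4) b a by simp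
  qed
  have ru: "raised \<delta> u = \<delta> - a" using pu du by (simp add: raised_def)
  have rv: "raised \<delta> v = \<delta> - b" using v(4) b by (simp add: raised_def)
  let ?g = "\<lambda>Y. f i Y + sum (raised \<delta>) Y"
  have Xi: "minimizer (B i) ?g (X i)" and Yi: "minimizer (B i) ?g (Y i)"
    using minimizer_raised[OF i(1)] Y_min[OF i(1)] by simp_all
  have vm': "real_valuated_matroid (B i) ?g"
    using vm[OF i(1)] fin_in[OF i(1)] by (rule real_valuated_matroid_add_modular)
  have fX: "finite (X i)" using fin_in i X_in by blast
  \<comment> \<open>Both raised prices are \<open>\<delta>\<close> minus a distance, and the
    distances differ by exactly the arc length.\<close>
  have tight: "minimizer (B i) ?g (insert v (X i - {u}))"
  proof -
    have "?g (insert v (X i - {u})) = ?g (X i)"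
      using sum_exchange[OF fX arc(1,2), of "raised \<delta>"] ru rv a by (simp add: l_def)
    then show ?thesis using Xi arc(3) unfolding minimizer_def by simp
  qed
  \<comment> \<open>By the layer conditions: \<open>v\<close> attains its distance by layer
    \<open>Suc k\<close>, so it has not been inserted; \<open>u\<close> attains its distance by
    layer \<open>k\<close>, so it has not been removed.\<close>
  have vY: "v \<notin> Y i" using new[OF i(1) _ arc(2)] v(2) by blast
  have uY: "u \<in> Y i" using old[OF i(1) arc(1)] du by blast
  obtain w where w: "w \<in> Y i" "w \<notin> insert v (X i - {u})"
    "minimizer (B i) ?g (insert w (insert v (X i - {u}) - {v}))"
    "minimizer (B i) ?g (insert v (Y i - {w}))"
    using minimizer_exchange[OF vm' tight Yi _ vY] by blast
  have "w = u"
  proof (rule ccontr)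
    assume "w \<noteq> u"
    then have wX: "w \<notin> X i" using w by auto
    have "insert w (insert v (X i - {u}) - {v}) = insert w (X i - {u})" using arc by auto
    then have mw: "minimizer (B i) ?g (insert w (X i - {u}))" using w by simp
    then have inB: "insert w (X i - {u}) \<in> B i" "w \<in> V"
      using B_sub[OF i(1)] unfolding minimizer_def by blast+
    define l' where "l' = f i (insert w (X i - {u})) - f i (X i)"
    have "?g (insert w (X i - {u})) \<le> ?g (X i)" using mw X_in[OF i(1)] unfolding minimizer_def by blast
    then have tw: "l' + raised \<delta> w \<le> \<delta> - a"
      using sum_exchange[OF fX arc(1) wX, of "raised \<delta>"] ru by (simp add: l'_def)
    have Lw: "L u w \<le> ereal l'" using L_le[OF i(1), of u w] arc wX inB by (simp add: arc_length_def l'_def)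
    have up: "D (Suc k) w \<le> ereal (a + l')"
    proof -
      have "D (Suc k) w \<le> D k u + L u w" using u' by (intro D_step)
      also have "\<dots> \<le> ereal a + ereal l'" using Lw a by (intro add_mono) auto
      finally show ?thesis by simp
    qed
    moreover have dw: "sdist w \<le> D (Suc k) w" using k by (intro D_antimono) auto
    ultimately obtain d where d: "sdist w = ereal d" using sdist_not_MInf[OF inB(2)]
      by (cases "sdist w") auto
    \<comment> \<open>At the raised prices the exchange of \<open>u\<close> for \<open>w\<close> can
      be optimal only if the distance of \<open>w\<close> is attained through \<open>u\<close> in
      layer \<open>Suc k\<close>; but \<open>w\<close> counts as inserted and attains it
      later.\<close>
    have "\<delta> - d \<le> raised \<delta> w" using d by (simp add: raised_def)
    then have "a + l' \<le> d" using tw by simp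
    then have "D (Suc k) w \<le> sdist w" using up d by (metis ereal_less_eq(3) order_trans)
    then have "D (Suc k) w = sdist w" using dw by (rule antisym)
    moreover have "D (Suc k) w \<noteq> sdist w" using new[OF i(1) w(1) wX] .
    ultimately show False by contradiction
  qed
  then have Y': "minimizer (B i) ?g (insert v (Y i - {u}))" using w by simp
  let ?Y = "Y(i := insert v (Y i - {u}))"
  have "\<forall>j\<in>I. minimizer (B j) (\<lambda>Y. f j Y + sum (raised \<delta>) Y) (?Y j)"
    using Y_min Y' by simp
  moreover have "\<forall>j\<in>I. \<forall>w\<in>?Y j - X j. D k w \<noteq> sdist w"
  proof (intro ballI)
    fix j w assume jw: "j \<in> I" "w \<in> ?Y j - X j"
    show "D k w \<noteq> sdist w"
    proof (cases "w = v")
      case True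
      then show ?thesis using u'(3) v(2) by simp
    next
      case False
      then have "w \<in> Y j - X j" using jw by (auto split: if_splits)
      then have "D (Suc k) w \<noteq> sdist w" using new jw(1) by blast
      then show ?thesis using D_eq_sdist_mono[of k w "Suc k"] k by auto
    qed
  qed
  moreover have "\<forall>j\<in>I. \<forall>w\<in>X j - ?Y j. \<forall>l<k. D l w \<noteq> sdist w"
  proof (intro ballI allI impI)
    fix j w l assume jw: "j \<in> I" "w \<in> X j - ?Y j" "l < k"
    show "D l w \<noteq> sdist w"
    proof (cases "w = u")
      case True
      then show ?thesis using lev_u jw by simp
    next
      case False
      then have "w \<in> X j - Y j" using jw by (auto split: if_splits)
      then show ?thesis using old jw by (meson DiffE less_SucI)
    qed
  qed
  moreover have "\<forall>w\<in>V. congested I ?Y w + of_bool (w = u) = congested I X w + of_bool (w = t)"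
  proof
    fix w assume "w \<in> V"
    then have "congested I Y w + of_bool (w = v) = congested I X w + of_bool (w = t)" by (rule cong)
    then show "congested I ?Y w + of_bool (w = u) = congested I X w + of_bool (w = t)"
      using congested_exchange[of i u Y v w] i(1) uY vY by simp
  qed
  ultimately show ?thesis using u'(1) du pu by (simp add: on_walk_def i_def)
qed

text \<open>If \<open>Q (Suc k) v = v\<close>, only the layer number drops, and the layer conditions
  become weaker. In layer 0 only \<open>r\<close> has finite distance, so the walk has arrived
  there.\<close>

lemma on_walk_augment:
  assumes "on_walk \<delta> t k v Y" "k \<le> card V"
  shows "on_walk \<delta> t 0 r (augment Q P k v Y)"
  using assms
proof (induction k arbitrary: v Y)
  case 0
  then show ?case by (auto simp: on_walk_def split: if_splits)
next
  case (Suc k)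
  show ?case
  proof (cases "Q (Suc k) v = v")
    case True
    have "v \<in> V" using Suc.prems by (simp add: on_walk_def)
    then have eq: "D (Suc k) v = D k v" using parent[of k v] True Suc.prems(2) by auto
    have "D k w = sdist w \<Longrightarrow> D (Suc k) w = sdist w" for w
      using D_eq_sdist_mono[of k w "Suc k"] Suc.prems(2) by simp
    then have "on_walk \<delta> t k v Y" using Suc.prems(1) eq
      by (auto simp: on_walk_def)
    then show ?thesis using Suc True by (simp add: Let_def)
  next
    case False
    have "on_walk \<delta> t k (Q (Suc k) v) (Y(P (Q (Suc k) v) v := insert v (Y (P (Q (Suc k) v) v) - {Q (Suc k) v})))"
      using on_walk_step[OF Suc.prems(1) _ refl False] Suc.prems(2) by simp
    then show ?thesis using Suc False by (simp add: Let_def)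
  qed
qed

end

section \<open>The certificate after raising the cost of one slot\<close>

context exchange_graph
begin

text \<open>The root has distance 0, so its raised price reaches \<open>\<gamma>\<close>, which
  repairs the lower bound at \<open>r\<close>. At the other resources \<open>far\<close> says just
  that prices raised to this level do not exceed the next marginal cost.\<close>

lemma supports_raised_keep:
  assumes sup: "supports V I B f c p X"
    and j: "congested I X r = j" and nx: "j < card I \<Longrightarrow> \<gamma> \<le> c r (Suc j)"
    and far: "\<And>v. v \<in> V \<Longrightarrow> v \<noteq> r \<Longrightarrow> sdist v < \<infinity> \<Longrightarrow> congested I X v < card I \<Longrightarrow>
                ereal \<gamma> \<le> sdist v + ereal (c v (Suc (congested I X v)))"
  shows "supports V I B f (c(r := (c r)(j := \<gamma>))) (raised \<gamma>) X"
proof -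
  have upper: "raised \<gamma> v \<le> c v (Suc (congested I X v))" if "v \<in> V" "congested I X v < card I" for v
  proof (cases "v = r")
    case True
    have "p r \<le> c r (Suc j)" using sup root that True unfolding supports_def j[symmetric] by blast
    then show ?thesis using True nx that j by (simp add: raised_def sdist_root)
  next
    case False
    have "p v \<le> c v (Suc (congested I X v))" using sup that by (simp add: supports_def)
    then show ?thesis using far[OF that(1) False] that sdist_not_MInf[OF that(1)]
      by (cases "sdist v") (auto simp: raised_def)
  qed
  have lower: "(c(r := (c r)(j := \<gamma>))) v (congested I X v) \<le> raised \<gamma> v" if "v \<in> V" "0 < congested I X v" for v
  proof (cases "v = r")
    case True
    then show ?thesis using j by (simp add: raised_def sdist_root)
  next
    case False
    then have "c v (congested I X v) \<le> p v" using sup that by (simp add: supports_def)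
    then show ?thesis using False raised_ge[of v \<gamma>] by simp
  qed
  show ?thesis unfolding supports_def using upper lower minimizer_raised j by auto
qed

end

context augmentation
begin

text \<open>The raised price of \<open>r\<close> is \<open>\<delta> \<le> \<gamma>\<close>, so it
  does not exceed the new cost of the vacated slot \<open>j\<close>; that of \<open>t\<close> is
  exactly the marginal cost of the slot newly occupied there. All other congestions are unchanged,
  and \<open>far\<close> bounds their prices.\<close>

lemma supports_augment:
  assumes sup: "supports V I B f c p X"
    and j: "congested I X r = j" "0 < j"
    and c_mono: "\<And>v k. v \<in> V \<Longrightarrow> 0 < k \<Longrightarrow> c v k \<le> c v (Suc k)"
    and nx: "\<gamma> \<le> c r (Suc j)"
    and t: "t \<in> V" "t \<noteq> r" "congested I X t < card I"
      "sdist t + ereal (c t (Suc (congested I X t))) = ereal \<delta>"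
    and \<delta>: "\<delta> \<le> \<gamma>"
    and far: "\<And>v. v \<in> V \<Longrightarrow> v \<noteq> r \<Longrightarrow> sdist v < \<infinity> \<Longrightarrow> congested I X v < card I \<Longrightarrow>
                ereal \<delta> \<le> sdist v + ereal (c v (Suc (congested I X v)))"
  shows "supports V I B f (c(r := (c r)(j := \<gamma>))) (raised \<delta>) (augment Q P (card V) t X)"
proof -
  let ?Y = "augment Q P (card V) t X"
  let ?x = "congested I X" and ?y = "congested I ?Y"
  have base: "c v (?x v) \<le> p v" if "v \<in> V" "0 < ?x v" for v using sup that by (simp add: supports_def)
  have base': "p v \<le> c v (Suc (?x v))" if "v \<in> V" "?x v < card I" for v using sup that by (simp add: supports_def)
  obtain b where b: "sdist t = ereal b" "b + c t (Suc (?x t)) = \<delta>"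
    using t(4) by (cases "sdist t") auto
  have "on_walk \<delta> t (card V) t X"
    using t b base'[OF t(1,3)] minimizer_raised by (auto simp: on_walk_def)
  from on_walk_augment[OF this] have ow: "on_walk \<delta> t 0 r ?Y" by simp
  then have mins: "\<forall>i\<in>I. minimizer (B i) (\<lambda>Y. f i Y + sum (raised \<delta>) Y) (?Y i)"
    and cong: "\<And>w. w \<in> V \<Longrightarrow> ?y w + of_bool (w = r) = ?x w + of_bool (w = t)"
    and pr: "p r \<le> \<delta>" by (auto simp: on_walk_def sdist_root)
  have rr: "raised \<delta> r = \<delta>" using pr by (simp add: raised_def sdist_root)
  have rt: "raised \<delta> t = c t (Suc (?x t))" using b base'[OF t(1,3)] by (auto simp: raised_def)
  have yr: "?y r = j - 1" and yt: "?y t = Suc (?x t)"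
    using cong[of r] cong[OF t(1)] root t(2) j by auto
  have y: "?y v = ?x v" if "v \<in> V" "v \<noteq> r" "v \<noteq> t" for v using cong[of v] that by simp
  have upper: "raised \<delta> v \<le> (c(r := (c r)(j := \<gamma>))) v (Suc (?y v))" if v: "v \<in> V" "?y v < card I" for v
  proof -
    consider "v = r" | "v = t" | "v \<noteq> r" "v \<noteq> t" by blast
    then show ?thesis
    proof cases
      case 1
      then show ?thesis using yr j rr \<delta> by simp
    next
      case 2
      then show ?thesis using yt t rt c_mono by simp
    next
      case 3
      then have x: "?x v < card I" using y v by simp
      show ?thesis using 3 far[OF v(1) 3(1) _ x] base'[OF v(1) x] y[OF v(1) 3] sdist_not_MInf[OF v(1)]
        by (cases "sdist v") (auto simp: raised_def)
    qed
  qed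
  have lower: "(c(r := (c r)(j := \<gamma>))) v (?y v) \<le> raised \<delta> v" if v: "v \<in> V" "0 < ?y v" for v
  proof -
    consider "v = r" | "v = t" | "v \<noteq> r" "v \<noteq> t" by blast
    then show ?thesis
    proof cases
      case 1
      \<comment> \<open>The lower bound at \<open>r\<close> now concerns slot \<open>j - 1\<close>,
        which costs at most the old cost of slot \<open>j\<close>.\<close>
      have "c r (j - 1) \<le> c r j" using c_mono[of r "j - 1"] root v 1 yr by simp
      also have "\<dots> \<le> p r" using base[OF root] j by simp
      finally have "c r (j - 1) \<le> p r" .
      moreover have "j - 1 \<noteq> j" using j by simp
      ultimately show ?thesis using 1 yr rr pr by simp
    next
      case 2
      then show ?thesis using yt t rt by simp
    next
      case 3
      then show ?thesis using base[OF v(1)] y[OF v(1) 3] v raised_ge[of v \<delta>] by simp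
    qed
  qed
  show ?thesis unfolding supports_def using upper lower mins by blast
qed

end

text \<open>The cost of slot \<open>j\<close> serves as a lower bound only if the congestion of
  \<open>r\<close> is \<open>j\<close>; where it serves as an upper bound, raising it does no
  harm.\<close>

lemma supports_slot_unused:
  assumes "supports V I B f c p X" "congested I X r \<noteq> j" "c r j \<le> \<gamma>"
  shows "supports V I B f (c(r := (c r)(j := \<gamma>))) p X"
  using assms unfolding supports_def by fastforce

text \<open>Identifies cost tables that differ only in slot 0 or beyond \<open>card I\<close>, where
  no condition of the certificate looks.\<close>

lemma supports_cong:
  assumes "finite I" "\<And>v k. v \<in> V \<Longrightarrow> 0 < k \<Longrightarrow> k \<le> card I \<Longrightarrow> c v k = c' v k"
  shows "supports V I B f c p X \<longleftrightarrow> supports V I B f c' p X"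
proof -
  have "congested I X v \<le> card I" for v using assms(1) by (auto simp: congested_def intro!: card_mono)
  then show ?thesis unfolding supports_def using assms(2) by (intro conj_cong ball_cong refl) (auto simp: Suc_le_eq)
qed

section \<open>Optimality of certified states\<close>

lemma sum_congested:
  fixes p :: "'a \<Rightarrow> 'b::comm_semiring_1"
  assumes "finite V" "finite I" "\<And>i. i \<in> I \<Longrightarrow> X i \<subseteq> V"
  shows "(\<Sum>i\<in>I. sum p (X i)) = (\<Sum>v\<in>V. of_nat (congested I X v) * p v)"
proof -
  have "(\<Sum>i\<in>I. sum p (X i)) = (\<Sum>i\<in>I. \<Sum>v\<in>V. if v \<in> X i then p v else 0)"
    using assms(1,3) by (intro sum.cong[OF refl, of I]) (simp flip: sum.inter_restrict add: inf_absorb2)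
  also have "\<dots> = (\<Sum>v\<in>V. \<Sum>i\<in>I. if v \<in> X i then p v else 0)" by (rule sum.swap)
  also have "\<dots> = (\<Sum>v\<in>V. of_nat (congested I X v) * p v)"
    using assms(2) by (intro sum.cong refl) (simp add: congested_def sum.inter_filter[symmetric])
  finally show ?thesis .
qed

text \<open>\<open>q\<close> is a subgradient of \<open>\<phi>\<close> at \<open>x\<close> on the
  range from 0 to \<open>n\<close>; at an end of the range one of its two bounds is void.\<close>

lemma convex_le_of_marginals:
  fixes \<phi> :: "nat \<Rightarrow> real"
  assumes conv: "\<And>k. \<phi> (Suc k) - \<phi> k \<le> \<phi> (Suc (Suc k)) - \<phi> (Suc k)"
    and lo: "0 < x \<Longrightarrow> \<phi> x - \<phi> (x - 1) \<le> q" and up: "x < n \<Longrightarrow> q \<le> \<phi> (Suc x) - \<phi> x"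
    and k: "k \<le> n"
  shows "\<phi> x - real x * q \<le> \<phi> k - real k * q"
proof -
  have mono: "\<phi> (Suc a) - \<phi> a \<le> \<phi> (Suc b) - \<phi> b" if "a \<le> b" for a b
    using lift_Suc_mono_le[of "\<lambda>a. \<phi> (Suc a) - \<phi> a", OF conv that] .
  show ?thesis
  proof (cases "x \<le> k")
    case True
    then show ?thesis using k
    proof (induction k rule: dec_induct)
      case (step k)
      then have "q \<le> \<phi> (Suc k) - \<phi> k" using up mono[of x k] by simp
      then show ?case using step by (simp add: algebra_simps)
    qed simp
  next
    case False
    then have "k \<le> x" by simp
    then show ?thesis
    proof (induction k rule: inc_induct)
      case (step k)
      have "k \<le> x - 1" "0 < x" using step(2) by simp_all
      then have "\<phi> (Suc k) - \<phi> k \<le> q" using lo mono[of k "x - 1"] by simp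
      then show ?case using step by (simp add: algebra_simps)
    qed simp
  qed
qed

text \<open>Weak duality: by \<open>sum_congested\<close> the prices summed over players equal those
  summed over resources, so \<open>p\<close> cancels when the two separate minimality statements are
  added.\<close>

lemma supports_imp_optimal:
  fixes \<phi> :: "'a \<Rightarrow> nat \<Rightarrow> real"
  assumes fin: "finite V" "finite I" and sub: "\<And>i Y. i \<in> I \<Longrightarrow> Y \<in> B i \<Longrightarrow> Y \<subseteq> V"
    and conv: "\<And>v k. v \<in> V \<Longrightarrow> \<phi> v (Suc k) - \<phi> v k \<le> \<phi> v (Suc (Suc k)) - \<phi> v (Suc k)"
    and sup: "supports V I B f (\<lambda>v k. \<phi> v k - \<phi> v (k - 1)) p X"
    and Y: "\<And>i. i \<in> I \<Longrightarrow> Y i \<in> B i"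
  shows "(\<Sum>i\<in>I. f i (X i)) + (\<Sum>v\<in>V. \<phi> v (congested I X v))
       \<le> (\<Sum>i\<in>I. f i (Y i)) + (\<Sum>v\<in>V. \<phi> v (congested I Y v))"
proof -
  have X: "X i \<in> B i" if "i \<in> I" for i using sup that by (auto simp: supports_def minimizer_def)
  have "(\<Sum>i\<in>I. f i (X i) + sum p (X i)) \<le> (\<Sum>i\<in>I. f i (Y i) + sum p (Y i))"
    using sup Y by (intro sum_mono) (auto simp: supports_def minimizer_def)
  moreover have "(\<Sum>i\<in>I. sum p (X i)) = (\<Sum>v\<in>V. real (congested I X v) * p v)"
    using fin X sub by (intro sum_congested) auto
  moreover have "(\<Sum>i\<in>I. sum p (Y i)) = (\<Sum>v\<in>V. real (congested I Y v) * p v)"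
    using fin Y sub by (intro sum_congested) auto
  moreover have "(\<Sum>v\<in>V. \<phi> v (congested I X v) - real (congested I X v) * p v)
     \<le> (\<Sum>v\<in>V. \<phi> v (congested I Y v) - real (congested I Y v) * p v)"
  proof (intro sum_mono convex_le_of_marginals[where n = "card I"])
    fix v assume "v \<in> V"
    show "congested I Y v \<le> card I" using fin by (auto simp: congested_def intro!: card_mono)
  qed (use sup conv in \<open>auto simp: supports_def\<close>)
  ultimately show ?thesis by (simp add: sum.distrib sum_subtractf)
qed

section \<open>Reasoning about timed programs\<close>

text \<open>Bounds the running time provided that every loop makes at most \<open>W\<close> iterations.\<close>

primrec step_bound :: "nat \<Rightarrow> com \<Rightarrow> nat" where
  "step_bound W Skip = 1"
| "step_bound W (NAssign x es e) = 1"
| "step_bound W (RAssign x es e') = 1"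
| "step_bound W (CallOmega f y e A es) = 1"
| "step_bound W (CallD y e k) = 1"
| "step_bound W (Seq c1 c2) = step_bound W c1 + step_bound W c2"
| "step_bound W (Cond b c1 c2) = 1 + step_bound W c1 + step_bound W c2"
| "step_bound W (While b c) = 1 + W * (1 + step_bound W c)"

text \<open>The functions below some \<open>C * W ^ k\<close> include 1 and are closed under
  addition and under multiplication by \<open>W\<close>, and \<open>step_bound\<close> is built from
  these. \<open>W > 0\<close> allows two summands to be brought to a common exponent.\<close>

lemma step_bound_polynomial: "\<exists>C k. \<forall>W>0. step_bound W c \<le> C * W ^ k"
proof -
  have const: "\<exists>C k. \<forall>W>0. (1::nat) \<le> C * W ^ k"
    by (rule exI[of _ 1], rule exI[of _ 0]) simp
  have add: "\<exists>C k. \<forall>W>0. g W + h W \<le> C * W ^ k"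
    if g: "\<exists>C k. \<forall>W>0. g W \<le> C * W ^ k" and h: "\<exists>C k. \<forall>W>0. h W \<le> C * W ^ k" for g h :: "nat \<Rightarrow> nat"
  proof -
    obtain C1 k1 where 1: "\<And>W. W > 0 \<Longrightarrow> g W \<le> C1 * W ^ k1" using g by blast
    obtain C2 k2 where 2: "\<And>W. W > 0 \<Longrightarrow> h W \<le> C2 * W ^ k2" using h by blast
    have "g W + h W \<le> (C1 + C2) * W ^ (k1 + k2)" if W: "W > 0" for W
    proof -
      have "W ^ k1 \<le> W ^ (k1 + k2)" "W ^ k2 \<le> W ^ (k1 + k2)"
        using W by (auto intro!: power_increasing)
      then have "C1 * W ^ k1 \<le> C1 * W ^ (k1 + k2)" "C2 * W ^ k2 \<le> C2 * W ^ (k1 + k2)"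
        by (simp_all only: mult_le_mono2)
      then show ?thesis using 1[OF W] 2[OF W] unfolding add_mult_distrib by linarith
    qed
    then show ?thesis by blast
  qed
  have times: "\<exists>C k. \<forall>W>0. W * g W \<le> C * W ^ k" if g: "\<exists>C k. \<forall>W>0. g W \<le> C * W ^ k" for g :: "nat \<Rightarrow> nat"
  proof -
    obtain C k where "\<forall>W>0. g W \<le> C * W ^ k" using g by blast
    then have "\<forall>W>0. W * g W \<le> C * W ^ Suc k"
      by (metis mult.left_commute mult_le_mono2 power_Suc)
    then show ?thesis by blast
  qed
  show ?thesis
    by (induction c) (simp_all only: step_bound.simps, (rule const add times | assumption)+)
qed

abbreviation seq_com :: "com \<Rightarrow> com \<Rightarrow> com" (infixr ";;" 60) where
  "c1 ;; c2 \<equiv> Seq c1 c2"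

abbreviation scalar :: "vname \<Rightarrow> nexp" where
  "scalar x \<equiv> NVar x []"

abbreviation rscalar :: "vname \<Rightarrow> rexp" where
  "rscalar x \<equiv> RVar x []"

abbreviation nonzero :: "nexp \<Rightarrow> bexp" where
  "nonzero e \<equiv> NLess (NConst 0) e"

definition neq :: "nexp \<Rightarrow> nexp \<Rightarrow> bexp" where
  "neq a b = BNot (BAnd (BNot (NLess a b)) (BNot (NLess b a)))"

lemma bval_neq [simp]: "bval (neq a b) s \<longleftrightarrow> nval a s \<noteq> nval b s"
  by (auto simp: neq_def)

definition For :: "vname \<Rightarrow> nexp \<Rightarrow> com \<Rightarrow> com" where
  "For x e c = NAssign x [] (NConst 0) ;;
     While (NLess (scalar x) e) (c ;; NAssign x [] (NAdd (scalar x) (NConst 1)))"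

lemma nmem_nupdate [simp]: "nmem (nupdate x js a s) = (nmem s)(x := (nmem s x)(js := a))"
  and rmem_nupdate [simp]: "rmem (nupdate x js a s) = rmem s"
  and nmem_rupdate [simp]: "nmem (rupdate x js b s) = nmem s"
  and rmem_rupdate [simp]: "rmem (rupdate x js b s) = (rmem s)(x := (rmem s x)(js := b))"
  by (simp_all add: nupdate_def rupdate_def)

definition rows :: "store \<Rightarrow> nat \<Rightarrow> nat set" where
  "rows s i = {j. nmem s ''X'' [i, j] \<noteq> 0}"

lemma rows_nupdate_other [simp]: "x \<noteq> ''X'' \<Longrightarrow> rows (nupdate x js a s) = rows s"
  and rows_rupdate [simp]: "rows (rupdate x js b s) = rows s"
  and rows_insert [simp]: "rows (nupdate ''X'' [i, j] (Suc 0) s) = (rows s)(i := insert j (rows s i))"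
  and rows_remove [simp]: "rows (nupdate ''X'' [i, j] 0 s) = (rows s)(i := rows s i - {j})"
  by (auto simp: rows_def fun_eq_iff)

lemma rows_nmem: "nmem s ''X'' [i, j] = 0 \<longleftrightarrow> j \<notin> rows s i" "0 < nmem s ''X'' [i, j] \<longleftrightarrow> j \<in> rows s i"
  by (auto simp: rows_def)

text \<open>The frame condition of the program lemmas: the two sets name the arrays that a program
  may write.\<close>

definition agree :: "vname set \<Rightarrow> vname set \<Rightarrow> store \<Rightarrow> store \<Rightarrow> bool" where
  "agree NS RS s s' \<longleftrightarrow>
     (\<forall>x. x \<notin> NS \<longrightarrow> nmem s' x = nmem s x) \<and> (\<forall>x. x \<notin> RS \<longrightarrow> rmem s' x = rmem s x)"

lemma agree_rows: "agree NS RS s s' \<Longrightarrow> ''X'' \<notin> NS \<Longrightarrow> rows s' = rows s"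
  by (simp add: agree_def rows_def fun_eq_iff)

lemma agree_trans:
  "agree NS RS s s' \<Longrightarrow> agree NS' RS' s' s'' \<Longrightarrow> NS \<union> NS' \<subseteq> NS'' \<Longrightarrow> RS \<union> RS' \<subseteq> RS'' \<Longrightarrow> agree NS'' RS'' s s''"
  unfolding agree_def by (metis Un_iff subsetD)

lemma agree_refl [simp]: "agree NS RS s s"
  by (simp add: agree_def)

lemma agree_nupdate [simp]: "x \<in> NS \<Longrightarrow> agree NS RS s (nupdate x js a s') \<longleftrightarrow> agree NS RS s s'"
  and agree_rupdate [simp]: "y \<in> RS \<Longrightarrow> agree NS RS s (rupdate y js b s') \<longleftrightarrow> agree NS RS s s'"
  unfolding agree_def by (auto; metis)+

section \<open>Total correctness with time bounds\<close>

locale ram =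
  fixes \<Omega> :: "nat \<Rightarrow> nat set \<Rightarrow> ereal" and \<Delta> :: "nat \<Rightarrow> nat \<Rightarrow> real" and W :: nat
begin

text \<open>A total-correctness triple whose time bound is determined by the program text, so that
  no invariant has to carry it.\<close>

definition runs :: "com \<Rightarrow> store \<Rightarrow> (store \<Rightarrow> bool) \<Rightarrow> bool" where
  "runs c s Q \<longleftrightarrow> (\<exists>t s'. exec \<Omega> \<Delta> c s t s' \<and> t \<le> step_bound W c \<and> Q s')"

lemma runs_mono: "runs c s Q \<Longrightarrow> (\<And>s'. Q s' \<Longrightarrow> R s') \<Longrightarrow> runs c s R"
  unfolding runs_def by blast

lemma runs_Skip: "Q s \<Longrightarrow> runs Skip s Q"
  unfolding runs_def using exec.Skip by force

lemma runs_NAssign: "Q (nupdate x (map (\<lambda>e. nval e s) es) (nval e s) s) \<Longrightarrow> runs (NAssign x es e) s Q"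
  unfolding runs_def using exec.NAssign by force

lemma runs_RAssign: "Q (rupdate x (map (\<lambda>e. nval e s) es) (rval e s) s) \<Longrightarrow> runs (RAssign x es e) s Q"
  unfolding runs_def using exec.RAssign by force

lemma runs_CallD: "Q (rupdate y [] (\<Delta> (nval e s) (nval k s)) s) \<Longrightarrow> runs (CallD y e k) s Q"
  unfolding runs_def using exec.CallD by force

text \<open>The two oracle rules in one: \<open>real_of_ereal\<close> sends infinity to 0, the value
  stored in that case. At minus infinity no rule applies, hence the first premise.\<close>

lemma runs_CallOmega:
  assumes "\<Omega> (nval e s) (rows s (nval e s)) \<noteq> -\<infinity>"
    and "Q (nupdate f [] (of_bool (\<Omega> (nval e s) (rows s (nval e s)) \<noteq> \<infinity>))
           (rupdate y [] (real_of_ereal (\<Omega> (nval e s) (rows s (nval e s)))) s))"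
  shows "runs (CallOmega f y e ''X'' [e]) s Q"
proof -
  have row: "{j. nmem s ''X'' (map (\<lambda>e. nval e s) [e] @ [j]) \<noteq> 0} = rows s (nval e s)"
    by (simp add: rows_def)
  show ?thesis
  proof (cases "\<Omega> (nval e s) (rows s (nval e s))")
    case (real a)
    then have "exec \<Omega> \<Delta> (CallOmega f y e ''X'' [e]) s 1 (nupdate f [] 1 (rupdate y [] a s))"
      by (intro CallOmega_finite) (simp only: row)
    then show ?thesis using assms(2) real unfolding runs_def by force
  next
    case PInf
    then have "exec \<Omega> \<Delta> (CallOmega f y e ''X'' [e]) s 1 (nupdate f [] 0 (rupdate y [] 0 s))"
      by (intro CallOmega_infinite) (simp only: row)
    then show ?thesis using assms(2) PInf unfolding runs_def by force
  qed (use assms(1) in simp)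
qed

lemma runs_Seq: "runs c1 s (\<lambda>s'. runs c2 s' Q) \<Longrightarrow> runs (c1 ;; c2) s Q"
  unfolding runs_def using exec.Seq by (fastforce intro: add_mono)

lemma runs_Cond: "(bval b s \<Longrightarrow> runs c1 s Q) \<Longrightarrow> (\<not> bval b s \<Longrightarrow> runs c2 s Q) \<Longrightarrow> runs (Cond b c1 c2) s Q"
proof (cases "bval b s")
  case True
  assume "bval b s \<Longrightarrow> runs c1 s Q"
  then obtain t s' where "exec \<Omega> \<Delta> c1 s t s'" "t \<le> step_bound W c1" "Q s'" using True by (auto simp: runs_def)
  then show ?thesis unfolding runs_def using Cond_true[OF True]
    by (intro exI[of _ "1 + t"] exI[of _ s']) auto
next
  case False
  assume "\<not> bval b s \<Longrightarrow> runs c2 s Q"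
  then obtain t s' where "exec \<Omega> \<Delta> c2 s t s'" "t \<le> step_bound W c2" "Q s'" using False by (auto simp: runs_def)
  then show ?thesis unfolding runs_def using Cond_false[OF False]
    by (intro exI[of _ "1 + t"] exI[of _ s']) auto
qed

text \<open>The bound \<open>e\<close> is evaluated anew at each test, so by \<open>ctr\<close> the
  invariant has to imply that its value is still \<open>N\<close>.\<close>

lemma runs_For:
  assumes N: "N \<le> W"
    and init: "I 0 (nupdate x [] 0 s)"
    and ctr: "\<And>k s. k \<le> N \<Longrightarrow> I k s \<Longrightarrow> nval e s = N \<and> nmem s x [] = k"
    and body: "\<And>k s. k < N \<Longrightarrow> I k s \<Longrightarrow>
       runs c s (\<lambda>s'. nmem s' x [] = k \<and> I (Suc k) (nupdate x [] (Suc k) s'))"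
    and post: "\<And>s. I N s \<Longrightarrow> Q s"
  shows "runs (For x e c) s Q"
proof -
  let ?c = "c ;; NAssign x [] (NAdd (scalar x) (NConst 1))"
  let ?T = "1 + step_bound W ?c"
  \<comment> \<open>Induction downwards from \<open>N\<close>; the time covers the remaining
    \<open>N - k\<close> rounds and the final test.\<close>
  have loop: "\<exists>t s'. exec \<Omega> \<Delta> (While (NLess (scalar x) e) ?c) s t s' \<and> t \<le> 1 + (N - k) * ?T \<and> Q s'"
    if "I k s" "k \<le> N" for k s
    using that(2,1)
  proof (induction k arbitrary: s rule: inc_induct)
    case base
    have "exec \<Omega> \<Delta> (While (NLess (scalar x) e) ?c) s 1 s"
      using ctr[OF _ base] by (intro While_false) simp
    then show ?case using post[OF base] by force
  next
    case (step k)
    obtain t1 s1 where s1: "exec \<Omega> \<Delta> c s t1 s1" "t1 \<le> step_bound W c" "nmem s1 x [] = k"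
      "I (Suc k) (nupdate x [] (Suc k) s1)"
      using body[OF step(2) step.prems] unfolding runs_def by blast
    obtain t2 s2 where s2: "exec \<Omega> \<Delta> (While (NLess (scalar x) e) ?c) (nupdate x [] (Suc k) s1) t2 s2"
      "t2 \<le> 1 + (N - Suc k) * ?T" "Q s2"
      using step.IH[OF s1(4)] by blast
    have "exec \<Omega> \<Delta> (NAssign x [] (NAdd (scalar x) (NConst 1))) s1 1 (nupdate x [] (Suc k) s1)"
      using exec.NAssign[of \<Omega> \<Delta> x "[]" "NAdd (scalar x) (NConst 1)" s1] s1(3) by simp
    then have "exec \<Omega> \<Delta> ?c s (t1 + 1) (nupdate x [] (Suc k) s1)" by (rule exec.Seq[OF s1(1)])
    moreover have "bval (NLess (scalar x) e) s" using ctr[OF _ step.prems] step(2) by simp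
    ultimately have "exec \<Omega> \<Delta> (While (NLess (scalar x) e) ?c) s (1 + (t1 + 1) + t2) s2"
      using s2(1) by (intro While_true)
    moreover have "1 + (t1 + 1) + t2 \<le> 1 + (N - k) * ?T"
    proof -
      have "N - k = Suc (N - Suc k)" using step(2) by simp
      then show ?thesis using s1(2) s2(2) by simp
    qed
    ultimately show ?case using s2(3) by blast
  qed
  obtain t s' where t: "exec \<Omega> \<Delta> (While (NLess (scalar x) e) ?c) (nupdate x [] 0 s) t s'"
    "t \<le> 1 + N * ?T" "Q s'"
    using loop[OF init] by auto
  have "exec \<Omega> \<Delta> (For x e c) s (1 + t) s'"
    unfolding For_def using exec.NAssign[of \<Omega> \<Delta> x "[]" "NConst 0" s] t(1) by (intro exec.Seq) auto
  moreover have "N * ?T \<le> W * ?T" using N by (rule mult_le_mono1)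
  then have "1 + t \<le> step_bound W (For x e c)" using t(2) by (simp add: For_def)
  ultimately show ?thesis using t(3) unfolding runs_def by blast
qed

lemmas runs_straight = runs_Skip runs_NAssign runs_RAssign runs_CallD runs_CallOmega runs_Seq runs_Cond

end

section \<open>The greedy algorithm\<close>

text \<open>Loops count from 0, players are numbered from 1.\<close>

abbreviation player :: nexp where
  "player \<equiv> NAdd (scalar ''i'') (NConst 1)"

definition bases :: "nat \<Rightarrow> (nat \<Rightarrow> nat set \<Rightarrow> ereal) \<Rightarrow> nat \<Rightarrow> nat set set" where
  "bases m \<Omega> i = {S. S \<subseteq> {..<m} \<and> \<Omega> i S < \<infinity>}"

definition valuation :: "(nat \<Rightarrow> nat set \<Rightarrow> ereal) \<Rightarrow> nat \<Rightarrow> nat set \<Rightarrow> real" where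
  "valuation \<Omega> i S = real_of_ereal (\<Omega> i S)"

text \<open>The increment \<open>\<phi> v k - \<phi> v (k - 1)\<close> of
  \<open>\<phi> v k = k * \<Delta> v k\<close>.\<close>

definition marginal :: "(nat \<Rightarrow> nat \<Rightarrow> real) \<Rightarrow> nat \<Rightarrow> nat \<Rightarrow> real" where
  "marginal \<Delta> v k = real k * \<Delta> v k - real (k - 1) * \<Delta> v (k - 1)"

text \<open>The oracle reads a row of memory, so the exchanged set is written into the player's own
  row and undone after the call.\<close>

definition test_exchange :: com where
  "test_exchange =
     NAssign ''X'' [player, scalar ''u''] (NConst 0) ;;
     NAssign ''X'' [player, scalar ''v''] (NConst 1) ;;
     CallOmega ''f'' ''y'' player ''X'' [player] ;;
     NAssign ''X'' [player, scalar ''v''] (NConst 0) ;;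
     NAssign ''X'' [player, scalar ''u''] (NConst 1)"

definition try_replacement :: com where
  "try_replacement =
     Cond (nonzero (NVar ''X'' [player, scalar ''v'']))
       Skip
       (test_exchange ;;
        Cond (BAnd (nonzero (scalar ''f'')) (RLess (rscalar ''y'') (rscalar ''best'')))
          (RAssign ''best'' [] (rscalar ''y'') ;; NAssign ''w'' [] (scalar ''v''))
          Skip)"

text \<open>Putting \<open>u\<close> back is the initial candidate, so the chosen \<open>w\<close>
  is never worse than keeping the base.\<close>

definition improve_base :: com where
  "improve_base =
     Cond (nonzero (NVar ''X'' [player, scalar ''u'']))
       (CallOmega ''f'' ''best'' player ''X'' [player] ;;
        NAssign ''w'' [] (scalar ''u'') ;;
        For ''v'' (scalar ''m'') try_replacement ;;
        NAssign ''X'' [player, scalar ''u''] (NConst 0) ;;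
        NAssign ''X'' [player, scalar ''w''] (NConst 1))
       Skip"

definition greedy :: com where
  "greedy = For ''i'' (scalar ''n'') (For ''u'' (scalar ''m'') improve_base)"

definition best_exchange :: "'a set set \<Rightarrow> ('a set \<Rightarrow> real) \<Rightarrow> 'a \<Rightarrow> 'a set \<Rightarrow> 'a set \<Rightarrow> bool" where
  "best_exchange B f u A A' \<longleftrightarrow>
     (\<exists>w. w \<notin> A - {u} \<and> A' = insert w (A - {u}) \<and> A' \<in> B \<and>
        (\<forall>x. x \<notin> A - {u} \<longrightarrow> insert x (A - {u}) \<in> B \<longrightarrow> f A' \<le> f (insert x (A - {u}))))"

text \<open>\<open>C\<close> is the base the greedy algorithm starts from; the elements of the current base \<open>A\<close> other than the
  not yet visited ones of \<open>C\<close> have been fixed.\<close>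

definition greedy_invariant :: "nat set set \<Rightarrow> (nat set \<Rightarrow> real) \<Rightarrow> nat \<Rightarrow> nat set \<Rightarrow> bool" where
  "greedy_invariant B f k A \<longleftrightarrow>
     A \<in> B \<and> (\<exists>C Y. C \<inter> {k..} \<subseteq> A \<and> minimizer B f Y \<and> A - (C \<inter> {k..}) \<subseteq> Y)"

text \<open>The visited \<open>k\<close> may belong to \<open>C\<close> or may have been inserted by
  an earlier step. In both cases it is given up, and \<open>greedy_exchange\<close> is applied to
  the remaining fixed elements \<open>F\<close>.\<close>

lemma greedy_invariant_step:
  fixes k :: nat
  assumes vm: "real_valuated_matroid B f" and inv: "greedy_invariant B f k A"
    and A': "if k \<in> A then best_exchange B f k A A' else A' = A"
  shows "greedy_invariant B f (Suc k) A'"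
proof -
  obtain C Y where C: "C \<inter> {k..} \<subseteq> A" "minimizer B f Y" "A - (C \<inter> {k..}) \<subseteq> Y" and A: "A \<in> B"
    using inv unfolding greedy_invariant_def by blast
  have split: "C \<inter> {k..} = C \<inter> {Suc k..} \<union> (C \<inter> {k})" by (auto simp: Suc_le_eq order_le_less)
  show ?thesis
  proof (cases "k \<in> A")
    case False
    then have "C \<inter> {k..} = C \<inter> {Suc k..}" using C(1) split by blast
    then show ?thesis using False A' A C unfolding greedy_invariant_def by auto
  next
    case True
    then obtain w where w: "w \<notin> A - {k}" "A' = insert w (A - {k})" "A' \<in> B"
      "\<And>x. x \<notin> A - {k} \<Longrightarrow> insert x (A - {k}) \<in> B \<Longrightarrow> f A' \<le> f (insert x (A - {k}))"
      using A' unfolding best_exchange_def by auto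
    define F where "F = A - {k} - C \<inter> {Suc k..}"
    have "F \<subseteq> Y" using C(3) split by (auto simp: F_def)
    then obtain Z where Z: "minimizer B f Z" "insert w F \<subseteq> Z"
      using greedy_exchange[OF vm w(3)[unfolded w(2)] w(4)[unfolded w(2)] C(2) _ _ w(1), of F]
      by (auto simp: F_def)
    have "C \<inter> {Suc k..} \<subseteq> A'" using C(1) w by fastforce
    moreover have "A' - C \<inter> {Suc k..} \<subseteq> insert w F" using w by (auto simp: F_def)
    ultimately show ?thesis using Z w(3) unfolding greedy_invariant_def by blast
  qed
qed

lemma greedy_invariant_init:
  fixes A :: "nat set"
  assumes "finite B" "A \<in> B"
  shows "greedy_invariant B f 0 A"
proof -
  obtain Y where "Y \<in> B" "\<And>Z. Z \<in> B \<Longrightarrow> f Y \<le> f Z"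
    using ex_is_arg_min_if_finite[of B f] assms by (auto simp: is_arg_min_linorder)
  then have "minimizer B f Y" by (simp add: minimizer_def)
  moreover have "A \<inter> {0..} \<subseteq> A" "A - (A \<inter> {0..}) \<subseteq> Y" by auto
  ultimately show ?thesis using assms(2) unfolding greedy_invariant_def by blast
qed

text \<open>No element of \<open>C\<close> is left unvisited, so all of \<open>A\<close> is fixed
  and lies in a minimiser; a base contained in a base equals it.\<close>

lemma greedy_invariant_final:
  fixes A :: "nat set"
  assumes "real_valuated_matroid B f" "greedy_invariant B f m A" "\<And>S. S \<in> B \<Longrightarrow> S \<subseteq> {..<m}"
  shows "minimizer B f A"
proof -
  obtain C Y where C: "C \<inter> {m..} \<subseteq> A" "minimizer B f Y" "A - (C \<inter> {m..}) \<subseteq> Y" and A: "A \<in> B"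
    using assms(2) unfolding greedy_invariant_def by blast
  have "A \<inter> {m..} = {}" using assms(3)[OF A] by auto
  then have "A \<subseteq> Y" using C(3) by auto
  moreover have "Y \<in> B" using C(2) by (simp add: minimizer_def)
  ultimately have "A = Y" using real_valuated_matroid_subset_eq[OF assms(1) A] by blast
  then show ?thesis using C(2) by simp
qed

text \<open>Loops run over resources, layers, players or slots, hence \<open>m\<close> or
  \<open>n\<close> times. The summand 1 keeps the bound positive even if both are 0.\<close>

locale game_oracles = ram \<Omega> \<Delta> "m + n + 1"
  for \<Omega> :: "nat \<Rightarrow> nat set \<Rightarrow> ereal" and \<Delta> :: "nat \<Rightarrow> nat \<Rightarrow> real" and n m :: nat +
  assumes nonneg: "\<And>i S. i \<in> {1..n} \<Longrightarrow> S \<subseteq> {..<m} \<Longrightarrow> 0 \<le> \<Omega> i S"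
    and vmat: "\<And>i. i \<in> {1..n} \<Longrightarrow> real_valuated_matroid (bases m \<Omega> i) (valuation \<Omega> i)"
    and marginal_nonneg: "\<And>v k. v < m \<Longrightarrow> 0 < k \<Longrightarrow> 0 \<le> marginal \<Delta> v k"
    and marginal_mono: "\<And>v k. v < m \<Longrightarrow> 0 < k \<Longrightarrow> marginal \<Delta> v k \<le> marginal \<Delta> v (Suc k)"
begin

abbreviation "Bs \<equiv> bases m \<Omega>"
abbreviation "fs \<equiv> valuation \<Omega>"

lemma bases_iff: "i \<in> {1..n} \<Longrightarrow> S \<subseteq> {..<m} \<Longrightarrow> \<Omega> i S \<noteq> \<infinity> \<longleftrightarrow> S \<in> Bs i"
  by (auto simp: bases_def)

text \<open>\<open>X\<close> counts as written although \<open>rows\<close> is restored: a nonzero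
  entry may come back as a different nonzero number.\<close>

lemma runs_test_exchange:
  assumes "nmem s ''i'' [] < n" "nmem s ''v'' [] < m"
    and "i = Suc (nmem s ''i'' [])" "u = nmem s ''u'' []" "v = nmem s ''v'' []"
    and "rows s i \<subseteq> {..<m}" "u \<in> rows s i" "v \<notin> rows s i"
    and post: "\<And>s'. agree {''X'', ''f''} {''y''} s s' \<Longrightarrow> rows s' = rows s \<Longrightarrow>
      nmem s' ''f'' [] = of_bool (insert v (rows s i - {u}) \<in> Bs i) \<Longrightarrow>
      rmem s' ''y'' [] = fs i (insert v (rows s i - {u})) \<Longrightarrow> Q s'"
  shows "runs test_exchange s Q"
proof -
  have S: "insert v (rows s i - {u}) \<subseteq> {..<m}" using assms by auto
  have i: "i \<in> {1..n}" using assms by auto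
  have ne: "u \<noteq> v" using assms by auto
  have "0 \<le> \<Omega> i (insert v (rows s i - {u}))" using nonneg[OF i S] .
  then have "\<Omega> i (insert v (rows s i - {u})) \<noteq> -\<infinity>" by auto
  then show ?thesis
    unfolding test_exchange_def
    using assms ne bases_iff[OF i S]
    by (intro runs_straight) (auto intro!: post simp: valuation_def insert_absorb)
qed

lemma runs_improve_base:
  assumes s: "nmem s ''i'' [] < n" "nmem s ''u'' [] < m" "nmem s ''m'' [] = m"
    and i: "i = Suc (nmem s ''i'' [])" and u: "u = nmem s ''u'' []"
    and A: "A = rows s i" "A \<in> Bs i"
    and post: "\<And>s' A'. agree {''X'', ''f'', ''v'', ''w''} {''y'', ''best''} s s' \<Longrightarrow> rows s' = (rows s)(i := A') \<Longrightarrow>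
      (if u \<in> A then best_exchange (Bs i) (fs i) u A A' else A' = A) \<Longrightarrow> Q s'"
  shows "runs improve_base s Q"
proof (cases "u \<in> A")
  case False
  then have "Q s" using A by (intro post[of s A]) auto
  then show ?thesis unfolding improve_base_def using False A i u
    by (intro runs_Cond runs_Skip) (auto simp: rows_nmem)
next
  case True
  have iN: "i \<in> {1..n}" using i s by auto
  have Am: "A \<subseteq> {..<m}" using A by (auto simp: bases_def)
  have "0 \<le> \<Omega> i A" using nonneg[OF iN Am] .
  then have A_fin: "\<Omega> i A \<noteq> -\<infinity>" by auto
  \<comment> \<open>The bound by \<open>fs i A\<close> accounts for the candidate \<open>u\<close>,
    which the clause about \<open>x \<notin> A\<close> leaves out.\<close>
  define I where "I k s' \<longleftrightarrow> agree {''X'', ''f'', ''v'', ''w''} {''y'', ''best''} s s' \<and> nmem s' ''v'' [] = k \<and>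
    rows s' = rows s \<and> (\<exists>w. nmem s' ''w'' [] = w \<and> w \<notin> A - {u} \<and> insert w (A - {u}) \<in> Bs i \<and>
      rmem s' ''best'' [] = fs i (insert w (A - {u})) \<and> rmem s' ''best'' [] \<le> fs i A \<and>
      (\<forall>x<k. x \<notin> A \<longrightarrow> insert x (A - {u}) \<in> Bs i \<longrightarrow> rmem s' ''best'' [] \<le> fs i (insert x (A - {u}))))" for k s'
  have loop: "runs (For ''v'' (scalar ''m'') try_replacement) s1 (I m)" if "I 0 (nupdate ''v'' [] 0 s1)" for s1
  proof (rule runs_For[where I = I and N = m])
    show "I 0 (nupdate ''v'' [] 0 s1)" by (rule that)
    show "nval (scalar ''m'') s' = m \<and> nmem s' ''v'' [] = k" if "I k s'" for k s'
      using that s by (simp add: I_def agree_def)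
    fix k s' assume k: "k < m" and Ik: "I k s'"
    have vars: "nmem s' ''i'' [] = nmem s ''i'' []" "nmem s' ''u'' [] = u" "nmem s' ''v'' [] = k" "rows s' = rows s"
      using Ik u by (simp_all add: I_def agree_def)
    obtain w where w: "nmem s' ''w'' [] = w" "w \<notin> A - {u}" "insert w (A - {u}) \<in> Bs i"
      "rmem s' ''best'' [] = fs i (insert w (A - {u}))" "rmem s' ''best'' [] \<le> fs i A"
      "\<And>x. x<k \<Longrightarrow> x \<notin> A \<Longrightarrow> insert x (A - {u}) \<in> Bs i \<Longrightarrow> rmem s' ''best'' [] \<le> fs i (insert x (A - {u}))"
      using Ik unfolding I_def by blast
    show "runs try_replacement s' (\<lambda>s''. nmem s'' ''v'' [] = k \<and> I (Suc k) (nupdate ''v'' [] (Suc k) s''))"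
      unfolding try_replacement_def
    proof (rule runs_Cond)
      assume "bval (nonzero (NVar ''X'' [player, scalar ''v''])) s'"
      then have "k \<in> A" using vars A i by (simp add: rows_nmem)
      then show "runs Skip s' (\<lambda>s''. nmem s'' ''v'' [] = k \<and> I (Suc k) (nupdate ''v'' [] (Suc k) s''))"
        using Ik w by (intro runs_Skip) (auto simp: I_def less_Suc_eq)
    next
      assume "\<not> bval (nonzero (NVar ''X'' [player, scalar ''v''])) s'"
      then have kA: "k \<notin> A" using vars A i by (simp add: rows_nmem)
      show "runs (test_exchange ;;
              Cond (BAnd (nonzero (scalar ''f'')) (RLess (rscalar ''y'') (rscalar ''best'')))
                (RAssign ''best'' [] (rscalar ''y'') ;; NAssign ''w'' [] (scalar ''v''))
                Skip) s' (\<lambda>s''. nmem s'' ''v'' [] = k \<and> I (Suc k) (nupdate ''v'' [] (Suc k) s''))"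
      proof (intro runs_Seq, rule runs_test_exchange[where i = i and u = u and v = k])
        fix s'' assume s'': "agree {''X'', ''f''} {''y''} s' s''" "rows s'' = rows s'"
          "nmem s'' ''f'' [] = of_bool (insert k (rows s' i - {u}) \<in> Bs i)"
          "rmem s'' ''y'' [] = fs i (insert k (rows s' i - {u}))"
        have ag: "agree {''X'', ''f'', ''v'', ''w''} {''y'', ''best''} s s''"
          using Ik unfolding I_def by (elim conjE) (rule agree_trans[OF _ s''(1)], auto)
        have vars'': "nmem s'' ''v'' [] = k" "nmem s'' ''w'' [] = w" "rmem s'' ''best'' [] = rmem s' ''best'' []"
          using s''(1) vars w by (simp_all add: agree_def)
        show "runs (Cond (BAnd (nonzero (scalar ''f'')) (RLess (rscalar ''y'') (rscalar ''best'')))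
                (RAssign ''best'' [] (rscalar ''y'') ;; NAssign ''w'' [] (scalar ''v''))
                Skip) s'' (\<lambda>s''. nmem s'' ''v'' [] = k \<and> I (Suc k) (nupdate ''v'' [] (Suc k) s''))"
        proof (rule runs_Cond)
          assume "bval (BAnd (nonzero (scalar ''f'')) (RLess (rscalar ''y'') (rscalar ''best''))) s''"
          then have h: "insert k (A - {u}) \<in> Bs i" "fs i (insert k (A - {u})) < rmem s' ''best'' []"
            using s'' vars vars'' A by (auto split: if_splits)
          have "x < Suc k \<Longrightarrow> x \<notin> A \<Longrightarrow> insert x (A - {u}) \<in> Bs i \<Longrightarrow>
              fs i (insert k (A - {u})) \<le> fs i (insert x (A - {u}))" for x
            using w(6)[of x] h(2) by (cases "x = k") auto
          then show "runs (RAssign ''best'' [] (rscalar ''y'') ;; NAssign ''w'' [] (scalar ''v'')) s''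
            (\<lambda>s''. nmem s'' ''v'' [] = k \<and> I (Suc k) (nupdate ''v'' [] (Suc k) s''))"
            using h ag s'' vars vars'' A kA w(5) by (intro runs_straight) (simp add: I_def)
        next
          assume "\<not> bval (BAnd (nonzero (scalar ''f'')) (RLess (rscalar ''y'') (rscalar ''best''))) s''"
          then have h: "insert k (A - {u}) \<in> Bs i \<Longrightarrow> rmem s' ''best'' [] \<le> fs i (insert k (A - {u}))"
            using s'' vars vars'' A by (auto split: if_splits)
          have "x < Suc k \<Longrightarrow> x \<notin> A \<Longrightarrow> insert x (A - {u}) \<in> Bs i \<Longrightarrow>
              rmem s' ''best'' [] \<le> fs i (insert x (A - {u}))" for x
            using w(6)[of x] h by (cases "x = k") auto
          then show "runs Skip s'' (\<lambda>s''. nmem s'' ''v'' [] = k \<and> I (Suc k) (nupdate ''v'' [] (Suc k) s''))"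
            using w(1-5) ag s''(2) vars vars'' by (intro runs_straight) (simp add: I_def)
        qed
      qed (use s u i A Am vars k kA True in auto)
    qed
  qed simp_all
  show ?thesis
    unfolding improve_base_def
  proof (intro runs_Cond runs_Seq)
    have "I 0 (nupdate ''v'' [] 0 (nupdate ''w'' [] u (nupdate ''f'' [] (of_bool (\<Omega> i A \<noteq> \<infinity>))
            (rupdate ''best'' [] (fs i A) s))))"
      using A Am True by (simp add: I_def insert_absorb)
    note loop' = loop[OF this]
    have fin: "runs (NAssign ''X'' [player, scalar ''u''] (NConst 0) ;;
        NAssign ''X'' [player, scalar ''w''] (NConst 1)) s1 Q" if Is: "I m s1" for s1
    proof (intro runs_straight)
      obtain w where w: "nmem s1 ''w'' [] = w" "w \<notin> A - {u}" "insert w (A - {u}) \<in> Bs i"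
        "rmem s1 ''best'' [] = fs i (insert w (A - {u}))" "rmem s1 ''best'' [] \<le> fs i A"
        "\<And>x. x<m \<Longrightarrow> x \<notin> A \<Longrightarrow> insert x (A - {u}) \<in> Bs i \<Longrightarrow> rmem s1 ''best'' [] \<le> fs i (insert x (A - {u}))"
        and ag: "agree {''X'', ''f'', ''v'', ''w''} {''y'', ''best''} s s1" "rows s1 = rows s"
        using Is unfolding I_def by blast
      have vars: "nmem s1 ''i'' [] = nmem s ''i'' []" "nmem s1 ''u'' [] = u"
        using ag u by (simp_all add: agree_def)
      have "fs i (insert w (A - {u})) \<le> fs i (insert x (A - {u}))"
        if x: "x \<notin> A - {u}" "insert x (A - {u}) \<in> Bs i" for x
      proof (cases "x = u")
        case True
        then show ?thesis using w \<open>u \<in> A\<close> by (simp add: insert_absorb)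
      next
        case False
        have "x < m" using x(2) by (auto simp: bases_def)
        then show ?thesis using False x w by auto
      qed
      then have "best_exchange (Bs i) (fs i) u A (insert w (A - {u}))"
        using w unfolding best_exchange_def by blast
      then show "Q (nupdate ''X'' (map (\<lambda>e. nval e (nupdate ''X'' (map (\<lambda>e. nval e s1) [player, scalar ''u''])
          (nval (NConst 0) s1) s1)) [player, scalar ''w''])
          (nval (NConst 1) (nupdate ''X'' (map (\<lambda>e. nval e s1) [player, scalar ''u'']) (nval (NConst 0) s1) s1))
          (nupdate ''X'' (map (\<lambda>e. nval e s1) [player, scalar ''u'']) (nval (NConst 0) s1) s1))"
        using True ag vars w(1) i A by (intro post[where A' = "insert w (A - {u})"]) auto
    qed
    show "runs (CallOmega ''f'' ''best'' player ''X'' [player]) s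
     (\<lambda>s'. runs (NAssign ''w'' [] (scalar ''u'') ;; For ''v'' (scalar ''m'') try_replacement ;;
        NAssign ''X'' [player, scalar ''u''] (NConst 0) ;; NAssign ''X'' [player, scalar ''w''] (NConst 1)) s' Q)"
    proof (intro runs_CallOmega runs_Seq runs_NAssign, goal_cases)
      case 1
      then show ?case using A_fin A i by simp
    next
      case 2
      show ?case
        by (rule runs_mono[where Q = "I m"])
          (use loop' A i u in \<open>simp add: valuation_def\<close>, rule fin)
    qed
  qed (use True A i u in \<open>auto simp: rows_nmem\<close>)
qed

lemma runs_greedy:
  assumes s: "nmem s ''n'' [] = n" "nmem s ''m'' [] = m" "\<And>i. i \<in> {1..n} \<Longrightarrow> rows s i \<in> Bs i"
    and post: "\<And>s'. agree {''X'', ''f'', ''v'', ''w'', ''u'', ''i''} {''y'', ''best''} s s' \<Longrightarrow>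
      (\<And>i. i \<in> {1..n} \<Longrightarrow> minimizer (Bs i) (fs i) (rows s' i)) \<Longrightarrow> Q s'"
  shows "runs greedy s Q"
  unfolding greedy_def
proof (rule runs_For[where N = n and I = "\<lambda>k s'. agree {''X'', ''f'', ''v'', ''w'', ''u'', ''i''} {''y'', ''best''} s s' \<and>
     nmem s' ''i'' [] = k \<and> (\<forall>i\<in>{1..n}. rows s' i \<in> Bs i \<and> (i \<le> k \<longrightarrow> minimizer (Bs i) (fs i) (rows s' i)))"])
  fix k s1 assume k: "k < n" and s1: "agree {''X'', ''f'', ''v'', ''w'', ''u'', ''i''} {''y'', ''best''} s s1 \<and>
     nmem s1 ''i'' [] = k \<and> (\<forall>i\<in>{1..n}. rows s1 i \<in> Bs i \<and> (i \<le> k \<longrightarrow> minimizer (Bs i) (fs i) (rows s1 i)))"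
  have i: "Suc k \<in> {1..n}" using k by simp
  have fin: "finite (Bs (Suc k))" by (rule finite_subset[of _ "Pow {..<m}"]) (auto simp: bases_def)
  show "runs (For ''u'' (scalar ''m'') improve_base) s1
     (\<lambda>s'. nmem s' ''i'' [] = k \<and>
       agree {''X'', ''f'', ''v'', ''w'', ''u'', ''i''} {''y'', ''best''} s (nupdate ''i'' [] (Suc k) s') \<and>
       nmem (nupdate ''i'' [] (Suc k) s') ''i'' [] = Suc k \<and>
       (\<forall>i\<in>{1..n}. rows (nupdate ''i'' [] (Suc k) s') i \<in> Bs i \<and>
          (i \<le> Suc k \<longrightarrow> minimizer (Bs i) (fs i) (rows (nupdate ''i'' [] (Suc k) s') i))))"
  proof (rule runs_For[where N = m and I = "\<lambda>l s'. agree {''X'', ''f'', ''v'', ''w'', ''u''} {''y'', ''best''} s1 s' \<and>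
     nmem s' ''u'' [] = l \<and> (\<exists>A. rows s' = (rows s1)(Suc k := A) \<and> greedy_invariant (Bs (Suc k)) (fs (Suc k)) l A)"])
    show "agree {''X'', ''f'', ''v'', ''w'', ''u''} {''y'', ''best''} s1 (nupdate ''u'' [] 0 s1) \<and>
       nmem (nupdate ''u'' [] 0 s1) ''u'' [] = 0 \<and>
       (\<exists>A. rows (nupdate ''u'' [] 0 s1) = (rows s1)(Suc k := A) \<and> greedy_invariant (Bs (Suc k)) (fs (Suc k)) 0 A)"
      using greedy_invariant_init[OF fin, of "rows s1 (Suc k)"] s1 i by (auto intro!: exI[of _ "rows s1 (Suc k)"])
    fix l s2 assume s2: "agree {''X'', ''f'', ''v'', ''w'', ''u''} {''y'', ''best''} s1 s2 \<and>
       nmem s2 ''u'' [] = l \<and> (\<exists>A. rows s2 = (rows s1)(Suc k := A) \<and> greedy_invariant (Bs (Suc k)) (fs (Suc k)) l A)"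
    then have vars: "nmem s2 ''m'' [] = m" "nmem s2 ''i'' [] = k" using s1 s by (auto simp: agree_def)
    then show "nval (scalar ''m'') s2 = m \<and> nmem s2 ''u'' [] = l" using s2 by simp
    assume l: "l < m"
    obtain A where A: "rows s2 = (rows s1)(Suc k := A)" "greedy_invariant (Bs (Suc k)) (fs (Suc k)) l A"
      using s2 by blast
    show "runs improve_base s2
       (\<lambda>s'. nmem s' ''u'' [] = l \<and>
         agree {''X'', ''f'', ''v'', ''w'', ''u''} {''y'', ''best''} s1 (nupdate ''u'' [] (Suc l) s') \<and>
         nmem (nupdate ''u'' [] (Suc l) s') ''u'' [] = Suc l \<and>
         (\<exists>A. rows (nupdate ''u'' [] (Suc l) s') = (rows s1)(Suc k := A) \<and>
            greedy_invariant (Bs (Suc k)) (fs (Suc k)) (Suc l) A))"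
    proof (rule runs_improve_base[where i = "Suc k" and u = l and A = A])
      fix s3 A' assume s3: "agree {''X'', ''f'', ''v'', ''w''} {''y'', ''best''} s2 s3"
        "rows s3 = (rows s2)(Suc k := A')"
        "if l \<in> A then best_exchange (Bs (Suc k)) (fs (Suc k)) l A A' else A' = A"
      have "agree {''X'', ''f'', ''v'', ''w'', ''u''} {''y'', ''best''} s1 s3"
        by (rule agree_trans[OF conjunct1[OF s2] s3(1)]) auto
      moreover have "nmem s3 ''u'' [] = l" using s3(1) s2 by (simp add: agree_def)
      ultimately show "nmem s3 ''u'' [] = l \<and>
         agree {''X'', ''f'', ''v'', ''w'', ''u''} {''y'', ''best''} s1 (nupdate ''u'' [] (Suc l) s3) \<and>
         nmem (nupdate ''u'' [] (Suc l) s3) ''u'' [] = Suc l \<and>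
         (\<exists>A. rows (nupdate ''u'' [] (Suc l) s3) = (rows s1)(Suc k := A) \<and>
            greedy_invariant (Bs (Suc k)) (fs (Suc k)) (Suc l) A)"
        using greedy_invariant_step[OF vmat[OF i] A(2) s3(3)] s3(2) A(1) by auto
    qed (use vars k l s2 A in \<open>auto simp: greedy_invariant_def\<close>)
  next
    fix s2 assume s2: "agree {''X'', ''f'', ''v'', ''w'', ''u''} {''y'', ''best''} s1 s2 \<and>
       nmem s2 ''u'' [] = m \<and> (\<exists>A. rows s2 = (rows s1)(Suc k := A) \<and> greedy_invariant (Bs (Suc k)) (fs (Suc k)) m A)"
    then obtain A where A: "rows s2 = (rows s1)(Suc k := A)" "greedy_invariant (Bs (Suc k)) (fs (Suc k)) m A"
      by blast
    have "minimizer (Bs (Suc k)) (fs (Suc k)) A"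
      using vmat[OF i] A(2) by (rule greedy_invariant_final) (auto simp: bases_def)
    moreover have "agree {''X'', ''f'', ''v'', ''w'', ''u'', ''i''} {''y'', ''best''} s s2"
      by (rule agree_trans[OF conjunct1[OF s1] conjunct1[OF s2]]) auto
    moreover have "nmem s2 ''i'' [] = k" using s1 s2 by (simp add: agree_def)
    ultimately show "nmem s2 ''i'' [] = k \<and>
       agree {''X'', ''f'', ''v'', ''w'', ''u'', ''i''} {''y'', ''best''} s (nupdate ''i'' [] (Suc k) s2) \<and>
       nmem (nupdate ''i'' [] (Suc k) s2) ''i'' [] = Suc k \<and>
       (\<forall>i\<in>{1..n}. rows (nupdate ''i'' [] (Suc k) s2) i \<in> Bs i \<and>
          (i \<le> Suc k \<longrightarrow> minimizer (Bs i) (fs i) (rows (nupdate ''i'' [] (Suc k) s2) i)))"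
      using A s1 by (auto simp: le_Suc_eq minimizer_def)
  qed simp
qed (use s post in \<open>auto simp: agree_def\<close>)

end

section \<open>Computing the exchange graph\<close>

definition count_players :: com where
  "count_players =
     For ''v'' (scalar ''m'')
       (NAssign ''x'' [scalar ''v''] (NConst 0) ;;
        For ''i'' (scalar ''n'')
          (Cond (nonzero (NVar ''X'' [player, scalar ''v'']))
             (NAssign ''x'' [scalar ''v''] (NAdd (NVar ''x'' [scalar ''v'']) (NConst 1)))
             Skip))"

text \<open>\<open>bexp\<close> has no disjunction; the nested negations spell out \<open><\<close>
  between flagged values, in the form of \<open>flagged_less\<close>.\<close>

definition scan_arc :: com where
  "scan_arc =
     Cond (BAnd (nonzero (NVar ''X'' [player, scalar ''u''])) (BNot (nonzero (NVar ''X'' [player, scalar ''v'']))))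
       (CallOmega ''f'' ''base'' player ''X'' [player] ;;
        test_exchange ;;
        Cond (BAnd (nonzero (scalar ''f''))
               (BNot (BAnd (nonzero (NVar ''F'' [scalar ''u'', scalar ''v'']))
                 (BNot (RLess (RSub (rscalar ''y'') (rscalar ''base'')) (RVar ''L'' [scalar ''u'', scalar ''v'']))))))
          (NAssign ''F'' [scalar ''u'', scalar ''v''] (NConst 1) ;;
           RAssign ''L'' [scalar ''u'', scalar ''v''] (RSub (rscalar ''y'') (rscalar ''base'')) ;;
           NAssign ''P'' [scalar ''u'', scalar ''v''] player)
          Skip)
       Skip"

text \<open>Only the flag is reset: while it is zero, entries of \<open>L\<close> and
  \<open>P\<close> left from earlier phases have no influence.\<close>

definition compute_arcs :: com where
  "compute_arcs =
     For ''u'' (scalar ''m'')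
       (For ''v'' (scalar ''m'')
         (NAssign ''F'' [scalar ''u'', scalar ''v''] (NConst 0) ;; For ''i'' (scalar ''n'') scan_arc))"

text \<open>Memory cells hold real numbers only, so infinity is encoded by a zero flag.\<close>

definition flagged :: "nat \<Rightarrow> real \<Rightarrow> ereal" where
  "flagged b a = (if b = 0 then \<infinity> else ereal a)"

lemma flagged_less:
  "flagged b a < flagged b' a' \<longleftrightarrow> b \<noteq> 0 \<and> \<not> (b' \<noteq> 0 \<and> \<not> a < a')"
  by (simp add: flagged_def)

lemma flagged_add_less:
  "flagged b a + flagged b' a' < flagged b'' a'' \<longleftrightarrow> b \<noteq> 0 \<and> b' \<noteq> 0 \<and> \<not> (b'' \<noteq> 0 \<and> \<not> a + a' < a'')"
  by (simp add: flagged_def)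

abbreviation arc_flagged :: "store \<Rightarrow> nat \<Rightarrow> nat \<Rightarrow> ereal" where
  "arc_flagged s u v \<equiv> flagged (nmem s ''F'' [u, v]) (rmem s ''L'' [u, v])"

lemma congested_Suc:
  "congested {1..Suc l} Z v = congested {1..l} Z v + of_bool (v \<in> Z (Suc l))"
proof -
  have "{i \<in> {1..Suc l}. v \<in> Z i} = (if v \<in> Z (Suc l) then insert (Suc l) {i \<in> {1..l}. v \<in> Z i} else {i \<in> {1..l}. v \<in> Z i})"
    by (auto simp: le_Suc_eq)
  then show ?thesis by (simp add: congested_def)
qed

context game_oracles
begin

lemma runs_count_players:
  assumes s: "nmem s ''n'' [] = n" "nmem s ''m'' [] = m"
    and post: "\<And>s'. agree {''x'', ''v'', ''i''} {} s s' \<Longrightarrow>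
      (\<And>v. v < m \<Longrightarrow> nmem s' ''x'' [v] = congested {1..n} (rows s) v) \<Longrightarrow> Q s'"
  shows "runs count_players s Q"
  unfolding count_players_def
proof (rule runs_For[where N = m and I = "\<lambda>k s'. agree {''x'', ''v'', ''i''} {} s s' \<and> nmem s' ''v'' [] = k \<and>
     (\<forall>v<k. nmem s' ''x'' [v] = congested {1..n} (rows s) v)"])
  fix k s1 assume s1: "agree {''x'', ''v'', ''i''} {} s s1 \<and> nmem s1 ''v'' [] = k \<and>
     (\<forall>v<k. nmem s1 ''x'' [v] = congested {1..n} (rows s) v)"
  then show "nval (scalar ''m'') s1 = m \<and> nmem s1 ''v'' [] = k" using s by (auto simp: agree_def)
  define s2 where "s2 = nupdate ''x'' [k] 0 s1"
  have s2: "agree {''x'', ''v'', ''i''} {} s s2" "nmem s2 ''v'' [] = k" "nmem s2 ''x'' [k] = 0"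
     "\<forall>v<k. nmem s2 ''x'' [v] = congested {1..n} (rows s) v" using s1 by (auto simp: s2_def)
  assume k: "k < m"
  show "runs (NAssign ''x'' [scalar ''v''] (NConst 0) ;;
        For ''i'' (scalar ''n'')
          (Cond (nonzero (NVar ''X'' [player, scalar ''v'']))
             (NAssign ''x'' [scalar ''v''] (NAdd (NVar ''x'' [scalar ''v'']) (NConst 1)))
             Skip)) s1 (\<lambda>s'. nmem s' ''v'' [] = k \<and> agree {''x'', ''v'', ''i''} {} s (nupdate ''v'' [] (Suc k) s') \<and>
         nmem (nupdate ''v'' [] (Suc k) s') ''v'' [] = Suc k \<and>
         (\<forall>v<Suc k. nmem (nupdate ''v'' [] (Suc k) s') ''x'' [v] = congested {1..n} (rows s) v))"
  proof (intro runs_Seq runs_NAssign, rule runs_For[where N = n and I = "\<lambda>l s'. agree {''x'', ''v'', ''i''} {} s s' \<and>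
     nmem s' ''v'' [] = k \<and> nmem s' ''i'' [] = l \<and> nmem s' ''x'' [k] = congested {1..l} (rows s) k \<and>
     (\<forall>v<k. nmem s' ''x'' [v] = congested {1..n} (rows s) v)"])
    fix l s3 assume s3: "agree {''x'', ''v'', ''i''} {} s s3 \<and>
     nmem s3 ''v'' [] = k \<and> nmem s3 ''i'' [] = l \<and> nmem s3 ''x'' [k] = congested {1..l} (rows s) k \<and>
     (\<forall>v<k. nmem s3 ''x'' [v] = congested {1..n} (rows s) v)"
    then have vars: "nmem s3 ''n'' [] = n" "rows s3 = rows s" using s by (auto simp: agree_def rows_def fun_eq_iff)
    then show "nval (scalar ''n'') s3 = n \<and> nmem s3 ''i'' [] = l" using s3 by simp
    show "runs (Cond (nonzero (NVar ''X'' [player, scalar ''v'']))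
             (NAssign ''x'' [scalar ''v''] (NAdd (NVar ''x'' [scalar ''v'']) (NConst 1)))
             Skip) s3 (\<lambda>s'. nmem s' ''i'' [] = l \<and> agree {''x'', ''v'', ''i''} {} s (nupdate ''i'' [] (Suc l) s') \<and>
     nmem (nupdate ''i'' [] (Suc l) s') ''v'' [] = k \<and> nmem (nupdate ''i'' [] (Suc l) s') ''i'' [] = Suc l \<and>
     nmem (nupdate ''i'' [] (Suc l) s') ''x'' [k] = congested {1..Suc l} (rows s) k \<and>
     (\<forall>v<k. nmem (nupdate ''i'' [] (Suc l) s') ''x'' [v] = congested {1..n} (rows s) v))"
      using s3 vars congested_Suc[of l "rows s" k] by (intro runs_straight) (auto simp: rows_nmem)
  qed (use s1 s2 in \<open>auto simp: less_Suc_eq congested_def\<close>)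
qed (use s post in \<open>auto simp: agree_def\<close>)

definition arc_scanned :: "(nat \<Rightarrow> nat set) \<Rightarrow> nat \<Rightarrow> nat \<Rightarrow> nat \<Rightarrow> store \<Rightarrow> bool" where
  "arc_scanned Z l u v s \<longleftrightarrow>
     arc_flagged s u v = (INF i\<in>{1..l}. arc_length Bs fs Z i u v) \<and>
     (nmem s ''F'' [u, v] \<noteq> 0 \<longrightarrow> nmem s ''P'' [u, v] \<in> {1..l} \<and>
        arc_length Bs fs Z (nmem s ''P'' [u, v]) u v = arc_flagged s u v)"

lemma arc_scanned_cong:
  "nmem s' ''F'' [u, v] = nmem s ''F'' [u, v] \<Longrightarrow> nmem s' ''P'' [u, v] = nmem s ''P'' [u, v] \<Longrightarrow>
   rmem s' ''L'' [u, v] = rmem s ''L'' [u, v] \<Longrightarrow> arc_scanned Z l u v s' = arc_scanned Z l u v s"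
  by (simp add: arc_scanned_def)

lemma arc_scanned_Suc_keep:
  assumes "arc_scanned Z l u v s" "arc_flagged s u v \<le> arc_length Bs fs Z (Suc l) u v"
  shows "arc_scanned Z (Suc l) u v s"
  using assms
  by (auto simp: arc_scanned_def atLeastAtMostSuc_conv inf_min min_absorb2 simp del: One_nat_def)

lemma arc_scanned_Suc_new:
  assumes "arc_scanned Z l u v s" "arc_length Bs fs Z (Suc l) u v \<le> arc_flagged s u v"
    "arc_flagged s' u v = arc_length Bs fs Z (Suc l) u v" "nmem s' ''P'' [u, v] = Suc l"
  shows "arc_scanned Z (Suc l) u v s'"
  using assms
  by (auto simp: arc_scanned_def atLeastAtMostSuc_conv inf_min min_absorb1 simp del: One_nat_def)

lemma runs_scan_arc:
  assumes s: "nmem s ''i'' [] = l" "l < n" "nmem s ''u'' [] = u" "nmem s ''v'' [] = v" "v < m"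
    and A: "rows s (Suc l) \<in> Bs (Suc l)" "rows s = Z" and sc: "arc_scanned Z l u v s"
    and post: "\<And>s'. agree {''X'', ''f'', ''F'', ''P''} {''y'', ''base'', ''L''} s s' \<Longrightarrow> rows s' = rows s \<Longrightarrow>
      (\<And>js. js \<noteq> [u, v] \<Longrightarrow> nmem s' ''F'' js = nmem s ''F'' js \<and> nmem s' ''P'' js = nmem s ''P'' js \<and>
         rmem s' ''L'' js = rmem s ''L'' js) \<Longrightarrow> arc_scanned Z (Suc l) u v s' \<Longrightarrow> Q s'"
  shows "runs scan_arc s Q"
  unfolding scan_arc_def
proof (rule runs_Cond)
  assume "\<not> bval (BAnd (nonzero (NVar ''X'' [player, scalar ''u''])) (BNot (nonzero (NVar ''X'' [player, scalar ''v''])))) s"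
  then have "arc_length Bs fs Z (Suc l) u v = \<infinity>" using s A by (auto simp: rows_nmem arc_length_def)
  then have "arc_scanned Z (Suc l) u v s" using sc by (intro arc_scanned_Suc_keep) auto
  then show "runs Skip s Q" by (intro runs_Skip post) auto
next
  assume "bval (BAnd (nonzero (NVar ''X'' [player, scalar ''u''])) (BNot (nonzero (NVar ''X'' [player, scalar ''v''])))) s"
  then have uv: "u \<in> Z (Suc l)" "v \<notin> Z (Suc l)" using s A by (auto simp: rows_nmem)
  have l: "Suc l \<in> {1..n}" using s by simp
  have Am: "Z (Suc l) \<subseteq> {..<m}" using A by (auto simp: bases_def)
  have "0 \<le> \<Omega> (Suc l) (Z (Suc l))" using nonneg[OF l Am] .
  then have fin: "\<Omega> (Suc l) (Z (Suc l)) \<noteq> -\<infinity>" by auto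
  let ?s1 = "nupdate ''f'' [] (of_bool (\<Omega> (Suc l) (Z (Suc l)) \<noteq> \<infinity>)) (rupdate ''base'' [] (fs (Suc l) (Z (Suc l))) s)"
  let ?c = "Cond (BAnd (nonzero (scalar ''f''))
               (BNot (BAnd (nonzero (NVar ''F'' [scalar ''u'', scalar ''v'']))
                 (BNot (RLess (RSub (rscalar ''y'') (rscalar ''base'')) (RVar ''L'' [scalar ''u'', scalar ''v''])))))) 
          (NAssign ''F'' [scalar ''u'', scalar ''v''] (NConst 1) ;;
           RAssign ''L'' [scalar ''u'', scalar ''v''] (RSub (rscalar ''y'') (rscalar ''base'')) ;;
           NAssign ''P'' [scalar ''u'', scalar ''v''] player)
          Skip"
  have fin': "runs ?c s2 Q" if s2: "agree {''X'', ''f''} {''y''} ?s1 s2" "rows s2 = rows ?s1"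
      "nmem s2 ''f'' [] = of_bool (insert v (Z (Suc l) - {u}) \<in> Bs (Suc l))"
      "rmem s2 ''y'' [] = fs (Suc l) (insert v (Z (Suc l) - {u}))" for s2
  proof -
    have vars: "nmem s2 ''u'' [] = u" "nmem s2 ''v'' [] = v" "nmem s2 ''i'' [] = l"
      "rmem s2 ''base'' [] = fs (Suc l) (Z (Suc l))"
      "nmem s2 ''F'' = nmem s ''F''" "nmem s2 ''P'' = nmem s ''P''" "rmem s2 ''L'' = rmem s ''L''" "rows s2 = rows s"
      using s2 s by (simp_all add: agree_def)
    have "agree {''X'', ''f'', ''F'', ''P''} {''y'', ''base'', ''L''} s ?s1" by simp
    then have ag: "agree {''X'', ''f'', ''F'', ''P''} {''y'', ''base'', ''L''} s s2"
      by (rule agree_trans[OF _ s2(1)]) auto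
    have len: "arc_length Bs fs Z (Suc l) u v = flagged (nmem s2 ''f'' []) (rmem s2 ''y'' [] - rmem s2 ''base'' [])"
      using uv s2 vars by (simp add: arc_length_def flagged_def)
    show ?thesis
    proof (rule runs_Cond)
      assume "bval (BAnd (nonzero (scalar ''f''))
               (BNot (BAnd (nonzero (NVar ''F'' [scalar ''u'', scalar ''v'']))
                 (BNot (RLess (RSub (rscalar ''y'') (rscalar ''base'')) (RVar ''L'' [scalar ''u'', scalar ''v''])))))) s2"
      then have less: "arc_length Bs fs Z (Suc l) u v < arc_flagged s u v"
        and f: "nmem s2 ''f'' [] \<noteq> 0" using vars by (auto simp: len flagged_less)
      show "runs (NAssign ''F'' [scalar ''u'', scalar ''v''] (NConst 1) ;;
           RAssign ''L'' [scalar ''u'', scalar ''v''] (RSub (rscalar ''y'') (rscalar ''base'')) ;;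
           NAssign ''P'' [scalar ''u'', scalar ''v''] player) s2 Q"
        using ag vars less f by (intro runs_straight post arc_scanned_Suc_new[OF sc]) (auto simp: len flagged_def)
    next
      assume "\<not> bval (BAnd (nonzero (scalar ''f''))
               (BNot (BAnd (nonzero (NVar ''F'' [scalar ''u'', scalar ''v'']))
                 (BNot (RLess (RSub (rscalar ''y'') (rscalar ''base'')) (RVar ''L'' [scalar ''u'', scalar ''v''])))))) s2"
      then have "\<not> arc_length Bs fs Z (Suc l) u v < arc_flagged s u v"
        using vars unfolding len flagged_less by auto
      then have "arc_scanned Z (Suc l) u v s" using sc by (intro arc_scanned_Suc_keep) auto
      then have "arc_scanned Z (Suc l) u v s2" using vars by (simp add: arc_scanned_def)
      then show "runs Skip s2 Q" using ag vars by (intro runs_Skip post) auto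
    qed
  qed
  show "runs (CallOmega ''f'' ''base'' player ''X'' [player] ;; test_exchange ;; ?c) s Q"
  proof (intro runs_Seq runs_CallOmega, goal_cases)
    case 1
    then show ?case using fin s A by simp
  next
    case 2
    have "runs test_exchange ?s1 (\<lambda>s'. runs ?c s' Q)"
      by (rule runs_test_exchange[where i = "Suc l" and u = u and v = v]) (use s A uv Am fin' in auto)
    then show ?case using s A by (simp add: valuation_def)
  qed
qed

lemma runs_compute_arcs:
  assumes s: "nmem s ''n'' [] = n" "nmem s ''m'' [] = m" "\<And>i. i \<in> {1..n} \<Longrightarrow> Z i \<in> Bs i" "rows s = Z"
    and post: "\<And>s'. agree {''X'', ''f'', ''F'', ''P'', ''u'', ''v'', ''i''} {''y'', ''base'', ''L''} s s' \<Longrightarrow> rows s' = rows s \<Longrightarrow>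
      (\<And>u v. u < m \<Longrightarrow> v < m \<Longrightarrow> arc_scanned Z n u v s') \<Longrightarrow> Q s'"
  shows "runs compute_arcs s Q"
proof -
  \<comment> \<open>Row by row: \<open>I a b\<close> speaks of all pairs before
    \<open>(a, b)\<close>, so the end of row \<open>a\<close> passes to
    \<open>I (Suc a) 0\<close>.\<close>
  define I where "I a b s' \<longleftrightarrow> agree {''X'', ''f'', ''F'', ''P'', ''u'', ''v'', ''i''} {''y'', ''base'', ''L''} s s' \<and>
     nmem s' ''u'' [] = a \<and> rows s' = Z \<and>
     (\<forall>u v. u < a \<and> v < m \<or> u = a \<and> v < b \<longrightarrow> arc_scanned Z n u v s')" for a b s'
  have I_agree: "nmem s' ''n'' [] = n" "nmem s' ''m'' [] = m" "nmem s' ''u'' [] = a" "rows s' = Z" if "I a b s'" for a b s'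
    using that s by (auto simp: I_def agree_def)
  have I_upd: "I a b (nupdate x [] c s') = I a b s'" if "x = ''v'' \<or> x = ''i''" for x a b c s'
    using that by (auto simp: I_def arc_scanned_def)
  have inner: "runs (NAssign ''F'' [scalar ''u'', scalar ''v''] (NConst 0) ;; For ''i'' (scalar ''n'') scan_arc) s1
      (\<lambda>s'. nmem s' ''v'' [] = b \<and> I a (Suc b) (nupdate ''v'' [] (Suc b) s'))"
    if s1: "I a b s1" "nmem s1 ''v'' [] = b" "a < m" "b < m" for a b s1
  proof (intro runs_Seq runs_NAssign, rule runs_For[where N = n and
      I = "\<lambda>l s'. I a b s' \<and> nmem s' ''v'' [] = b \<and> nmem s' ''i'' [] = l \<and> arc_scanned Z l a b s'"])
    show "I a b (nupdate ''i'' [] 0 (nupdate ''F'' (map (\<lambda>e. nval e s1) [scalar ''u'', scalar ''v'']) (nval (NConst 0) s1) s1)) \<and>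
      nmem (nupdate ''i'' [] 0 (nupdate ''F'' (map (\<lambda>e. nval e s1) [scalar ''u'', scalar ''v'']) (nval (NConst 0) s1) s1)) ''v'' [] = b \<and>
      nmem (nupdate ''i'' [] 0 (nupdate ''F'' (map (\<lambda>e. nval e s1) [scalar ''u'', scalar ''v'']) (nval (NConst 0) s1) s1)) ''i'' [] = 0 \<and>
      arc_scanned Z 0 a b (nupdate ''i'' [] 0 (nupdate ''F'' (map (\<lambda>e. nval e s1) [scalar ''u'', scalar ''v'']) (nval (NConst 0) s1) s1))"
      using s1 by (auto simp: I_def arc_scanned_def flagged_def top_ereal_def)
  next
    fix l s2 assume l: "l < n" and s2: "I a b s2 \<and> nmem s2 ''v'' [] = b \<and> nmem s2 ''i'' [] = l \<and> arc_scanned Z l a b s2"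
    show "runs scan_arc s2 (\<lambda>s'. nmem s' ''i'' [] = l \<and> I a b (nupdate ''i'' [] (Suc l) s') \<and>
        nmem (nupdate ''i'' [] (Suc l) s') ''v'' [] = b \<and> nmem (nupdate ''i'' [] (Suc l) s') ''i'' [] = Suc l \<and>
        arc_scanned Z (Suc l) a b (nupdate ''i'' [] (Suc l) s'))"
    proof (rule runs_scan_arc[where l = l and u = a and v = b and Z = Z])
      fix s3 assume s3: "agree {''X'', ''f'', ''F'', ''P''} {''y'', ''base'', ''L''} s2 s3" "rows s3 = rows s2"
        "\<And>js. js \<noteq> [a, b] \<Longrightarrow> nmem s3 ''F'' js = nmem s2 ''F'' js \<and> nmem s3 ''P'' js = nmem s2 ''P'' js \<and>
         rmem s3 ''L'' js = rmem s2 ''L'' js" "arc_scanned Z (Suc l) a b s3"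
      have s2': "agree {''X'', ''f'', ''F'', ''P'', ''u'', ''v'', ''i''} {''y'', ''base'', ''L''} s s2"
        using s2 by (simp add: I_def)
      have ag: "agree {''X'', ''f'', ''F'', ''P'', ''u'', ''v'', ''i''} {''y'', ''base'', ''L''} s s3"
        by (rule agree_trans[OF s2' s3(1)]) auto
      have "arc_scanned Z n u v s3" if "u < a \<and> v < m \<or> u = a \<and> v < b" for u v
      proof -
        have "[u, v] \<noteq> [a, b]" using that by auto
        from s3(3)[OF this] have "arc_scanned Z n u v s3 = arc_scanned Z n u v s2"
          by (intro arc_scanned_cong) auto
        then show ?thesis using s2 that unfolding I_def by blast
      qed
      then have "I a b s3" using ag s2 s3(1,2) by (simp add: I_def agree_def)
      moreover have "nmem s3 ''i'' [] = l" "nmem s3 ''v'' [] = b" using s2 s3(1) by (simp_all add: agree_def)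
      ultimately show "nmem s3 ''i'' [] = l \<and> I a b (nupdate ''i'' [] (Suc l) s3) \<and>
        nmem (nupdate ''i'' [] (Suc l) s3) ''v'' [] = b \<and> nmem (nupdate ''i'' [] (Suc l) s3) ''i'' [] = Suc l \<and>
        arc_scanned Z (Suc l) a b (nupdate ''i'' [] (Suc l) s3)"
        using s3(4) I_upd[of "''i''"] by (simp add: arc_scanned_def)
    qed (use s2 l that s I_agree[of a b s2] in auto)
  next
    fix s2 assume s2: "I a b s2 \<and> nmem s2 ''v'' [] = b \<and> nmem s2 ''i'' [] = n \<and> arc_scanned Z n a b s2"
    then have "I a (Suc b) s2" by (auto simp: I_def less_Suc_eq)
    then show "nmem s2 ''v'' [] = b \<and> I a (Suc b) (nupdate ''v'' [] (Suc b) s2)"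
      using s2 I_upd[of "''v''"] by simp
  qed (use I_agree in auto)
  show ?thesis unfolding compute_arcs_def
  proof (rule runs_For[where N = m and I = "\<lambda>a. I a 0"])
    show "I 0 0 (nupdate ''u'' [] 0 s)" using s by (simp add: I_def)
    fix a s1 assume a: "a < m" and s1: "I a 0 s1"
    show "runs (For ''v'' (scalar ''m'')
         (NAssign ''F'' [scalar ''u'', scalar ''v''] (NConst 0) ;; For ''i'' (scalar ''n'') scan_arc)) s1
         (\<lambda>s'. nmem s' ''u'' [] = a \<and> I (Suc a) 0 (nupdate ''u'' [] (Suc a) s'))"
    proof (rule runs_For[where N = m and I = "\<lambda>b s'. I a b s' \<and> nmem s' ''v'' [] = b"])
      fix b s2 assume "b < m" "I a b s2 \<and> nmem s2 ''v'' [] = b"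
      then show "runs (NAssign ''F'' [scalar ''u'', scalar ''v''] (NConst 0) ;; For ''i'' (scalar ''n'') scan_arc) s2
        (\<lambda>s'. nmem s' ''v'' [] = b \<and> I a (Suc b) (nupdate ''v'' [] (Suc b) s') \<and>
          nmem (nupdate ''v'' [] (Suc b) s') ''v'' [] = Suc b)"
        using inner[of a b s2] a by (auto elim: runs_mono)
    next
      fix s2 assume "I a m s2 \<and> nmem s2 ''v'' [] = m"
      then show "nmem s2 ''u'' [] = a \<and> I (Suc a) 0 (nupdate ''u'' [] (Suc a) s2)"
        by (auto simp: I_def less_Suc_eq arc_scanned_def)
    qed (use s1 I_upd I_agree in auto)
  next
    fix s1 assume "I m 0 s1"
    then show "Q s1" using s by (intro post) (auto simp: I_def)
  qed (use I_agree in auto)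
qed

end

section \<open>Shortest walks and slot raising\<close>

definition relax_arc :: com where
  "relax_arc =
     Cond (BAnd (nonzero (NVar ''R'' [scalar ''k'', scalar ''u'']))
            (BAnd (nonzero (NVar ''F'' [scalar ''u'', scalar ''v'']))
              (BNot (BAnd (nonzero (NVar ''R'' [NAdd (scalar ''k'') (NConst 1), scalar ''v'']))
                (BNot (RLess (RAdd (RVar ''D'' [scalar ''k'', scalar ''u'']) (RVar ''L'' [scalar ''u'', scalar ''v'']))
                   (RVar ''D'' [NAdd (scalar ''k'') (NConst 1), scalar ''v''])))))))
       (NAssign ''R'' [NAdd (scalar ''k'') (NConst 1), scalar ''v''] (NConst 1) ;;
        RAssign ''D'' [NAdd (scalar ''k'') (NConst 1), scalar ''v'']
          (RAdd (RVar ''D'' [scalar ''k'', scalar ''u'']) (RVar ''L'' [scalar ''u'', scalar ''v''])) ;;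
        NAssign ''Q'' [NAdd (scalar ''k'') (NConst 1), scalar ''v''] (scalar ''u''))
       Skip"

text \<open>All layers are stored instead of updating one vector in place, since
  \<open>augment\<close> needs the parent in every layer. Copying with parent \<open>v\<close> and
  overwriting only on strict improvement yields walks with fewest arcs.\<close>

definition relax_vertex :: com where
  "relax_vertex =
     NAssign ''R'' [NAdd (scalar ''k'') (NConst 1), scalar ''v''] (NVar ''R'' [scalar ''k'', scalar ''v'']) ;;
     RAssign ''D'' [NAdd (scalar ''k'') (NConst 1), scalar ''v''] (RVar ''D'' [scalar ''k'', scalar ''v'']) ;;
     NAssign ''Q'' [NAdd (scalar ''k'') (NConst 1), scalar ''v''] (scalar ''v'') ;;
     For ''u'' (scalar ''m'') relax_arc"

definition bellman_ford :: com where
  "bellman_ford =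
     For ''v'' (scalar ''m'') (NAssign ''R'' [NConst 0, scalar ''v''] (NConst 0)) ;;
     NAssign ''R'' [NConst 0, scalar ''r''] (NConst 1) ;;
     RAssign ''D'' [NConst 0, scalar ''r''] (ROfNat (NConst 0)) ;;
     For ''k'' (scalar ''m'') (For ''v'' (scalar ''m'') relax_vertex)"

abbreviation walk_flagged :: "store \<Rightarrow> nat \<Rightarrow> nat \<Rightarrow> ereal" where
  "walk_flagged s k v \<equiv> flagged (nmem s ''R'' [k, v]) (rmem s ''D'' [k, v])"

text \<open>Slots of resources beyond \<open>r\<close> are still free, so the oracle is consulted
  only for \<open>v < r\<close>.\<close>

definition try_target :: com where
  "try_target =
     Cond (BAnd (neq (scalar ''v'') (scalar ''r''))
            (BAnd (nonzero (NVar ''R'' [scalar ''m'', scalar ''v'']))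
              (NLess (NVar ''x'' [scalar ''v'']) (scalar ''n''))))
       (RAssign ''cand'' [] (RVar ''D'' [scalar ''m'', scalar ''v'']) ;;
        Cond (NLess (scalar ''v'') (scalar ''r''))
          (CallD ''y1'' (scalar ''v'') (NAdd (NVar ''x'' [scalar ''v'']) (NConst 1)) ;;
           CallD ''y2'' (scalar ''v'') (NVar ''x'' [scalar ''v'']) ;;
           RAssign ''cand'' []
             (RAdd (rscalar ''cand'')
               (RSub (RMul (ROfNat (NAdd (NVar ''x'' [scalar ''v'']) (NConst 1))) (rscalar ''y1''))
                     (RMul (ROfNat (NVar ''x'' [scalar ''v''])) (rscalar ''y2'')))))
          Skip ;;
        Cond (RLess (rscalar ''cand'') (rscalar ''best''))
          (RAssign ''best'' [] (rscalar ''cand'') ;; NAssign ''t'' [] (scalar ''v''))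
          Skip)
       Skip"

text \<open>\<open>t = r\<close> stands for keeping the state, with the marginal cost of slot
  \<open>j\<close> as the value to beat; it wins ties because comparisons are strict.\<close>

definition select_target :: com where
  "select_target =
     CallD ''y1'' (scalar ''r'') (scalar ''j'') ;;
     CallD ''y2'' (scalar ''r'') (NSub (scalar ''j'') (NConst 1)) ;;
     RAssign ''best'' []
       (RSub (RMul (ROfNat (scalar ''j'')) (rscalar ''y1''))
             (RMul (ROfNat (NSub (scalar ''j'') (NConst 1))) (rscalar ''y2''))) ;;
     NAssign ''t'' [] (scalar ''r'') ;;
     For ''v'' (scalar ''m'') try_target"

text \<open>Round \<open>l\<close> treats layer \<open>m - l\<close>, so the exchanges are made from
  the end of the walk back to \<open>r\<close>.\<close>

definition trace_step :: com where
  "trace_step =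
     NAssign ''q'' [] (NVar ''Q'' [NSub (scalar ''m'') (scalar ''l''), scalar ''t'']) ;;
     Cond (neq (scalar ''q'') (scalar ''t''))
       (NAssign ''X'' [NVar ''P'' [scalar ''q'', scalar ''t''], scalar ''q''] (NConst 0) ;;
        NAssign ''X'' [NVar ''P'' [scalar ''q'', scalar ''t''], scalar ''t''] (NConst 1) ;;
        NAssign ''t'' [] (scalar ''q''))
       Skip"

definition raise_slot :: com where
  "raise_slot =
     count_players ;;
     Cond (neq (NVar ''x'' [scalar ''r'']) (scalar ''j''))
       Skip
       (compute_arcs ;; bellman_ford ;; select_target ;;
        Cond (neq (scalar ''t'') (scalar ''r'')) (For ''l'' (scalar ''m'') trace_step) Skip)"

definition optimize :: com where
  "optimize =
     greedy ;;
     For ''r'' (scalar ''m'')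
       (For ''z'' (scalar ''n'')
         (NAssign ''j'' [] (NSub (scalar ''n'') (scalar ''z'')) ;; raise_slot))"

text \<open>The marginal costs while the slots \<open>(v, k)\<close> are being priced in the order of increasing \<open>v\<close> and
  decreasing \<open>k\<close>: those of \<open>r\<close> down to \<open>j + 1\<close> have been treated.\<close>

definition slot_cost :: "(nat \<Rightarrow> nat \<Rightarrow> real) \<Rightarrow> nat \<Rightarrow> nat \<Rightarrow> nat \<Rightarrow> nat \<Rightarrow> real" where
  "slot_cost \<Delta> r j v k = (if v < r \<or> v = r \<and> j < k then marginal \<Delta> v k else 0)"

text \<open>\<open>l\<close> counts the tails scanned so far. The strict inequality in the second
  disjunct is what \<open>parent\<close> in the locale \<open>augmentation\<close> asks for.\<close>

definition relaxed :: "nat \<Rightarrow> nat \<Rightarrow> nat \<Rightarrow> nat \<Rightarrow> store \<Rightarrow> bool" where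
  "relaxed m l k v s \<longleftrightarrow>
     walk_flagged s (Suc k) v = min (walk_flagged s k v) (INF u\<in>{..<l}. walk_flagged s k u + arc_flagged s u v) \<and>
     (nmem s ''Q'' [Suc k, v] = v \<and> walk_flagged s (Suc k) v = walk_flagged s k v \<or>
      nmem s ''Q'' [Suc k, v] < m \<and>
      walk_flagged s (Suc k) v = walk_flagged s k (nmem s ''Q'' [Suc k, v]) + arc_flagged s (nmem s ''Q'' [Suc k, v]) v \<and>
      walk_flagged s (Suc k) v < walk_flagged s k v)"

lemma relaxed_cong:
  assumes "nmem s' ''F'' = nmem s ''F''" "rmem s' ''L'' = rmem s ''L''"
    and "\<And>u. nmem s' ''R'' [k, u] = nmem s ''R'' [k, u] \<and> rmem s' ''D'' [k, u] = rmem s ''D'' [k, u]"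
    and "nmem s' ''R'' [Suc k, v] = nmem s ''R'' [Suc k, v]" "rmem s' ''D'' [Suc k, v] = rmem s ''D'' [Suc k, v]"
      "nmem s' ''Q'' [Suc k, v] = nmem s ''Q'' [Suc k, v]"
  shows "relaxed m l k v s' = relaxed m l k v s"
  using assms by (simp add: relaxed_def)

lemma relaxed_nupdate [simp]:
  "x \<notin> {''F'', ''R'', ''Q''} \<Longrightarrow> relaxed m l k v (nupdate x js a s) = relaxed m l k v s"
  by (rule relaxed_cong) auto

lemma relaxed_Suc:
  "relaxed m l k v s \<Longrightarrow> walk_flagged s (Suc k) v \<le> walk_flagged s k l + arc_flagged s l v \<Longrightarrow> relaxed m (Suc l) k v s"
proof -
  assume rel: "relaxed m l k v s" and le: "walk_flagged s (Suc k) v \<le> walk_flagged s k l + arc_flagged s l v"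
  have "walk_flagged s (Suc k) v = min (walk_flagged s k v) (INF u\<in>{..<l}. walk_flagged s k u + arc_flagged s u v)"
    using rel by (simp add: relaxed_def)
  then have "walk_flagged s (Suc k) v = min (walk_flagged s k v) (INF u\<in>{..<Suc l}. walk_flagged s k u + arc_flagged s u v)"
    using le by (auto simp: lessThan_Suc inf_min min_def split: if_splits)
  then show ?thesis using rel unfolding relaxed_def by blast
qed

lemma relaxed_improve:
  assumes "relaxed m l k v s" "l < m" "walk_flagged s k l + arc_flagged s l v < walk_flagged s (Suc k) v"
    and "nmem s' ''F'' = nmem s ''F''" "rmem s' ''L'' = rmem s ''L''"
    and "\<And>u. nmem s' ''R'' [k, u] = nmem s ''R'' [k, u] \<and> rmem s' ''D'' [k, u] = rmem s ''D'' [k, u]"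
    and "walk_flagged s' (Suc k) v = walk_flagged s k l + arc_flagged s l v" "nmem s' ''Q'' [Suc k, v] = l"
  shows "relaxed m (Suc l) k v s'"
proof -
  have 1: "walk_flagged s (Suc k) v = min (walk_flagged s k v) (INF u\<in>{..<l}. walk_flagged s k u + arc_flagged s u v)"
    using assms(1) by (simp add: relaxed_def)
  have "walk_flagged s (Suc k) v \<le> walk_flagged s k v" using 1 by simp
  then have 2: "walk_flagged s' (Suc k) v < walk_flagged s k v" using assms(3,7) by simp
  have "walk_flagged s' (Suc k) v = min (walk_flagged s k v) (INF u\<in>{..<Suc l}. walk_flagged s k u + arc_flagged s u v)"
    using assms(3,7) 1 by (auto simp: lessThan_Suc inf_min min_def split: if_splits)
  then show ?thesis using assms(2,4-8) 2 by (simp add: relaxed_def)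
qed

context game_oracles
begin

lemma runs_relax_arc:
  assumes s: "nmem s ''u'' [] = l" "l < m" "nmem s ''v'' [] = v" "nmem s ''k'' [] = k" and rel: "relaxed m l k v s"
    and post: "\<And>s'. agree {''R'', ''Q''} {''D''} s s' \<Longrightarrow>
      (\<And>js. js \<noteq> [Suc k, v] \<Longrightarrow> nmem s' ''R'' js = nmem s ''R'' js \<and> nmem s' ''Q'' js = nmem s ''Q'' js \<and>
         rmem s' ''D'' js = rmem s ''D'' js) \<Longrightarrow> relaxed m (Suc l) k v s' \<Longrightarrow> Q s'"
  shows "runs relax_arc s Q"
  unfolding relax_arc_def
proof (rule runs_Cond)
  assume "bval (BAnd (nonzero (NVar ''R'' [scalar ''k'', scalar ''u'']))
            (BAnd (nonzero (NVar ''F'' [scalar ''u'', scalar ''v'']))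
              (BNot (BAnd (nonzero (NVar ''R'' [NAdd (scalar ''k'') (NConst 1), scalar ''v'']))
                (BNot (RLess (RAdd (RVar ''D'' [scalar ''k'', scalar ''u'']) (RVar ''L'' [scalar ''u'', scalar ''v'']))
                   (RVar ''D'' [NAdd (scalar ''k'') (NConst 1), scalar ''v'']))))))) s"
  then have less: "walk_flagged s k l + arc_flagged s l v < walk_flagged s (Suc k) v"
    using s by (simp add: flagged_add_less)
  then have "walk_flagged s k l + arc_flagged s l v = ereal (rmem s ''D'' [k, l] + rmem s ''L'' [l, v])"
    by (auto simp: flagged_def split: if_splits)
  then show "runs (NAssign ''R'' [NAdd (scalar ''k'') (NConst 1), scalar ''v''] (NConst 1) ;;
        RAssign ''D'' [NAdd (scalar ''k'') (NConst 1), scalar ''v'']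
          (RAdd (RVar ''D'' [scalar ''k'', scalar ''u'']) (RVar ''L'' [scalar ''u'', scalar ''v''])) ;;
        NAssign ''Q'' [NAdd (scalar ''k'') (NConst 1), scalar ''v''] (scalar ''u'')) s Q"
    using s by (intro runs_straight post relaxed_improve[OF rel s(2) less]) (auto simp: flagged_def)
next
  assume "\<not> bval (BAnd (nonzero (NVar ''R'' [scalar ''k'', scalar ''u'']))
            (BAnd (nonzero (NVar ''F'' [scalar ''u'', scalar ''v'']))
              (BNot (BAnd (nonzero (NVar ''R'' [NAdd (scalar ''k'') (NConst 1), scalar ''v'']))
                (BNot (RLess (RAdd (RVar ''D'' [scalar ''k'', scalar ''u'']) (RVar ''L'' [scalar ''u'', scalar ''v'']))
                   (RVar ''D'' [NAdd (scalar ''k'') (NConst 1), scalar ''v'']))))))) s"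
  then have "\<not> walk_flagged s k l + arc_flagged s l v < walk_flagged s (Suc k) v"
    using s by (simp add: flagged_add_less)
  then have "relaxed m (Suc l) k v s" by (intro relaxed_Suc rel) simp
  then show "runs Skip s Q" by (intro runs_Skip post) auto
qed

lemma runs_relax_vertex:
  assumes s: "nmem s ''m'' [] = m" "nmem s ''v'' [] = v" "nmem s ''k'' [] = k"
    and post: "\<And>s'. agree {''R'', ''Q'', ''u''} {''D''} s s' \<Longrightarrow>
      (\<And>js. js \<noteq> [Suc k, v] \<Longrightarrow> nmem s' ''R'' js = nmem s ''R'' js \<and> nmem s' ''Q'' js = nmem s ''Q'' js \<and>
         rmem s' ''D'' js = rmem s ''D'' js) \<Longrightarrow> relaxed m m k v s' \<Longrightarrow> Q s'"
  shows "runs relax_vertex s Q"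
  unfolding relax_vertex_def
proof (intro runs_Seq runs_NAssign runs_RAssign, rule runs_For[where N = m and
    I = "\<lambda>l s'. agree {''R'', ''Q'', ''u''} {''D''} s s' \<and> nmem s' ''u'' [] = l \<and>
      (\<forall>js. js \<noteq> [Suc k, v] \<longrightarrow> nmem s' ''R'' js = nmem s ''R'' js \<and> nmem s' ''Q'' js = nmem s ''Q'' js \<and>
         rmem s' ''D'' js = rmem s ''D'' js) \<and> relaxed m l k v s'"], goal_cases)
  case 2
  then show ?case using s by (auto simp: relaxed_def flagged_def top_ereal_def)
next
  case (3 l s1)
  then show ?case using s by (auto simp: agree_def)
next
  case (4 l s1)
  have ag: "agree {''R'', ''Q'', ''u''} {''D''} s s1" using 4 by blast
  show ?case
  proof (rule runs_relax_arc[where l = l and v = v and k = k])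
    fix s2 assume s2: "agree {''R'', ''Q''} {''D''} s1 s2"
      "\<And>js. js \<noteq> [Suc k, v] \<Longrightarrow> nmem s2 ''R'' js = nmem s1 ''R'' js \<and> nmem s2 ''Q'' js = nmem s1 ''Q'' js \<and>
         rmem s2 ''D'' js = rmem s1 ''D'' js" "relaxed m (Suc l) k v s2"
    have "agree {''R'', ''Q'', ''u''} {''D''} s s2" by (rule agree_trans[OF ag s2(1)]) auto
    moreover have "nmem s2 ''u'' [] = l" using 4 s2(1) by (simp add: agree_def)
    ultimately show "nmem s2 ''u'' [] = l \<and>
       agree {''R'', ''Q'', ''u''} {''D''} s (nupdate ''u'' [] (Suc l) s2) \<and> nmem (nupdate ''u'' [] (Suc l) s2) ''u'' [] = Suc l \<and>
      (\<forall>js. js \<noteq> [Suc k, v] \<longrightarrow> nmem (nupdate ''u'' [] (Suc l) s2) ''R'' js = nmem s ''R'' js \<and>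
         nmem (nupdate ''u'' [] (Suc l) s2) ''Q'' js = nmem s ''Q'' js \<and>
         rmem (nupdate ''u'' [] (Suc l) s2) ''D'' js = rmem s ''D'' js) \<and>
      relaxed m (Suc l) k v (nupdate ''u'' [] (Suc l) s2)"
      using 4 s2 by simp
  qed (use 4 s ag in \<open>auto simp: agree_def\<close>)
next
  case (5 s1)
  then show ?case by (intro post) auto
qed auto

lemma runs_bellman_ford:
  assumes s: "nmem s ''m'' [] = m" "nmem s ''r'' [] = r" "r < m"
    and post: "\<And>s'. agree {''R'', ''Q'', ''u'', ''v'', ''k''} {''D''} s s' \<Longrightarrow>
      (\<And>k v. k \<le> m \<Longrightarrow> v < m \<Longrightarrow> walk_flagged s' k v = walk_dist {..<m} (arc_flagged s) r k v) \<Longrightarrow>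
      (\<And>k v. k < m \<Longrightarrow> v < m \<Longrightarrow> relaxed m m k v s') \<Longrightarrow> Q s'"
  shows "runs bellman_ford s Q"
proof -
  define I where "I a b s' \<longleftrightarrow> agree {''R'', ''Q'', ''u'', ''v'', ''k''} {''D''} s s' \<and>
     nmem s' ''k'' [] = a \<and>
     (\<forall>v<m. walk_flagged s' 0 v = (if v = r then 0 else \<infinity>)) \<and>
     (\<forall>k v. k < a \<and> v < m \<or> k = a \<and> v < b \<longrightarrow> relaxed m m k v s')" for a b s'
  have I_vars: "nmem s' ''m'' [] = m" "nmem s' ''k'' [] = a" if "I a b s'" for a b s'
    using that s by (auto simp: I_def agree_def)
  have I_v: "I a b (nupdate ''v'' [] c s') = I a b s'" for a b c s'
    by (simp add: I_def)
  have inner: "runs relax_vertex s1 (\<lambda>s'. nmem s' ''v'' [] = b \<and> I a (Suc b) (nupdate ''v'' [] (Suc b) s'))"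
    if s1: "I a b s1" "nmem s1 ''v'' [] = b" "a < m" "b < m" for a b s1
  proof (rule runs_relax_vertex[where v = b and k = a])
    fix s2 assume s2: "agree {''R'', ''Q'', ''u''} {''D''} s1 s2"
      "\<And>js. js \<noteq> [Suc a, b] \<Longrightarrow> nmem s2 ''R'' js = nmem s1 ''R'' js \<and> nmem s2 ''Q'' js = nmem s1 ''Q'' js \<and>
         rmem s2 ''D'' js = rmem s1 ''D'' js" "relaxed m m a b s2"
    have s1': "agree {''R'', ''Q'', ''u'', ''v'', ''k''} {''D''} s s1" using s1 by (simp add: I_def)
    have ag: "agree {''R'', ''Q'', ''u'', ''v'', ''k''} {''D''} s s2" by (rule agree_trans[OF s1' s2(1)]) auto
    have "relaxed m m k v s2" if kv: "k < a \<and> v < m \<or> k = a \<and> v < Suc b" for k v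
    proof (cases "k = a \<and> v = b")
      case True
      then show ?thesis using s2(3) by simp
    next
      case False
      then have kv': "k < a \<and> v < m \<or> k = a \<and> v < b" using kv by auto
      \<comment> \<open>Only the cell \<open>[Suc a, b]\<close> has changed. Earlier relaxations
        read layers up to \<open>a\<close> and wrote other cells, so they stay valid.\<close>
      have ne: "[Suc k, v] \<noteq> [Suc a, b]" "[k, u] \<noteq> [Suc a, b]" for u using False kv' by auto
      have FL: "nmem s2 ''F'' = nmem s1 ''F''" "rmem s2 ''L'' = rmem s1 ''L''" using s2(1) by (simp_all add: agree_def)
      have "relaxed m m k v s2 = relaxed m m k v s1"
        using s2(2)[OF ne(1)] s2(2)[OF ne(2)] FL by (intro relaxed_cong) simp_all
      then show ?thesis using s1(1) kv' unfolding I_def by blast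
    qed
    moreover have "\<forall>v<m. walk_flagged s2 0 v = (if v = r then 0 else \<infinity>)"
      using s1(1) s2(2)[of "[0, _]"] by (simp add: I_def)
    moreover have "nmem s2 ''k'' [] = a" "nmem s2 ''v'' [] = b" using s1 s2(1) I_vars[of a b s1] by (simp_all add: agree_def)
    ultimately show "nmem s2 ''v'' [] = b \<and> I a (Suc b) (nupdate ''v'' [] (Suc b) s2)"
      using ag by (simp add: I_def)
  qed (use s1 I_vars in auto)
  have loop: "runs (For ''k'' (scalar ''m'') (For ''v'' (scalar ''m'') relax_vertex)) s1 (I m 0)"
    if s1: "I 0 0 (nupdate ''k'' [] 0 s1)" for s1
  proof (rule runs_For[where N = m and I = "\<lambda>a. I a 0"])
    fix a s1 assume a: "a < m" and s1: "I a 0 s1"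
    show "runs (For ''v'' (scalar ''m'') relax_vertex) s1
         (\<lambda>s'. nmem s' ''k'' [] = a \<and> I (Suc a) 0 (nupdate ''k'' [] (Suc a) s'))"
    proof (rule runs_For[where N = m and I = "\<lambda>b s'. I a b s' \<and> nmem s' ''v'' [] = b"])
      fix b s2 assume "b < m" "I a b s2 \<and> nmem s2 ''v'' [] = b"
      then show "runs relax_vertex s2 (\<lambda>s'. nmem s' ''v'' [] = b \<and> I a (Suc b) (nupdate ''v'' [] (Suc b) s') \<and>
          nmem (nupdate ''v'' [] (Suc b) s') ''v'' [] = Suc b)"
        using inner[of a b s2] a by (auto elim: runs_mono)
    next
      fix s2 assume "I a m s2 \<and> nmem s2 ''v'' [] = m"
      then show "nmem s2 ''k'' [] = a \<and> I (Suc a) 0 (nupdate ''k'' [] (Suc a) s2)"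
        by (auto simp: I_def less_Suc_eq)
    qed (use s1 I_vars I_v in auto)
  qed (use s1 I_vars in auto)
  have fin: "Q s1" if s1: "I m 0 s1" for s1
  proof (rule post)
    have FL: "nmem s1 ''F'' = nmem s ''F''" "rmem s1 ''L'' = rmem s ''L''" using s1 by (simp_all add: I_def agree_def)
    have rel: "relaxed m m k v s1" if "k < m" "v < m" for k v using s1 that by (simp add: I_def)
    then show "relaxed m m k v s1" if "k < m" "v < m" for k v using that .
    show "walk_flagged s1 k v = walk_dist {..<m} (arc_flagged s) r k v" if "k \<le> m" "v < m" for k v
      using that
    proof (induction k arbitrary: v)
      case 0
      then show ?case using s1 by (simp add: I_def)
    next
      case (Suc k)
      then have "walk_flagged s1 (Suc k) v = min (walk_flagged s1 k v) (INF u\<in>{..<m}. walk_flagged s1 k u + arc_flagged s1 u v)"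
        using rel[of k v] by (simp add: relaxed_def)
      also have "\<dots> = walk_dist {..<m} (arc_flagged s) r (Suc k) v"
        using Suc FL by (simp add: walk_dist.simps(2))
      finally show ?case .
    qed
  qed (use s1 in \<open>simp add: I_def\<close>)
  show ?thesis unfolding bellman_ford_def
  proof (rule runs_Seq, rule runs_For[where N = m and I = "\<lambda>b s'. agree {''R'', ''v''} {} s s' \<and> nmem s' ''v'' [] = b \<and>
      (\<forall>v<b. nmem s' ''R'' [0, v] = 0)"], goal_cases)
    case (4 b s1)
    then show ?case by (intro runs_straight) (auto simp: less_Suc_eq)
  next
    case (5 s1)
    then have s1: "agree {''R'', ''Q'', ''u'', ''v'', ''k''} {''D''} s s1" by (auto simp: agree_def)
    have r': "nmem s1 ''r'' [] = r" using s1 s by (simp add: agree_def)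
    show ?case
    proof (intro runs_Seq runs_NAssign runs_RAssign, rule runs_mono[OF loop fin])
      qed (use 5 s1 r' in \<open>auto simp: I_def flagged_def\<close>)
  qed (use s in \<open>auto simp: agree_def\<close>)
qed

end

section \<open>Choosing the end of the walk and pricing the slots\<close>

definition target_cost :: "(nat \<Rightarrow> nat \<Rightarrow> real) \<Rightarrow> nat \<Rightarrow> nat \<Rightarrow> nat \<Rightarrow> store \<Rightarrow> nat \<Rightarrow> ereal" where
  "target_cost \<Delta> m r j s v = walk_flagged s m v + ereal (slot_cost \<Delta> r j v (Suc (nmem s ''x'' [v])))"

definition target :: "nat \<Rightarrow> nat \<Rightarrow> nat \<Rightarrow> store \<Rightarrow> nat \<Rightarrow> bool" where
  "target n m r s v \<longleftrightarrow> v < m \<and> v \<noteq> r \<and> nmem s ''R'' [m, v] \<noteq> 0 \<and> nmem s ''x'' [v] < n"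

context game_oracles
begin

lemma runs_try_target:
  assumes s: "nmem s ''n'' [] = n" "nmem s ''m'' [] = m" "nmem s ''r'' [] = r" "nmem s ''v'' [] = v" "v < m"
    and post: "\<And>s'. agree {''t''} {''best'', ''y1'', ''y2'', ''cand''} s s' \<Longrightarrow>
       target n m r s v \<and> target_cost \<Delta> m r j s v < ereal (rmem s ''best'' []) \<and>
         ereal (rmem s' ''best'' []) = target_cost \<Delta> m r j s v \<and> nmem s' ''t'' [] = v \<or>
       (target n m r s v \<longrightarrow> ereal (rmem s ''best'' []) \<le> target_cost \<Delta> m r j s v) \<and>
         rmem s' ''best'' [] = rmem s ''best'' [] \<and> nmem s' ''t'' [] = nmem s ''t'' [] \<Longrightarrow> Q s'"
  shows "runs try_target s Q"
  unfolding try_target_def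
proof (rule runs_Cond)
  assume "\<not> bval (BAnd (neq (scalar ''v'') (scalar ''r''))
            (BAnd (nonzero (NVar ''R'' [scalar ''m'', scalar ''v'']))
              (NLess (NVar ''x'' [scalar ''v'']) (scalar ''n'')))) s"
  then have "\<not> target n m r s v" using s by (auto simp: target_def)
  then show "runs Skip s Q" by (intro runs_Skip post) auto
next
  assume "bval (BAnd (neq (scalar ''v'') (scalar ''r''))
            (BAnd (nonzero (NVar ''R'' [scalar ''m'', scalar ''v'']))
              (NLess (NVar ''x'' [scalar ''v'']) (scalar ''n'')))) s"
  then have tg: "target n m r s v" using s by (auto simp: target_def)
  then have R: "nmem s ''R'' [m, v] \<noteq> 0" "v \<noteq> r" by (auto simp: target_def)
  let ?c = "Cond (RLess (rscalar ''cand'') (rscalar ''best''))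
          (RAssign ''best'' [] (rscalar ''cand'') ;; NAssign ''t'' [] (scalar ''v''))
          Skip"
  have fin: "runs ?c s1 Q" if s1: "agree {} {''y1'', ''y2'', ''cand''} s s1"
    "ereal (rmem s1 ''cand'' []) = target_cost \<Delta> m r j s v" for s1
  proof -
    have "agree {''t''} {''best'', ''y1'', ''y2'', ''cand''} s s1" "nmem s1 = nmem s" "rmem s1 ''best'' = rmem s ''best''"
      using s1(1) by (auto simp: agree_def)
    then show ?thesis using s tg by (intro runs_straight post) (auto simp flip: s1(2))
  qed
  have far: "target_cost \<Delta> m r j s v = ereal (rmem s ''D'' [m, v] + (if v < r then marginal \<Delta> v (Suc (nmem s ''x'' [v])) else 0))"
    using R by (auto simp: target_cost_def flagged_def slot_cost_def)
  show "runs (RAssign ''cand'' [] (RVar ''D'' [scalar ''m'', scalar ''v'']) ;;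
        Cond (NLess (scalar ''v'') (scalar ''r''))
          (CallD ''y1'' (scalar ''v'') (NAdd (NVar ''x'' [scalar ''v'']) (NConst 1)) ;;
           CallD ''y2'' (scalar ''v'') (NVar ''x'' [scalar ''v'']) ;;
           RAssign ''cand'' []
             (RAdd (rscalar ''cand'')
               (RSub (RMul (ROfNat (NAdd (NVar ''x'' [scalar ''v'']) (NConst 1))) (rscalar ''y1''))
                     (RMul (ROfNat (NVar ''x'' [scalar ''v''])) (rscalar ''y2'')))))
          Skip ;; ?c) s Q"
    using s
    by (intro runs_Seq runs_RAssign runs_Cond[where b = "NLess (scalar ''v'') (scalar ''r'')"] runs_CallD runs_Skip fin)
      (auto simp: far marginal_def)
qed

lemma runs_select_target:
  assumes s: "nmem s ''n'' [] = n" "nmem s ''m'' [] = m" "nmem s ''r'' [] = r" "nmem s ''j'' [] = j"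
    and post: "\<And>s' \<delta> t. agree {''t'', ''v''} {''best'', ''y1'', ''y2'', ''cand''} s s' \<Longrightarrow> nmem s' ''t'' [] = t \<Longrightarrow>
       \<delta> \<le> marginal \<Delta> r j \<Longrightarrow> (\<And>v. target n m r s v \<Longrightarrow> ereal \<delta> \<le> target_cost \<Delta> m r j s v) \<Longrightarrow>
       t = r \<and> \<delta> = marginal \<Delta> r j \<or> target n m r s t \<and> target_cost \<Delta> m r j s t = ereal \<delta> \<Longrightarrow> Q s'"
  shows "runs select_target s Q"
proof -
  define I where "I k s' \<longleftrightarrow> agree {''t'', ''v''} {''best'', ''y1'', ''y2'', ''cand''} s s' \<and> nmem s' ''v'' [] = k \<and>
     rmem s' ''best'' [] \<le> marginal \<Delta> r j \<and>
     (\<forall>v<k. target n m r s v \<longrightarrow> ereal (rmem s' ''best'' []) \<le> target_cost \<Delta> m r j s v) \<and>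
     (nmem s' ''t'' [] = r \<and> rmem s' ''best'' [] = marginal \<Delta> r j \<or>
      target n m r s (nmem s' ''t'' []) \<and> target_cost \<Delta> m r j s (nmem s' ''t'' []) = ereal (rmem s' ''best'' []))" for k s'
  have cong: "target n m r s' = target n m r s" "target_cost \<Delta> m r j s' = target_cost \<Delta> m r j s"
    "nmem s' ''n'' [] = n" "nmem s' ''m'' [] = m" "nmem s' ''r'' [] = r"
    if "agree {''t'', ''v''} {''best'', ''y1'', ''y2'', ''cand''} s s'" for s'
    using that s by (simp_all add: agree_def target_def target_cost_def fun_eq_iff)
  have loop: "runs (For ''v'' (scalar ''m'') try_target) s1 Q" if "I 0 (nupdate ''v'' [] 0 s1)" for s1
  proof (rule runs_For[where N = m and I = I])
    show "I 0 (nupdate ''v'' [] 0 s1)" by (rule that)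
    show "nval (scalar ''m'') s2 = m \<and> nmem s2 ''v'' [] = k" if "I k s2" for k s2
      using that s by (simp add: I_def agree_def)
    show "Q s2" if s2: "I m s2" for s2
    proof (rule post[where \<delta> = "rmem s2 ''best'' []" and t = "nmem s2 ''t'' []"])
      show "ereal (rmem s2 ''best'' []) \<le> target_cost \<Delta> m r j s v" if "target n m r s v" for v
        using s2 that unfolding I_def target_def by blast
    qed (use s2 in \<open>simp_all add: I_def\<close>)
    fix k s2 assume k: "k < m" and s2: "I k s2"
    have ag: "agree {''t'', ''v''} {''best'', ''y1'', ''y2'', ''cand''} s s2" and v: "nmem s2 ''v'' [] = k"
      and le: "rmem s2 ''best'' [] \<le> marginal \<Delta> r j"
      and lo: "\<And>v. v < k \<Longrightarrow> target n m r s v \<Longrightarrow> ereal (rmem s2 ''best'' []) \<le> target_cost \<Delta> m r j s v"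
      and at: "nmem s2 ''t'' [] = r \<and> rmem s2 ''best'' [] = marginal \<Delta> r j \<or>
        target n m r s (nmem s2 ''t'' []) \<and> target_cost \<Delta> m r j s (nmem s2 ''t'' []) = ereal (rmem s2 ''best'' [])"
      using s2 by (auto simp: I_def)
    note c = cong[OF ag]
    show "runs try_target s2 (\<lambda>s'. nmem s' ''v'' [] = k \<and> I (Suc k) (nupdate ''v'' [] (Suc k) s'))"
    proof (rule runs_try_target[where v = k and r = r and j = j], goal_cases)
      case (6 s3)
      have ag3: "agree {''t'', ''v''} {''best'', ''y1'', ''y2'', ''cand''} s s3"
        by (rule agree_trans[OF ag 6(1)]) auto
      have v3: "nmem s3 ''v'' [] = k" using 6(1) v by (simp add: agree_def)
      from 6(2) show ?case
      proof (elim disjE conjE, goal_cases)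
        case 1
        then have less: "rmem s3 ''best'' [] < rmem s2 ''best'' []" using c by (metis less_ereal.simps(1))
        have "ereal (rmem s3 ''best'' []) \<le> target_cost \<Delta> m r j s v" if "v < Suc k" "target n m r s v" for v
        proof (cases "v = k")
          case True
          then show ?thesis using 1 c by simp
        next
          case False
          then have "ereal (rmem s2 ''best'' []) \<le> target_cost \<Delta> m r j s v" using lo that by simp
          moreover have "ereal (rmem s3 ''best'' []) \<le> ereal (rmem s2 ''best'' [])" using less by simp
          ultimately show ?thesis by (rule order_trans[rotated])
        qed
        then show ?case using 1 c ag3 v3 less le by (simp add: I_def)
      next
        case 2
        have "ereal (rmem s3 ''best'' []) \<le> target_cost \<Delta> m r j s v" if "v < Suc k" "target n m r s v" for v
          using that 2 c lo[of v] by (cases "v = k") auto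
        then show ?case using 2 ag3 v3 le at by (simp add: I_def)
      qed
    qed (use c v k in auto)
  qed simp_all
  show ?thesis unfolding select_target_def
    using s by (intro runs_Seq runs_CallD runs_RAssign runs_NAssign loop) (simp add: I_def marginal_def)
qed

lemma runs_trace:
  assumes s: "nmem s ''m'' [] = m" "nmem s ''t'' [] = t"
    and post: "\<And>s'. agree {''X'', ''q'', ''l'', ''t''} {} s s' \<Longrightarrow>
       rows s' = augment (\<lambda>k v. nmem s ''Q'' [k, v]) (\<lambda>u v. nmem s ''P'' [u, v]) m t (rows s) \<Longrightarrow> Q s'"
  shows "runs (For ''l'' (scalar ''m'') trace_step) s Q"
proof -
  let ?aug = "augment (\<lambda>k v. nmem s ''Q'' [k, v]) (\<lambda>u v. nmem s ''P'' [u, v])"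
  show ?thesis
  \<comment> \<open>\<open>augment\<close> is tail recursive: continuing from the current vertex and
    rows always has the same final result.\<close>
  proof (rule runs_For[where N = m and I = "\<lambda>l s'. agree {''X'', ''q'', ''l'', ''t''} {} s s' \<and> nmem s' ''l'' [] = l \<and>
      ?aug (m - l) (nmem s' ''t'' []) (rows s') = ?aug m t (rows s)"], goal_cases)
    case (4 l s1)
    then have "m - l = Suc (m - Suc l)" by simp
    moreover have "nmem s1 ''Q'' = nmem s ''Q''" "nmem s1 ''P'' = nmem s ''P''" "nmem s1 ''m'' [] = m"
      using 4 s by (auto simp: agree_def)
    ultimately show ?case unfolding trace_step_def
      using 4 by (intro runs_straight) (auto simp: Let_def split: if_splits)
  qed (use s post in \<open>auto simp: agree_def\<close>)
qed

text \<open>Within a resource the free slots precede the priced ones. At the border nonnegativity of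
  the marginal cost is used, beyond it convexity.\<close>

lemma slot_cost_mono: "v < m \<Longrightarrow> 0 < k \<Longrightarrow> slot_cost \<Delta> r j v k \<le> slot_cost \<Delta> r j v (Suc k)"
  using marginal_mono[of v k] marginal_nonneg[of v "Suc k"] by (auto simp: slot_cost_def)

lemma slot_cost_raise:
  "0 < j \<Longrightarrow> (slot_cost \<Delta> r j)(r := (slot_cost \<Delta> r j r)(j := marginal \<Delta> r j)) = slot_cost \<Delta> r (j - 1)"
  by (auto simp: slot_cost_def fun_eq_iff)

abbreviation "supported c p Z \<equiv> supports {..<m} {1..n} Bs fs c p Z"

text \<open>The three outcomes of a phase are covered by \<open>supports_slot_unused\<close>,
  \<open>supports_raised_keep\<close> and \<open>supports_augment\<close>.\<close>

lemma runs_raise_slot: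
  assumes s: "nmem s ''n'' [] = n" "nmem s ''m'' [] = m" "nmem s ''r'' [] = r" "nmem s ''j'' [] = j"
    and rj: "r < m" "0 < j" and sup: "supported (slot_cost \<Delta> r j) p (rows s)"
    and post: "\<And>s' p'. (\<And>x. x \<in> {''n'', ''m'', ''r'', ''z''} \<Longrightarrow> nmem s' x = nmem s x) \<Longrightarrow>
      supported (slot_cost \<Delta> r (j - 1)) p' (rows s') \<Longrightarrow> Q s'"
  shows "runs raise_slot s Q"
  unfolding raise_slot_def
proof (rule runs_Seq, rule runs_count_players)
  fix s1 assume ag1: "agree {''x'', ''v'', ''i''} {} s s1"
    and x1: "\<And>v. v < m \<Longrightarrow> nmem s1 ''x'' [v] = congested {1..n} (rows s) v"
  define Z where "Z = rows s"
  have Z1: "rows s1 = Z" using agree_rows[OF ag1] by (simp add: Z_def)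
  have sup: "supported (slot_cost \<Delta> r j) p Z" using sup by (simp add: Z_def)
  have vars1: "nmem s1 ''n'' [] = n" "nmem s1 ''m'' [] = m" "nmem s1 ''r'' [] = r" "nmem s1 ''j'' [] = j"
    using ag1 s by (simp_all add: agree_def)
  let ?keep = "\<lambda>s'. \<forall>x\<in>{''n'', ''m'', ''r'', ''z''}. nmem s' x = nmem s x"
  have keep1: "?keep s1" using ag1 by (simp add: agree_def)
  have post': "Q s'" if "?keep s'" "supported (slot_cost \<Delta> r (j - 1)) p' (rows s')" for s' p'
    using that by (intro post) auto
  show "runs (Cond (neq (NVar ''x'' [scalar ''r'']) (scalar ''j''))
       Skip
       (compute_arcs ;; bellman_ford ;; select_target ;;
        Cond (neq (scalar ''t'') (scalar ''r'')) (For ''l'' (scalar ''m'') trace_step) Skip)) s1 Q"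
  proof (rule runs_Cond)
    assume "bval (neq (NVar ''x'' [scalar ''r'']) (scalar ''j'')) s1"
    then have "congested {1..n} Z r \<noteq> j" using vars1 x1[OF rj(1)] by (simp add: Z_def)
    moreover have "slot_cost \<Delta> r j r j \<le> marginal \<Delta> r j"
      using marginal_nonneg[OF rj] by (simp add: slot_cost_def)
    ultimately have "supported (slot_cost \<Delta> r (j - 1)) p Z"
      using supports_slot_unused[OF sup, of r j] slot_cost_raise[OF rj(2), of r] by metis
    then show "runs Skip s1 Q" using keep1 Z1 by (intro runs_Skip post') auto
  next
    assume "\<not> bval (neq (NVar ''x'' [scalar ''r'']) (scalar ''j'')) s1"
    then have cj: "congested {1..n} Z r = j" using vars1 x1[OF rj(1)] by (simp add: Z_def)
    have Zb: "Z i \<in> Bs i" if "i \<in> {1..n}" for i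
      using sup that by (auto simp: supports_def minimizer_def)
    interpret exchange_graph "{..<m}" "{1..n}" Bs fs Z p r
    proof
      show "minimizer (Bs i) (\<lambda>Y. fs i Y + sum p Y) (Z i)" if "i \<in> {1..n}" for i
        using sup that by (simp add: supports_def)
    qed (use vmat rj in \<open>auto simp: bases_def\<close>)
    show "runs (compute_arcs ;; bellman_ford ;; select_target ;;
        Cond (neq (scalar ''t'') (scalar ''r'')) (For ''l'' (scalar ''m'') trace_step) Skip) s1 Q"
    proof (rule runs_Seq, rule runs_compute_arcs[OF vars1(1,2) Zb Z1])
      fix s2 assume ag2: "agree {''X'', ''f'', ''F'', ''P'', ''u'', ''v'', ''i''} {''y'', ''base'', ''L''} s1 s2"
        and Z2: "rows s2 = rows s1" and sc: "\<And>u v. u < m \<Longrightarrow> v < m \<Longrightarrow> arc_scanned Z n u v s2"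
      have vars2: "nmem s2 ''n'' [] = n" "nmem s2 ''m'' [] = m" "nmem s2 ''r'' [] = r" "nmem s2 ''j'' [] = j"
        "nmem s2 ''x'' = nmem s1 ''x''" and keep2: "?keep s2"
        using ag2 vars1 keep1 by (simp_all add: agree_def)
      have L2: "arc_flagged s2 u v = L u v" if "u < m" "v < m" for u v
        using sc[OF that] unfolding arc_scanned_def L_def by blast
      show "runs (bellman_ford ;; select_target ;;
        Cond (neq (scalar ''t'') (scalar ''r'')) (For ''l'' (scalar ''m'') trace_step) Skip) s2 Q"
      proof (rule runs_Seq, rule runs_bellman_ford[OF vars2(2,3) rj(1)])
        fix s3 assume ag3: "agree {''R'', ''Q'', ''u'', ''v'', ''k''} {''D''} s2 s3"
          and w3: "\<And>k v. k \<le> m \<Longrightarrow> v < m \<Longrightarrow> walk_flagged s3 k v = walk_dist {..<m} (arc_flagged s2) r k v"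
          and rel3: "\<And>k v. k < m \<Longrightarrow> v < m \<Longrightarrow> relaxed m m k v s3"
        have vars3: "nmem s3 ''n'' [] = n" "nmem s3 ''m'' [] = m" "nmem s3 ''r'' [] = r" "nmem s3 ''j'' [] = j"
          "nmem s3 ''x'' = nmem s1 ''x''" "nmem s3 ''F'' = nmem s2 ''F''" "nmem s3 ''P'' = nmem s2 ''P''"
          "rmem s3 ''L'' = rmem s2 ''L''" and keep3: "?keep s3"
          using ag3 vars2 keep2 by (simp_all add: agree_def)
        have Z3: "rows s3 = Z" using agree_rows[OF ag3] Z2 Z1 by simp
        have D3: "walk_flagged s3 k v = D k v" if "k \<le> m" "v < m" for k v
          using w3[OF that] walk_dist_cong[of "{..<m}" "arc_flagged s2" L v r k] L2 that by simp
        have tg: "target n m r s3 v \<longleftrightarrow> v \<in> {..<m} \<and> v \<noteq> r \<and> sdist v < \<infinity> \<and> congested {1..n} Z v < card {1..n}" for v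
          using D3[of m v] x1[of v] vars3 by (auto simp: target_def Z_def flagged_def split: if_splits)
        have tc: "target_cost \<Delta> m r j s3 v = sdist v + ereal (slot_cost \<Delta> r j v (Suc (congested {1..n} Z v)))"
          if "v < m" for v
          using D3[of m v] x1[of v] vars3 that by (simp add: target_cost_def Z_def)
        have nx: "marginal \<Delta> r j \<le> slot_cost \<Delta> r j r (Suc j)"
          using marginal_mono[OF rj] by (simp add: slot_cost_def)
        show "runs (select_target ;;
          Cond (neq (scalar ''t'') (scalar ''r'')) (For ''l'' (scalar ''m'') trace_step) Skip) s3 Q"
        proof (rule runs_Seq, rule runs_select_target[OF vars3(1-4)])
          fix s4 \<delta> t
          assume ag4: "agree {''t'', ''v''} {''best'', ''y1'', ''y2'', ''cand''} s3 s4" and t4: "nmem s4 ''t'' [] = t"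
            and \<delta>: "\<delta> \<le> marginal \<Delta> r j" "\<And>v. target n m r s3 v \<Longrightarrow> ereal \<delta> \<le> target_cost \<Delta> m r j s3 v"
            and t: "t = r \<and> \<delta> = marginal \<Delta> r j \<or> target n m r s3 t \<and> target_cost \<Delta> m r j s3 t = ereal \<delta>"
          have vars4: "nmem s4 ''m'' [] = m" "nmem s4 ''r'' [] = r" "nmem s4 ''P'' = nmem s2 ''P''" "nmem s4 ''Q'' = nmem s3 ''Q''"
            and keep4: "?keep s4" using ag4 vars3 keep3 by (simp_all add: agree_def)
          have Z4: "rows s4 = Z" using agree_rows[OF ag4] Z3 by simp
          have far: "ereal \<delta> \<le> sdist v + ereal (slot_cost \<Delta> r j v (Suc (congested {1..n} Z v)))"
            if "v \<in> {..<m}" "v \<noteq> r" "sdist v < \<infinity>" "congested {1..n} Z v < card {1..n}" for v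
            using \<delta>(2)[of v] tg[of v] tc[of v] that by simp
          show "runs (Cond (neq (scalar ''t'') (scalar ''r'')) (For ''l'' (scalar ''m'') trace_step) Skip) s4 Q"
          proof (rule runs_Cond)
            assume "\<not> bval (neq (scalar ''t'') (scalar ''r'')) s4"
            then have "t = r" using t4 vars4 by simp
            then have "\<delta> = marginal \<Delta> r j" using t tg by auto
            then have "supported ((slot_cost \<Delta> r j)(r := (slot_cost \<Delta> r j r)(j := marginal \<Delta> r j))) (raised (marginal \<Delta> r j)) Z"
              using far nx by (intro supports_raised_keep[OF sup cj]) auto
            then show "runs Skip s4 Q"
              unfolding slot_cost_raise[OF rj(2)] using keep4 Z4 by (intro runs_Skip post') auto
          next
            assume "bval (neq (scalar ''t'') (scalar ''r'')) s4"
            then have tr: "target n m r s3 t" "target_cost \<Delta> m r j s3 t = ereal \<delta>" using t t4 vars4 by auto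
            let ?Q = "\<lambda>k v. nmem s4 ''Q'' [k, v]" and ?P = "\<lambda>u v. nmem s4 ''P'' [u, v]"
            interpret augmentation "{..<m}" "{1..n}" Bs fs Z p r ?Q ?P
            proof
              fix k v assume k: "k < card {..<m}" and v: "v \<in> {..<m}"
              then have k: "k < m" "v < m" by simp_all
              have "arc_flagged s3 u v = L u v" if "u < m" for u using L2[of u v] vars3 that k by simp
              \<comment> \<open>The exchange graph has no loops, so a strict improvement never has
                \<open>v\<close> as its own parent.\<close>
              moreover have "\<infinity> \<le> L v v" unfolding L_def by (rule INF_greatest) (simp add: arc_length_self)
              ultimately show "?Q (Suc k) v = v \<and> D (Suc k) v = D k v \<or>
                 ?Q (Suc k) v \<in> {..<m} \<and> ?Q (Suc k) v \<noteq> v \<and> D (Suc k) v = D k (?Q (Suc k) v) + L (?Q (Suc k) v) v \<and>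
                 D (Suc k) v < D k v"
                using rel3[OF k] k D3[of "Suc k" v] D3[of k v] D3[of k "?Q (Suc k) v"] vars4
                unfolding relaxed_def by (cases "?Q (Suc k) v = v") auto
            next
              fix u v assume uv: "u \<in> {..<m}" "v \<in> {..<m}" and fin: "L u v < \<infinity>"
              then have "nmem s2 ''F'' [u, v] \<noteq> 0" using L2[of u v] by (auto simp: flagged_def split: if_splits)
              then show "?P u v \<in> {1..n} \<and> L u v = arc_length Bs fs Z (?P u v) u v"
                using sc[of u v] uv L2[of u v] vars4 by (simp add: arc_scanned_def)
            qed
            have "supported ((slot_cost \<Delta> r j)(r := (slot_cost \<Delta> r j r)(j := marginal \<Delta> r j))) (raised \<delta>)
                (augment ?Q ?P (card {..<m}) t Z)"
              using tr tg[of t] tc[of t] far nx \<delta>(1) rj(2)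
              by (intro supports_augment[OF sup cj]) (auto intro: slot_cost_mono)
            then have sup': "supported (slot_cost \<Delta> r (j - 1)) (raised \<delta>) (augment ?Q ?P m t Z)"
              unfolding slot_cost_raise[OF rj(2)] by simp
            show "runs (For ''l'' (scalar ''m'') trace_step) s4 Q"
            proof (rule runs_trace[OF vars4(1) t4])
              fix s5 assume ag5: "agree {''X'', ''q'', ''l'', ''t''} {} s4 s5" and Z5: "rows s5 = augment ?Q ?P m t (rows s4)"
              have "?keep s5" using ag5 keep4 by (simp add: agree_def)
              then show "Q s5" using sup' Z5 Z4 by (intro post') auto
            qed
          qed
        qed
      qed
    qed
  qed
qed (use s in auto)

lemma runs_optimize:
  assumes s: "nmem s ''n'' [] = n" "nmem s ''m'' [] = m" "\<And>i. i \<in> {1..n} \<Longrightarrow> rows s i \<in> Bs i"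
    and post: "\<And>s' p. supported (marginal \<Delta>) p (rows s') \<Longrightarrow> Q s'"
  shows "runs optimize s Q"
  unfolding optimize_def
proof (rule runs_Seq, rule runs_greedy[OF s])
  fix s1 assume ag: "agree {''X'', ''f'', ''v'', ''w'', ''u'', ''i''} {''y'', ''best''} s s1"
    and min: "\<And>i. i \<in> {1..n} \<Longrightarrow> minimizer (Bs i) (fs i) (rows s1 i)"
  \<comment> \<open>While every slot is free, zero prices certify the separately minimal
    bases.\<close>
  have "supported (\<lambda>_ _. 0) (\<lambda>_. 0) (rows s1)" using min by (simp add: supports_def)
  then have init: "supported (slot_cost \<Delta> 0 n) (\<lambda>_. 0) (rows s1)"
    by (subst supports_cong[where c' = "\<lambda>_ _. 0"]) (auto simp: slot_cost_def)
  define J where "J r z s' \<longleftrightarrow> nmem s' ''n'' [] = n \<and> nmem s' ''m'' [] = m \<and> nmem s' ''r'' [] = r \<and>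
    (\<exists>p. supported (slot_cost \<Delta> r (n - z)) p (rows s'))" for r z s'
  show "runs (For ''r'' (scalar ''m'')
       (For ''z'' (scalar ''n'') (NAssign ''j'' [] (NSub (scalar ''n'') (scalar ''z'')) ;; raise_slot))) s1 Q"
  proof (rule runs_For[where N = m and I = "\<lambda>r. J r 0"])
    show "J 0 0 (nupdate ''r'' [] 0 s1)" using init ag s by (auto simp: J_def agree_def)
    fix r s2 assume r: "r < m" and s2: "J r 0 s2"
    show "runs (For ''z'' (scalar ''n'') (NAssign ''j'' [] (NSub (scalar ''n'') (scalar ''z'')) ;; raise_slot)) s2
      (\<lambda>s'. nmem s' ''r'' [] = r \<and> J (Suc r) 0 (nupdate ''r'' [] (Suc r) s'))"
    proof (rule runs_For[where N = n and I = "\<lambda>z s'. J r z s' \<and> nmem s' ''z'' [] = z"])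
      fix z s3 assume z: "z < n" and s3: "J r z s3 \<and> nmem s3 ''z'' [] = z"
      then obtain p where p: "supported (slot_cost \<Delta> r (n - z)) p (rows s3)" by (auto simp: J_def)
      show "runs (NAssign ''j'' [] (NSub (scalar ''n'') (scalar ''z'')) ;; raise_slot) s3
        (\<lambda>s'. nmem s' ''z'' [] = z \<and> J r (Suc z) (nupdate ''z'' [] (Suc z) s') \<and>
          nmem (nupdate ''z'' [] (Suc z) s') ''z'' [] = Suc z)"
      proof (intro runs_Seq runs_NAssign, rule runs_raise_slot[where r = r and j = "n - z" and p = p])
        fix s4 p'
        assume s4: "\<And>x. x \<in> {''n'', ''m'', ''r'', ''z''} \<Longrightarrow> nmem s4 x =
            nmem (nupdate ''j'' (map (\<lambda>e. nval e s3) []) (nval (NSub (scalar ''n'') (scalar ''z'')) s3) s3) x"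
          and "supported (slot_cost \<Delta> r (n - z - 1)) p' (rows s4)"
        then have "supported (slot_cost \<Delta> r (n - Suc z)) p' (rows s4)" by simp
        then show "nmem s4 ''z'' [] = z \<and> J r (Suc z) (nupdate ''z'' [] (Suc z) s4) \<and>
          nmem (nupdate ''z'' [] (Suc z) s4) ''z'' [] = Suc z"
          using s3 s4[of "''n''"] s4[of "''m''"] s4[of "''r''"] s4[of "''z''"] by (auto simp: J_def)
      qed (use s3 z r p in \<open>auto simp: J_def\<close>)
    next
      fix s3 assume s3: "J r n s3 \<and> nmem s3 ''z'' [] = n"
      then obtain p where "supported (slot_cost \<Delta> r 0) p (rows s3)" by (auto simp: J_def)
      \<comment> \<open>On slots 1 to \<open>n\<close>, having treated all slots of \<open>r\<close>
        is the same as having treated none of \<open>Suc r\<close>.\<close>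
      then have "supported (slot_cost \<Delta> (Suc r) n) p (rows s3)"
        by (subst supports_cong[where c' = "slot_cost \<Delta> r 0"]) (auto simp: slot_cost_def less_Suc_eq)
      then show "nmem s3 ''r'' [] = r \<and> J (Suc r) 0 (nupdate ''r'' [] (Suc r) s3)"
        using s3 by (auto simp: J_def)
    qed (use s2 in \<open>auto simp: J_def\<close>)
  next
    fix s2 assume "J m 0 s2"
    then obtain p where "supported (slot_cost \<Delta> m n) p (rows s2)" by (auto simp: J_def)
    then have "supported (marginal \<Delta>) p (rows s2)"
      by (subst supports_cong[where c' = "slot_cost \<Delta> m n"]) (auto simp: slot_cost_def)
    then show "Q s2" by (rule post)
  qed (auto simp: J_def)
qed

end

section \<open>Correctness and running time\<close>

lemma valuated_matroid_bases:
  fixes vs :: "'v list"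
  assumes vm: "valuated_matroid (set vs) (\<omega> i)" and vs: "distinct vs"
    and nonneg: "\<And>X. X \<subseteq> set vs \<Longrightarrow> 0 \<le> \<omega> i X"
  shows "real_valuated_matroid (bases (length vs) (omega_oracle vs \<omega>) i) (valuation (omega_oracle vs \<omega>) i)"
    (is "real_valuated_matroid ?B ?f")
  unfolding real_valuated_matroid_def
proof (intro ballI)
  let ?g = "(!) vs" and ?w = "omega_oracle vs \<omega> i"
  have inj: "inj_on ?g {..<length vs}" using vs by (auto simp: inj_on_def nth_eq_iff_index_eq)
  have sub: "?g ` S \<subseteq> set vs" if "S \<subseteq> {..<length vs}" for S using that by auto
  fix X Y v assume XY: "X \<in> ?B" "Y \<in> ?B" "v \<in> X - Y"
  then have XYm: "X \<subseteq> {..<length vs}" "Y \<subseteq> {..<length vs}" by (auto simp: bases_def)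
  have "?g ` X \<in> effective_domain (set vs) (\<omega> i)" "?g ` Y \<in> effective_domain (set vs) (\<omega> i)"
    using XY sub XYm by (auto simp: effective_domain_def bases_def omega_oracle_def)
  moreover have "?g v \<in> ?g ` X - ?g ` Y"
    using XY XYm inj_on_image_mem_iff[OF inj, of v Y] by auto
  ultimately obtain u' where u': "u' \<in> ?g ` Y - ?g ` X"
    "\<omega> i ((?g ` X - {?g v}) \<union> {u'}) + \<omega> i ((?g ` Y \<union> {?g v}) - {u'}) \<le> \<omega> i (?g ` X) + \<omega> i (?g ` Y)"
    using vm unfolding valuated_matroid_def by meson
  then obtain u where u: "u \<in> Y" "u \<notin> X" "u' = ?g u" by auto
  have uv: "u \<noteq> v" "u < length vs" "v < length vs" using u XY XYm by auto
  have "?g ` (X - {v}) = ?g ` X - {?g v}" "?g ` (Y - {u}) = ?g ` Y - {?g u}"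
    using inj_on_image_set_diff[OF inj, of X "{v}"] inj_on_image_set_diff[OF inj, of Y "{u}"] XYm uv
    by (simp_all add: subset_iff)
  moreover have "?g v \<noteq> ?g u" using inj_onD[OF inj, of v u] uv by auto
  ultimately have "(?g ` X - {?g v}) \<union> {u'} = ?g ` insert u (X - {v})"
    "(?g ` Y \<union> {?g v}) - {u'} = ?g ` insert v (Y - {u})"
    unfolding u(3) by (simp_all add: insert_Diff_if)
  then have le: "?w (insert u (X - {v})) + ?w (insert v (Y - {u})) \<le> ?w X + ?w Y"
    using u'(2) by (simp add: omega_oracle_def)
  have m: "insert u (X - {v}) \<subseteq> {..<length vs}" "insert v (Y - {u}) \<subseteq> {..<length vs}"
    using XYm uv by auto
  have ge: "0 \<le> ?w S" if "S \<subseteq> {..<length vs}" for S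
    using nonneg[OF sub[OF that]] by (simp add: omega_oracle_def)
  obtain a b where ab: "?w X = ereal a" "?w Y = ereal b"
    using XY ge[OF XYm(1)] ge[OF XYm(2)] by (cases "?w X"; cases "?w Y") (auto simp: bases_def)
  \<comment> \<open>Nonnegative summands of a finite bound are finite; this puts both exchanged sets
    into the domain.\<close>
  obtain c d where cd: "?w (insert u (X - {v})) = ereal c" "?w (insert v (Y - {u})) = ereal d"
    using le ab ge[OF m(1)] ge[OF m(2)]
    by (cases "?w (insert u (X - {v}))"; cases "?w (insert v (Y - {u}))") auto
  show "\<exists>u\<in>Y - X. insert u (X - {v}) \<in> ?B \<and> insert v (Y - {u}) \<in> ?B \<and>
      ?f (insert u (X - {v})) + ?f (insert v (Y - {u})) \<le> ?f X + ?f Y"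
    using u ab cd m le by (intro bexI[of _ u]) (simp_all add: bases_def valuation_def)
qed

text \<open>The marginal cost at 1 is \<open>\<Delta> j 1\<close>, which is nonnegative, and weak
  convexity says exactly that marginal costs do not decrease from there on.\<close>

lemma marginal_convex:
  assumes nonneg: "\<And>x. 0 \<le> \<Delta> j x" and conv: "weakly_convex (\<Delta> j)" and k: "0 < k"
  shows "0 \<le> marginal \<Delta> j k" "marginal \<Delta> j k \<le> marginal \<Delta> j (Suc k)"
proof -
  have eq: "marginal \<Delta> j (Suc x) = real (x + 1) * \<Delta> j (x + 1) - real x * \<Delta> j x" for x
    by (simp add: marginal_def)
  have mono: "marginal \<Delta> j (Suc x) \<le> marginal \<Delta> j (Suc y)" if "x \<le> y" for x y
    unfolding eq using conv that unfolding weakly_convex_def by (rule monoD)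
  obtain x where x: "k = Suc x" using k by (cases k) auto
  have "0 \<le> marginal \<Delta> j (Suc 0)" using nonneg[of 1] by (simp add: eq)
  also have "\<dots> \<le> marginal \<Delta> j k" unfolding x by (rule mono) simp
  finally show "0 \<le> marginal \<Delta> j k" .
  show "marginal \<Delta> j k \<le> marginal \<Delta> j (Suc k)" unfolding x by (rule mono) simp
qed

text \<open>Each of the \<open>x\<close> users of a resource pays its cost at \<open>x\<close>;
  double counting by \<open>sum_congested\<close> turns this into \<open>x\<close> times that
  cost.\<close>

lemma social_cost_rows:
  fixes vs :: "'v list"
  assumes vs: "distinct vs" and nonneg: "\<And>i X. i \<in> {1..n} \<Longrightarrow> X \<subseteq> set vs \<Longrightarrow> 0 \<le> \<omega> i X"
    and Z: "\<And>i. i \<in> {1..n} \<Longrightarrow> Z i \<in> bases (length vs) (omega_oracle vs \<omega>) i"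
    and X: "\<And>i. i \<in> {1..n} \<Longrightarrow> X i = (!) vs ` Z i"
  shows "social_cost n \<omega> d X = ereal ((\<Sum>i\<in>{1..n}. valuation (omega_oracle vs \<omega>) i (Z i)) +
    (\<Sum>v\<in>{..<length vs}. real (congested {1..n} Z v) * d (vs ! v) (congested {1..n} Z v)))"
proof -
  have Zm: "Z i \<subseteq> {..<length vs}" if "i \<in> {1..n}" for i using Z[OF that] by (auto simp: bases_def)
  have inj: "inj_on ((!) vs) {..<length vs}" using vs by (auto simp: inj_on_def nth_eq_iff_index_eq)
  have cong: "congestion n X (vs ! v) = congested {1..n} Z v" if "v < length vs" for v
  proof -
    have "vs ! v \<in> X i \<longleftrightarrow> v \<in> Z i" if "i \<in> {1..n}" for i
      using X[OF that] inj_on_image_mem_iff[OF inj _ Zm[OF that]] \<open>v < length vs\<close> by simp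
    then have "{i \<in> {1..n}. vs ! v \<in> X i} = {i \<in> {1..n}. v \<in> Z i}" by blast
    then show ?thesis by (simp add: congestion_def congested_def)
  qed
  have pc: "player_cost n \<omega> d X i = ereal (valuation (omega_oracle vs \<omega>) i (Z i) +
      (\<Sum>v\<in>Z i. d (vs ! v) (congested {1..n} Z v)))" if i: "i \<in> {1..n}" for i
  proof -
    have "\<omega> i (X i) = omega_oracle vs \<omega> i (Z i)" by (simp add: omega_oracle_def X[OF i])
    moreover have "0 \<le> \<omega> i (X i)" using Zm[OF i] X[OF i] by (intro nonneg[OF i]) auto
    ultimately have "\<omega> i (X i) = ereal (valuation (omega_oracle vs \<omega>) i (Z i))"
      using Z[OF i] by (cases "omega_oracle vs \<omega> i (Z i)") (simp_all add: valuation_def bases_def)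
    moreover have "(\<Sum>v\<in>X i. d v (congestion n X v)) = (\<Sum>v\<in>Z i. d (vs ! v) (congested {1..n} Z v))"
      unfolding X[OF i] using Zm[OF i] cong
      by (subst sum.reindex[OF inj_on_subset[OF inj Zm[OF i]]]) (auto simp flip: X[OF i] intro!: sum.cong)
    ultimately show ?thesis by (simp add: player_cost_def)
  qed
  have "social_cost n \<omega> d X = ereal ((\<Sum>i\<in>{1..n}. valuation (omega_oracle vs \<omega>) i (Z i)) +
     (\<Sum>i\<in>{1..n}. \<Sum>v\<in>Z i. d (vs ! v) (congested {1..n} Z v)))"
    unfolding social_cost_def by (subst sum.cong[OF refl pc]) (simp_all add: sum.distrib)
  also have "(\<Sum>i\<in>{1..n}. \<Sum>v\<in>Z i. d (vs ! v) (congested {1..n} Z v)) =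
    (\<Sum>v\<in>{..<length vs}. real (congested {1..n} Z v) * d (vs ! v) (congested {1..n} Z v))"
    using Zm by (intro sum_congested) auto
  finally show ?thesis .
qed

lemma optimize_computes_social_optimum:
  fixes V :: "'v set"
  assumes game: "matroid_congestion_game n V \<B> \<omega> d" and vs: "distinct vs" "set vs = V"
    and st: "is_state n \<B> X\<^sub>0" and T: "step_bound (card V + n + 1) optimize \<le> T"
  shows "computes_social_optimum optimize T n vs \<B> \<omega> d X\<^sub>0"
proof -
  let ?\<Omega> = "omega_oracle vs \<omega>" and ?\<Delta> = "d_oracle vs d" and ?m = "length vs" and ?s = "input_store n vs X\<^sub>0"
  have m: "card V = ?m" using vs distinct_card by blast
  have omega_nonneg: "0 \<le> \<omega> i X" if "i \<in> {1..n}" "X \<subseteq> set vs" for i X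
    using game that vs(2) by (auto simp: matroid_congestion_game_def)
  have \<B>: "\<B> i = effective_domain V (\<omega> i)" if "i \<in> {1..n}" for i
    using game that by (simp add: matroid_congestion_game_def)
  interpret game_oracles ?\<Omega> ?\<Delta> n ?m
  proof
    fix i S assume i: "i \<in> {1..n}" and "S \<subseteq> {..<?m}"
    then have "(!) vs ` S \<subseteq> set vs" by auto
    then show "0 \<le> ?\<Omega> i S" unfolding omega_oracle_def by (rule omega_nonneg[OF i])
  next
    fix i assume "i \<in> {1..n}"
    then show "real_valuated_matroid (bases ?m ?\<Omega> i) (valuation ?\<Omega> i)"
      using game vs omega_nonneg by (intro valuated_matroid_bases) (auto simp: matroid_congestion_game_def)
  next
    fix v k assume v: "v < ?m" and k: "0 < (k::nat)"
    then have "vs ! v \<in> V" using vs by auto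
    moreover have "?\<Delta> v = d (vs ! v)" by (simp add: d_oracle_def fun_eq_iff)
    ultimately have "\<And>x. 0 \<le> ?\<Delta> v x" "weakly_convex (?\<Delta> v)"
      using game by (auto simp: matroid_congestion_game_def)
    from marginal_convex[of ?\<Delta> v, OF this k]
    show "0 \<le> marginal ?\<Delta> v k" "marginal ?\<Delta> v k \<le> marginal ?\<Delta> v (Suc k)" .
  qed
  define pos where "pos X = {j. j < ?m \<and> vs ! j \<in> X}" for X
  have pos_img: "(!) vs ` pos X = X" if "X \<subseteq> V" for X
    using that vs by (force simp: pos_def in_set_conv_nth)
  have pos_base: "pos (Y i) \<in> Bs i" "(!) vs ` pos (Y i) = Y i" if "is_state n \<B> Y" "i \<in> {1..n}" for Y i
  proof -
    have Y: "Y i \<subseteq> V" "\<omega> i (Y i) < \<infinity>" using that \<B> by (auto simp: is_state_def effective_domain_def)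
    then show "(!) vs ` pos (Y i) = Y i" using pos_img by blast
    with Y show "pos (Y i) \<in> Bs i" by (auto simp: bases_def omega_oracle_def pos_def)
  qed
  have rows0: "rows ?s i \<in> Bs i" if "i \<in> {1..n}" for i
  proof -
    have "rows ?s i = pos (X\<^sub>0 i)" using that by (auto simp: rows_def input_store_def pos_def)
    then show ?thesis using pos_base(1)[OF st that] by simp
  qed
  have "runs optimize ?s (\<lambda>s. \<exists>p. supported (marginal ?\<Delta>) p (rows s))"
  proof (rule runs_optimize[OF _ _ rows0])
    show "nmem ?s ''n'' [] = n" "nmem ?s ''m'' [] = ?m" by (simp_all add: input_store_def)
  qed (assumption, rule exI, assumption)
  then obtain t s p where ex: "exec ?\<Omega> ?\<Delta> optimize ?s t s" "t \<le> step_bound (?m + n + 1) optimize"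
    and sup: "supported (marginal ?\<Delta>) p (rows s)"
    unfolding runs_def by blast
  have rb: "rows s i \<in> Bs i" if "i \<in> {1..n}" for i
    using sup that by (auto simp: supports_def minimizer_def)
  have out: "output_state vs s i = (!) vs ` rows s i" if "i \<in> {1..n}" for i
    using rb[OF that] by (auto simp: output_state_def rows_def bases_def)
  have state: "is_state n \<B> (output_state vs s)"
    unfolding is_state_def
  proof
    fix i assume i: "i \<in> {1..n}"
    then have "rows s i \<subseteq> {..<?m}" "\<omega> i ((!) vs ` rows s i) < \<infinity>"
      using rb[OF i] by (auto simp: bases_def omega_oracle_def)
    moreover from this(1) have "(!) vs ` rows s i \<subseteq> V" unfolding vs(2)[symmetric] by auto
    ultimately show "output_state vs s i \<in> \<B> i" by (simp add: \<B>[OF i] effective_domain_def out[OF i])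
  qed
  have opt: "social_cost n \<omega> d (output_state vs s) \<le> social_cost n \<omega> d Y" if Y: "is_state n \<B> Y" for Y
  proof -
    let ?\<phi> = "\<lambda>v k. real k * d (vs ! v) k"
    have marg: "?\<phi> v k - ?\<phi> v (k - 1) = marginal ?\<Delta> v k" for v k
      by (simp add: marginal_def d_oracle_def)
    have "(\<Sum>i\<in>{1..n}. fs i (rows s i)) + (\<Sum>v\<in>{..<?m}. ?\<phi> v (congested {1..n} (rows s) v))
       \<le> (\<Sum>i\<in>{1..n}. fs i (pos (Y i))) + (\<Sum>v\<in>{..<?m}. ?\<phi> v (congested {1..n} (\<lambda>i. pos (Y i)) v))"
    proof (rule supports_imp_optimal)
      show "supported (\<lambda>v k. ?\<phi> v k - ?\<phi> v (k - 1)) p (rows s)" using sup by (simp only: marg)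
      show "?\<phi> v (Suc k) - ?\<phi> v k \<le> ?\<phi> v (Suc (Suc k)) - ?\<phi> v (Suc k)" if "v \<in> {..<?m}" for v k
        using marginal_mono[of v "Suc k"] marg[of "Suc k" v] marg[of "Suc (Suc k)" v] that by simp
    qed (use pos_base[OF Y] in \<open>auto simp: bases_def\<close>)
    then show ?thesis
      using social_cost_rows[where d = d, OF vs(1) omega_nonneg rb out]
        social_cost_rows[where d = d, OF vs(1) omega_nonneg pos_base(1)[OF Y] pos_base(2)[OF Y, symmetric]] by simp
  qed
  show ?thesis unfolding computes_social_optimum_def socially_optimal_def
    using ex state opt T m by (metis order_trans)
qed

theorem theorem18:
  "\<exists>(p::com) (C::nat) (k::nat).
     \<forall>(n::nat) (V::'v set) (vs::'v list) (\<B>::nat \<Rightarrow> 'v set set) (\<omega>::nat \<Rightarrow> 'v set \<Rightarrow> ereal)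
       (d::'v \<Rightarrow> nat \<Rightarrow> real) (X\<^sub>0::nat \<Rightarrow> 'v set).
       matroid_congestion_game n V \<B> \<omega> d \<longrightarrow>
       distinct vs \<longrightarrow> set vs = V \<longrightarrow>
       is_state n \<B> X\<^sub>0 \<longrightarrow>
       computes_social_optimum p (C * (card V + n + 1) ^ k) n vs \<B> \<omega> d X\<^sub>0"
proof -
  \<comment> \<open>The bound depends on the text of \<open>optimize\<close> only, so the constants
    serve all games.\<close>
  obtain C k where C: "\<And>W. W > 0 \<Longrightarrow> step_bound W optimize \<le> C * W ^ k"
    using step_bound_polynomial[of optimize] by blast
  show ?thesis
    by (rule exI[of _ optimize], rule exI[of _ C], rule exI[of _ k])
      (intro allI impI, rule optimize_computes_social_optimum, assumption+, rule C, simp)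
qed

end
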